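(* Let $\mathcal{F}=\{f_i\}_{i\in\mathbb{N}}$ be a frame for $\mathcal{H}$ with synthesis operator $F$ and optimal lower frame bound $A_{\mathcal{F}}$. Suppose that $\dim N(F)=n<\infty$ and let $C_{\mathcal{F}}=u_{n+1}(F)$. Then $$\alpha(\mathcal{F})=\min\big\{\max\{C_{\mathcal{F}}-1,\ 1-A_{\mathcal{F}}^{1/2}\},\ 1+m_e(F)\big\}.$$
   Context: $\mathcal{H}$ is a separable infinite dimensional complex Hilbert space and $\ell_2=\ell_2(\mathbb{N})$. A sequence $\mathcal{F}=\{f_i\}_{i\in\mathbb{N}}$ in $\mathcal{H}$ is a frame for $\mathcal{H}$ if there exist $A,B>0$ with $A\|f\|^2\le\sum_{i\in\mathbb{N}}|\langle f,f_i\rangle|^2\le B\|f\|^2$ for all $f\in\mathcal{H}$; the largest such $A$ is the optimal lower frame bound $A_{\mathcal{F}}$. The synthesis operator $F\in B(\ell_2,\mathcal{H})$ is $F((a_i)_{i\in\mathbb{N}})=\sum_i a_if_i$, and $N(F)$ is its nullspace. Define $$\alpha(\mathcal{F})=\inf\{\|FX^*-I\|:\ X\in B(\ell_2,\mathcal{H}),\ XX^*=I_{\mathcal{H}}\}$$ with $\|\cdot\|$ the operator norm. For a bounded operator $T$ put $|T|=(T^*T)^{1/2}$ and $m_e(T)=\min\sigma_e(|T|)$, where $\sigma_e$ denotes the essential spectrum. For a closed subspace $\mathcal{M}$ of the domain of $T$, $|T|_{\mathcal{M}}=P_{\mathcal{M}}|T|\,|_{\mathcal{M}}\in B(\mathcal{M})$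 denotes the compression of $|T|$ to $\mathcal{M}$ ($P_{\mathcal{M}}$ the orthogonal projection onto $\mathcal{M}$), and for $k\in\mathbb{N}$, $k\geq 1$, $$u_k(T)=\sup\{\min\sigma(|T|_{\mathcal{M}}):\ \dim\mathcal{M}=k\}.$$ For $T=F$ these are applied with $|F|=(F^*F)^{1/2}\in B(\ell_2)$. *)

theory Defs
  imports "HOL-Analysis.Analysis"
begin

section \<open>Complex Hilbert spaces\<close>

text \<open>The inner product is linear in its first argument.\<close>

class complex_inner = real_normed_vector +
  fixes scaleC :: "complex \<Rightarrow> 'a \<Rightarrow> 'a"  (infixr \<open>*\<^sub>C\<close> 75)
    and cinner :: "'a \<Rightarrow> 'a \<Rightarrow> complex"
  assumes scaleC_add_right: "c *\<^sub>C (x + y) = c *\<^sub>C x + c *\<^sub>C y"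
    and scaleC_add_left: "(c + d) *\<^sub>C x = c *\<^sub>C x + d *\<^sub>C x"
    and scaleC_scaleC: "c *\<^sub>C d *\<^sub>C x = (c * d) *\<^sub>C x"
    and scaleC_one: "1 *\<^sub>C x = x"
    and scaleR_scaleC: "r *\<^sub>R x = complex_of_real r *\<^sub>C x"
    and cinner_commute: "cinner x y = cnj (cinner y x)"
    and cinner_add_left: "cinner (x + y) z = cinner x z + cinner y z"
    and cinner_scaleC_left: "cinner (c *\<^sub>C x) y = c * cinner x y"
    and cinner_self_norm: "cinner x x = complex_of_real ((norm x)\<^sup>2)"

class chilbert_space = complex_inner + complete_space

global_interpretation complex_vector:
  vector_space "scaleC :: complex \<Rightarrow> 'a \<Rightarrow> 'a::complex_inner"
  defines csubspace = complex_vector.subspace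
    and cspan = complex_vector.span
    and cdependent = complex_vector.dependent
  by unfold_locales (simp_all add: scaleC_add_right scaleC_add_left scaleC_scaleC scaleC_one)

text \<open>The library's \<open>dim\<close> is \<open>0\<close> on infinite-dimensional spaces, so dimension is a relation here.\<close>

definition has_cdim :: "'a::complex_inner set \<Rightarrow> nat \<Rightarrow> bool" where
  "has_cdim M n \<longleftrightarrow>
     (\<exists>B. finite B \<and> card B = n \<and> \<not> cdependent B \<and> cspan B = M)"

definition finite_cdim :: "'a::complex_inner set \<Rightarrow> bool" where
  "finite_cdim M \<longleftrightarrow> (\<exists>n. has_cdim M n)"


section \<open>The space of square-summable complex sequences\<close>

typedef ell2 = "{a :: nat \<Rightarrow> complex. summable (\<lambda>i. (cmod (a i))\<^sup>2)}"
  morphisms coord Abs_ell2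
  by (rule exI[of _ "\<lambda>_. 0"]) simp

lemma ell2_eqI: "(\<And>i. coord x i = coord y i) \<Longrightarrow> x = y"
  by (simp add: coord_inject[symmetric] ext)

lemma summable_coord: "summable (\<lambda>i. (cmod (coord x i))\<^sup>2)"
  using coord[of x] by simp

lemma coord_Abs: "summable (\<lambda>i. (cmod (a i))\<^sup>2) \<Longrightarrow> coord (Abs_ell2 a) = a"
  by (simp add: Abs_ell2_inverse)

lemma summable_sq_add:
  assumes "summable (\<lambda>i. (cmod (a i))\<^sup>2)" "summable (\<lambda>i. (cmod (b i))\<^sup>2)"
  shows "summable (\<lambda>i. (cmod (a i + b i))\<^sup>2)"
proof (rule summable_comparison_test')
  show "summable (\<lambda>i. 2 * (cmod (a i))\<^sup>2 + 2 * (cmod (b i))\<^sup>2)"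
    by (intro summable_add summable_mult assms)
  fix i
  have "(cmod (a i + b i))\<^sup>2 \<le> (cmod (a i) + cmod (b i))\<^sup>2"
    by (intro power_mono norm_triangle_ineq) simp
  also have "\<dots> \<le> 2 * (cmod (a i))\<^sup>2 + 2 * (cmod (b i))\<^sup>2"
    using zero_le_power2[of "cmod (a i) - cmod (b i)"] by (simp add: power2_eq_square algebra_simps)
  finally show "norm ((cmod (a i + b i))\<^sup>2) \<le> 2 * (cmod (a i))\<^sup>2 + 2 * (cmod (b i))\<^sup>2" by simp
qed

lemma summable_sq_scale:
  "summable (\<lambda>i. (cmod (a i))\<^sup>2) \<Longrightarrow> summable (\<lambda>i. (cmod (c * a i))\<^sup>2)"
  by (simp add: norm_mult power_mult_distrib summable_mult)

lemma summable_sq_prod: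
  assumes "summable (\<lambda>i. (cmod (a i))\<^sup>2)" "summable (\<lambda>i. (cmod (b i))\<^sup>2)"
  shows "summable (\<lambda>i. a i * cnj (b i))"
proof (rule summable_comparison_test')
  show "summable (\<lambda>i. (cmod (a i))\<^sup>2 + (cmod (b i))\<^sup>2)"
    by (intro summable_add assms)
  fix i
  have "2 * (cmod (a i) * cmod (b i)) \<le> (cmod (a i))\<^sup>2 + (cmod (b i))\<^sup>2"
    using zero_le_power2[of "cmod (a i) - cmod (b i)"] by (simp add: power2_eq_square algebra_simps)
  moreover have "0 \<le> cmod (a i) * cmod (b i)" by simp
  ultimately show "norm (a i * cnj (b i)) \<le> (cmod (a i))\<^sup>2 + (cmod (b i))\<^sup>2"
    by (simp only: norm_mult complex_mod_cnj)
qed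

instantiation ell2 :: real_normed_vector
begin

definition "0 = Abs_ell2 (\<lambda>_. 0)"
definition "x + y = Abs_ell2 (\<lambda>i. coord x i + coord y i)"
definition "- x = Abs_ell2 (\<lambda>i. - coord x i)"
definition "x - y = Abs_ell2 (\<lambda>i. coord x i - coord y i)"
definition "r *\<^sub>R x = Abs_ell2 (\<lambda>i. complex_of_real r * coord x i)"
definition "norm x = sqrt (\<Sum>i. (cmod (coord x i))\<^sup>2)"
definition "sgn (x::ell2) = inverse (norm x) *\<^sub>R x"
definition "dist (x::ell2) y = norm (x - y)"
definition [code del]: "(uniformity :: (ell2 \<times> ell2) filter) =
  (INF e\<in>{0<..}. principal {(x, y). dist x y < e})"
definition [code del]: "open (U :: ell2 set) \<longleftrightarrow>
  (\<forall>x\<in>U. eventually (\<lambda>(x', y). x' = x \<longrightarrow> y \<in> U) uniformity)"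

lemma coord_zero: "coord 0 i = 0"
  by (simp add: zero_ell2_def coord_Abs)

lemma coord_add: "coord (x + y) i = coord x i + coord y i"
  by (simp add: plus_ell2_def coord_Abs summable_sq_add summable_coord)

lemma coord_uminus: "coord (- x) i = - coord x i"
  by (simp add: uminus_ell2_def coord_Abs summable_coord)

lemma coord_diff: "coord (x - y) i = coord x i - coord y i"
  using summable_sq_add[of "coord x" "\<lambda>i. - coord y i"]
  by (simp add: minus_ell2_def coord_Abs summable_coord)

lemma coord_scaleR: "coord (r *\<^sub>R x) i = complex_of_real r * coord x i"
  unfolding scaleR_ell2_def by (subst coord_Abs) (auto intro!: summable_sq_scale summable_coord)

lemma norm_ell2_sq: "(norm x)\<^sup>2 = (\<Sum>i. (cmod (coord x i))\<^sup>2)" for x :: ell2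
  by (simp add: norm_ell2_def suminf_nonneg summable_coord)

lemma norm_ell2_nonneg: "0 \<le> norm x" for x :: ell2
  by (simp add: norm_ell2_def suminf_nonneg summable_coord)

lemma L2_set_le_norm: "L2_set (\<lambda>i. cmod (coord x i)) {..<k} \<le> norm x"
  unfolding L2_set_def norm_ell2_def
  by (intro real_sqrt_le_mono sum_le_suminf summable_coord) auto

lemma norm_leI:
  assumes "\<And>k. L2_set (\<lambda>i. cmod (coord x i)) {..<k} \<le> r" "0 \<le> r"
  shows "norm x \<le> r"
proof -
  have "(\<Sum>i<k. (cmod (coord x i))\<^sup>2) \<le> r\<^sup>2" for k
    using assms(1)[of k] assms(2) unfolding L2_set_def by (simp add: sqrt_le_D)
  then have "(norm x)\<^sup>2 \<le> r\<^sup>2"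
    unfolding norm_ell2_sq by (intro suminf_le_const summable_coord)
  then show ?thesis using assms(2) by (rule power2_le_imp_le)
qed

instance
proof
  fix x y z :: ell2 and r s :: real
  show "x + y + z = x + (y + z)" "x + y = y + x" "0 + x = x" "- x + x = 0" "x - y = x + - y"
    by (auto intro!: ell2_eqI simp: coord_zero coord_add coord_uminus coord_diff)
  show "r *\<^sub>R (x + y) = r *\<^sub>R x + r *\<^sub>R y" "(r + s) *\<^sub>R x = r *\<^sub>R x + s *\<^sub>R x"
    "r *\<^sub>R s *\<^sub>R x = (r * s) *\<^sub>R x" "1 *\<^sub>R x = x"
    by (auto intro!: ell2_eqI simp: coord_add coord_scaleR algebra_simps)
  show "dist x y = norm (x - y)" "sgn x = inverse (norm x) *\<^sub>R x"
    by (rule dist_ell2_def sgn_ell2_def)+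
  show "(uniformity :: (ell2 \<times> ell2) filter) = (INF e\<in>{0<..}. principal {(x, y). dist x y < e})"
    by (rule uniformity_ell2_def)
  show "open U \<longleftrightarrow> (\<forall>x\<in>U. eventually (\<lambda>(x', y). x' = x \<longrightarrow> y \<in> U) uniformity)"
    for U :: "ell2 set" by (rule open_ell2_def)
  show "norm x = 0 \<longleftrightarrow> x = 0"
  proof
    assume "norm x = 0"
    then have "(\<Sum>i. (cmod (coord x i))\<^sup>2) = 0" by (simp add: norm_ell2_def)
    then have "\<forall>i. (cmod (coord x i))\<^sup>2 = 0"
      by (subst (asm) suminf_eq_zero_iff) (auto intro: summable_coord)
    then show "x = 0" by (auto intro!: ell2_eqI simp: coord_zero)
  qed (simp add: norm_ell2_def coord_zero)
  show "norm (x + y) \<le> norm x + norm y"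
  proof (rule norm_leI)
    fix k
    have "L2_set (\<lambda>i. cmod (coord (x + y) i)) {..<k}
        \<le> L2_set (\<lambda>i. cmod (coord x i) + cmod (coord y i)) {..<k}"
      by (rule L2_set_mono) (auto simp: coord_add norm_triangle_ineq)
    also have "\<dots> \<le> L2_set (\<lambda>i. cmod (coord x i)) {..<k} + L2_set (\<lambda>i. cmod (coord y i)) {..<k}"
      by (rule L2_set_triangle_ineq)
    also have "\<dots> \<le> norm x + norm y" by (intro add_mono L2_set_le_norm)
    finally show "L2_set (\<lambda>i. cmod (coord (x + y) i)) {..<k} \<le> norm x + norm y" .
  qed (simp add: norm_ell2_nonneg)
  show "norm (r *\<^sub>R x) = \<bar>r\<bar> * norm x"
    by (simp add: norm_ell2_def coord_scaleR norm_mult power_mult_distrib suminf_mult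
        summable_coord real_sqrt_mult)
qed

end

instantiation ell2 :: chilbert_space
begin

definition "c *\<^sub>C x = Abs_ell2 (\<lambda>i. c * coord x i)"
definition "cinner x y = (\<Sum>i. coord x i * cnj (coord y i))"

lemma coord_scaleC: "coord (c *\<^sub>C x) i = c * coord x i"
  unfolding scaleC_ell2_def by (subst coord_Abs) (auto intro!: summable_sq_scale summable_coord)

lemma ell2_Cauchy_convergent:
  fixes X :: "nat \<Rightarrow> ell2"
  assumes "Cauchy X"
  shows "convergent X"
proof -
  have coord_le: "cmod (coord x i) \<le> norm x" for x :: ell2 and i
  proof -
    have "cmod (coord x i) \<le> L2_set (\<lambda>i. cmod (coord x i)) {..<Suc i}"
      by (rule member_le_L2_set) auto
    then show ?thesis using L2_set_le_norm[of x "Suc i"] by linarith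
  qed
  have "Cauchy (\<lambda>n. coord (X n) i)" for i
  proof (rule metric_CauchyI)
    fix e :: real assume "0 < e"
    then obtain M where "\<forall>m\<ge>M. \<forall>n\<ge>M. dist (X m) (X n) < e"
      using assms metric_CauchyD by blast
    then show "\<exists>M. \<forall>m\<ge>M. \<forall>n\<ge>M. dist (coord (X m) i) (coord (X n) i) < e"
      using coord_le[of "X m - X n" i for m n]
      by (intro exI[of _ M]) (metis coord_diff dist_norm le_less_trans)
  qed
  then have "\<forall>i. \<exists>l. (\<lambda>n. coord (X n) i) \<longlonglongrightarrow> l"
    by (auto simp: Cauchy_convergent_iff convergent_def)
  then obtain a where a: "\<And>i. (\<lambda>n. coord (X n) i) \<longlonglongrightarrow> a i" by metis
  have key: "\<exists>M. \<forall>m\<ge>M. \<forall>k. L2_set (\<lambda>i. cmod (coord (X m) i - a i)) {..<k} \<le> e"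
    if "0 < e" for e
  proof -
    obtain M where M: "\<And>m n. m \<ge> M \<Longrightarrow> n \<ge> M \<Longrightarrow> dist (X m) (X n) < e"
      using assms metric_CauchyD[OF _ \<open>0 < e\<close>] by blast
    have "L2_set (\<lambda>i. cmod (coord (X m) i - a i)) {..<k} \<le> e" if "m \<ge> M" for m k
    proof (rule tendsto_upperbound)
      show "(\<lambda>n. L2_set (\<lambda>i. cmod (coord (X m) i - coord (X n) i)) {..<k})
          \<longlonglongrightarrow> L2_set (\<lambda>i. cmod (coord (X m) i - a i)) {..<k}"
        unfolding L2_set_def by (intro tendsto_intros a)
      show "\<forall>\<^sub>F n in sequentially. L2_set (\<lambda>i. cmod (coord (X m) i - coord (X n) i)) {..<k} \<le> e"
        using eventually_ge_at_top[of M]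
      proof eventually_elim
        case (elim n)
        then show ?case
          using M[OF that elim] L2_set_le_norm[of "X m - X n" k] by (simp add: coord_diff dist_norm)
      qed
    qed simp
    then show ?thesis by blast
  qed
  obtain M where M: "\<And>k. L2_set (\<lambda>i. cmod (coord (X M) i - a i)) {..<k} \<le> 1"
    using key[of 1] by fastforce
  have "summable (\<lambda>i. (cmod (coord (X M) i - a i))\<^sup>2)"
  proof (rule summableI_nonneg_bounded)
    show "(\<Sum>i<k. (cmod (coord (X M) i - a i))\<^sup>2) \<le> 1" for k
      using M[of k] by (simp add: L2_set_def)
  qed auto
  from summable_sq_add[OF summable_sq_scale[OF this, of "-1"] summable_coord[of "X M"]]
  have "summable (\<lambda>i. (cmod (a i))\<^sup>2)" by simp
  then have c: "coord (Abs_ell2 a) = a" by (rule coord_Abs)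
  have "X \<longlonglongrightarrow> Abs_ell2 a"
  proof (rule metric_LIMSEQ_I)
    fix e :: real assume "0 < e"
    then obtain M where M: "\<And>m k. m \<ge> M \<Longrightarrow> L2_set (\<lambda>i. cmod (coord (X m) i - a i)) {..<k} \<le> e / 2"
      using key[of "e / 2"] by auto
    have "dist (X m) (Abs_ell2 a) < e" if "m \<ge> M" for m
    proof -
      have "norm (X m - Abs_ell2 a) \<le> e / 2"
        using M[OF that] \<open>0 < e\<close> by (intro norm_leI) (auto simp: coord_diff c)
      then show ?thesis using \<open>0 < e\<close> by (simp add: dist_norm)
    qed
    then show "\<exists>M. \<forall>m\<ge>M. dist (X m) (Abs_ell2 a) < e" by blast
  qed
  then show ?thesis by (auto simp: convergent_def)
qed

instance
proof
  fix x y z :: ell2 and c d :: complex and r :: real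
  show "c *\<^sub>C (x + y) = c *\<^sub>C x + c *\<^sub>C y" "(c + d) *\<^sub>C x = c *\<^sub>C x + d *\<^sub>C x"
    "c *\<^sub>C d *\<^sub>C x = (c * d) *\<^sub>C x" "1 *\<^sub>C x = x" "r *\<^sub>R x = complex_of_real r *\<^sub>C x"
    by (auto intro!: ell2_eqI simp: coord_add coord_scaleC coord_scaleR algebra_simps)
  note s = summable_sq_prod[OF summable_coord summable_coord]
  show "cinner x y = cnj (cinner y x)"
    unfolding cinner_ell2_def
    using summable_sums[OF s[of y x]]
    by (subst (asm) sums_cnj[symmetric]) (simp add: sums_iff mult.commute)
  show "cinner (x + y) z = cinner x z + cinner y z"
    by (simp add: cinner_ell2_def coord_add distrib_right suminf_add s)
  show "cinner (c *\<^sub>C x) y = c * cinner x y"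
    by (simp add: cinner_ell2_def coord_scaleC mult.assoc suminf_mult s)
  show "cinner x x = complex_of_real ((norm x)\<^sup>2)"
    using sums_of_real[OF summable_sums[OF summable_coord[of x]], where 'a = complex]
    by (simp add: cinner_ell2_def norm_ell2_sq sums_iff complex_norm_square del: of_real_power)
  show "Cauchy X \<Longrightarrow> convergent X" for X :: "nat \<Rightarrow> ell2"
    by (rule ell2_Cauchy_convergent)
qed

end


section \<open>Bounded operators\<close>

definition bounded_clinear :: "('a::complex_inner \<Rightarrow> 'b::complex_inner) \<Rightarrow> bool" where
  "bounded_clinear T \<longleftrightarrow> bounded_linear T \<and> (\<forall>c x. T (c *\<^sub>C x) = c *\<^sub>C T x)"

definition cadjoint :: "('a::chilbert_space \<Rightarrow> 'b::chilbert_space) \<Rightarrow> 'b \<Rightarrow> 'a" where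
  "cadjoint T = (THE S. bounded_clinear S \<and> (\<forall>x y. cinner (T x) y = cinner x (S y)))"

definition positive_op :: "('a::chilbert_space \<Rightarrow> 'a) \<Rightarrow> bool" where
  "positive_op P \<longleftrightarrow> bounded_clinear P \<and> (\<forall>x. cinner (P x) x \<in> \<real>\<^sub>\<ge>\<^sub>0)"

definition op_sqrt :: "('a::chilbert_space \<Rightarrow> 'a) \<Rightarrow> 'a \<Rightarrow> 'a" where
  "op_sqrt S = (THE P. positive_op P \<and> P \<circ> P = S)"

definition op_abs :: "('a::chilbert_space \<Rightarrow> 'b::chilbert_space) \<Rightarrow> 'a \<Rightarrow> 'a" where
  "op_abs T = op_sqrt (cadjoint T \<circ> T)"

definition orth_proj :: "'a::chilbert_space set \<Rightarrow> 'a \<Rightarrow> 'a" where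
  "orth_proj M x = (THE y. y \<in> M \<and> (\<forall>z\<in>M. cinner (x - y) z = 0))"

text \<open>
  The spectrum of \<open>S\<close> as an element of \<open>B(M)\<close>, where \<open>M\<close> is a closed subspace mapped into
  itself by \<open>S\<close>. Every bounded operator on \<open>M\<close> is the restriction of a bounded operator \<open>R\<close> on
  the whole space, so ranging over the latter loses no candidate inverse.
\<close>

definition spectrum_on :: "'a::chilbert_space set \<Rightarrow> ('a \<Rightarrow> 'a) \<Rightarrow> complex set" where
  "spectrum_on M S = {\<mu>. \<not> (\<exists>R. bounded_clinear R \<and>
     (\<forall>x\<in>M. R x \<in> M \<and> R (S x - \<mu> *\<^sub>C x) = x \<and> S (R x) - \<mu> *\<^sub>C R x = x))}"

definition compression :: "'a::chilbert_space set \<Rightarrow> ('a \<Rightarrow> 'a) \<Rightarrow> 'a \<Rightarrow> 'a" where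
  "compression M S = (\<lambda>x. orth_proj M (S x))"

definition fredholm :: "('a::chilbert_space \<Rightarrow> 'b::chilbert_space) \<Rightarrow> bool" where
  "fredholm T \<longleftrightarrow> bounded_clinear T \<and> finite_cdim {x. T x = 0} \<and> closed (range T) \<and>
     (\<exists>B. finite B \<and> (\<forall>y. \<exists>x. y - T x \<in> cspan B))"

definition ess_spectrum :: "('a::chilbert_space \<Rightarrow> 'a) \<Rightarrow> complex set" where
  "ess_spectrum S = {\<mu>. \<not> fredholm (\<lambda>x. S x - \<mu> *\<^sub>C x)}"

text \<open>Minimum of a set of complex numbers that consists of real ones (spectra of positive operators).\<close>

definition real_min :: "complex set \<Rightarrow> real" where
  "real_min \<Lambda> = (LEAST r. complex_of_real r \<in> \<Lambda>)"

definition ess_min_modulus :: "('a::chilbert_space \<Rightarrow> 'b::chilbert_space) \<Rightarrow> real" where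
  "ess_min_modulus T = real_min (ess_spectrum (op_abs T))"

definition u_number :: "nat \<Rightarrow> ('a::chilbert_space \<Rightarrow> 'b::chilbert_space) \<Rightarrow> real" where
  "u_number k T =
     Sup {real_min (spectrum_on M (compression M (op_abs T))) | M. has_cdim M k}"


section \<open>Frames\<close>

text \<open>
  In the first two definitions, summability must be required separately: \<open>suminf\<close> of a divergent
  series is an unspecified real number, not infinity.
\<close>

definition is_frame :: "(nat \<Rightarrow> 'h::chilbert_space) \<Rightarrow> bool" where
  "is_frame f \<longleftrightarrow> (\<exists>A>0. \<exists>B>0. \<forall>x.
     summable (\<lambda>i. (cmod (cinner x (f i)))\<^sup>2) \<and>
     A * (norm x)\<^sup>2 \<le> (\<Sum>i. (cmod (cinner x (f i)))\<^sup>2) \<and>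
     (\<Sum>i. (cmod (cinner x (f i)))\<^sup>2) \<le> B * (norm x)\<^sup>2)"

definition optimal_lower_bound :: "(nat \<Rightarrow> 'h::chilbert_space) \<Rightarrow> real" where
  "optimal_lower_bound f = (GREATEST A. 0 < A \<and> (\<forall>x.
     summable (\<lambda>i. (cmod (cinner x (f i)))\<^sup>2) \<and>
     A * (norm x)\<^sup>2 \<le> (\<Sum>i. (cmod (cinner x (f i)))\<^sup>2)))"

definition synthesis :: "(nat \<Rightarrow> 'h::chilbert_space) \<Rightarrow> ell2 \<Rightarrow> 'h" where
  "synthesis f a = (\<Sum>i. coord a i *\<^sub>C f i)"

definition frame_alpha :: "(nat \<Rightarrow> 'h::chilbert_space) \<Rightarrow> real" where
  "frame_alpha f = Inf {onorm (\<lambda>h. synthesis f (cadjoint X h) - h) | X :: ell2 \<Rightarrow> 'h.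
     bounded_clinear X \<and> X \<circ> cadjoint X = id}"

end

theory Submission
  imports Defs
begin

text \<open>
  Put \<open>V = X\<^sup>*\<close>, an isometry, so that \<open>\<alpha>\<close> is the distance from the identity to the operators \<open>F V\<close>.
  Testing the adjoint on almost minimisers of \<open>norm (F\<^sup>* h)\<close> gives \<open>norm (F V - 1) \<ge> 1 - A\<^sup>1\<^sup>/\<^sup>2\<close> always.
  If \<open>norm (F V - 1) < 1 + m\<close> with \<open>m\<close> the essential minimum modulus, then
  \<open>F V + \<kappa> = (F + \<kappa> V\<^sup>*) V\<close> is invertible for some \<open>0 \<le> \<kappa> < m\<close>, so the range of \<open>V\<close> and the kernel of
  \<open>F + \<kappa> V\<^sup>*\<close> are complementary. By stability of the index, that kernel has dimension at most \<open>n\<close>. The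
  range of \<open>V\<close> therefore meets every subspace of dimension \<open>n + 1\<close>, and \<open>norm (F V - 1) \<ge> C - 1\<close>.

  Conversely, write \<open>F = T U\<close> with \<open>T\<close> the square root of \<open>F F\<^sup>*\<close> and \<open>U\<close> a coisometry. If \<open>V\<close> maps onto
  the span of orthonormal vectors on which \<open>F\<close> has norm nearly \<open>m\<close> and orthogonal images, then
  \<open>norm (F V - 1)\<close> is nearly at most \<open>1 + m\<close>. For \<open>c > C\<close> the operator \<open>T\<close> exceeds \<open>c\<close> only on a
  subspace of dimension at most \<open>n\<close>; the \<open>n\<close> dimensions of the kernel of \<open>F\<close> leave enough room to
  choose \<open>V\<close> with \<open>F V = min T c\<close>.
\<close>

text \<open>Forms replace spectral projections throughout. \<open>u_number\<close> is a supremum of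
  infima of \<open>Re (cinner (G x) x)\<close>, and \<open>m\<close> is the supremum of the lower
  bounds of \<open>F\<close> on the sets \<open>cortho L\<close> with \<open>L\<close> finite, which
  stand for the subspaces of finite codimension. Bounded inverses come from coercivity alone
  (\<open>Lax_Milgram\<close>).

  The bound \<open>C - 1\<close> cannot hold for every isometry: one whose range has infinite
  codimension may miss the \<open>n + 1\<close> directions in which \<open>F\<close> is large.
  Closeness below \<open>1 + m\<close> rules this out. It leaves room for some
  \<open>\<kappa> < m\<close> that makes \<open>F V + \<kappa>\<close> coercive, and
  \<open>\<kappa> < m\<close> is also the condition under which \<open>F + \<kappa> X\<close> stays
  bounded below on a subspace of finite codimension and so keeps the index \<open>n\<close> of
  \<open>F\<close>. No index is defined: \<open>Th\<close> composed with
  \<open>F + \<kappa> X\<close> is coercive up to finite rank, which reduces the matter to counting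
  dimensions in a finite-dimensional space.\<close>

instance chilbert_space \<subseteq> banach ..

section \<open>Inner products and orthogonal projections\<close>

lemma cinner_add_right: "cinner x (y + z) = cinner x y + cinner x z"
  by (metis cinner_add_left cinner_commute complex_cnj_add)

lemma cinner_scaleC_right: "cinner x (c *\<^sub>C y) = cnj c * cinner x y"
  by (metis cinner_commute cinner_scaleC_left complex_cnj_mult)

lemma cinner_zero_left [simp]: "cinner 0 y = 0"
  using cinner_add_left[of 0 0 y] by simp

lemma cinner_zero_right [simp]: "cinner x 0 = 0"
  using cinner_add_right[of x 0 0] by simp

lemma cinner_minus_left [simp]: "cinner (- x) y = - cinner x y"
  using cinner_add_left[of x "- x" y] by (simp add: eq_neg_iff_add_eq_0 add.commute)

lemma cinner_minus_right [simp]: "cinner x (- y) = - cinner x y"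
  using cinner_add_right[of x y "- y"] by (simp add: eq_neg_iff_add_eq_0 add.commute)

lemma cinner_diff_left: "cinner (x - y) z = cinner x z - cinner y z"
  using cinner_add_left[of x "- y" z] by simp

lemma cinner_diff_right: "cinner x (y - z) = cinner x y - cinner x z"
  using cinner_add_right[of x y "- z"] by simp

lemma cinner_scaleR_left: "cinner (r *\<^sub>R x) y = complex_of_real r * cinner x y"
  by (simp add: scaleR_scaleC cinner_scaleC_left)

lemma cinner_scaleR_right: "cinner x (r *\<^sub>R y) = complex_of_real r * cinner x y"
  by (simp add: scaleR_scaleC cinner_scaleC_right)

lemma cinner_sum_left: "cinner (sum g A) y = (\<Sum>a\<in>A. cinner (g a) y)"
  by (induction A rule: infinite_finite_induct) (simp_all add: cinner_add_left)

lemma cinner_sum_right: "cinner x (sum g A) = (\<Sum>a\<in>A. cinner x (g a))"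
  by (induction A rule: infinite_finite_induct) (simp_all add: cinner_add_right)

lemmas cinner_simps = cinner_add_left cinner_add_right cinner_diff_left cinner_diff_right
  cinner_scaleC_left cinner_scaleC_right cinner_scaleR_left cinner_scaleR_right

lemma norm_sq_cinner: "(norm x)\<^sup>2 = Re (cinner x x)"
  by (simp add: cinner_self_norm)

lemma cinner_eq_zero_iff [simp]: "cinner x x = 0 \<longleftrightarrow> x = 0"
  by (simp add: cinner_self_norm)

lemma Re_cinner_commute: "Re (cinner x y) = Re (cinner y x)"
  by (subst cinner_commute) simp

lemma cinner_zero_commute: "cinner x y = 0 \<longleftrightarrow> cinner y x = 0"
  by (metis cinner_commute complex_cnj_zero)

lemma norm_add_sq: "(norm (x + y))\<^sup>2 = (norm x)\<^sup>2 + 2 * Re (cinner x y) + (norm y)\<^sup>2"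
  using Re_cinner_commute[of y x] by (simp add: norm_sq_cinner cinner_simps)

lemma norm_diff_sq: "(norm (x - y))\<^sup>2 = (norm x)\<^sup>2 - 2 * Re (cinner x y) + (norm y)\<^sup>2"
  using norm_add_sq[of x "- y"] by simp

lemma norm_scaleC: "norm (c *\<^sub>C x) = cmod c * norm x"
proof -
  have "complex_of_real ((norm (c *\<^sub>C x))\<^sup>2) = c * cnj c * cinner x x"
    by (simp only: cinner_self_norm[symmetric] cinner_simps mult_ac)
  also have "\<dots> = complex_of_real ((cmod c * norm x)\<^sup>2)"
    by (simp add: cinner_self_norm complex_norm_square[symmetric] power_mult_distrib)
  finally have "(norm (c *\<^sub>C x))\<^sup>2 = (cmod c * norm x)\<^sup>2"
    by (simp only: of_real_eq_iff)
  then show ?thesis by (simp add: power2_eq_iff_nonneg)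
qed

text \<open>Every Cauchy--Schwarz inequality below is drawn from this, those for semidefinite forms
  included; hence the sign of \<open>c\<close> is derived, and \<open>c = 0\<close> gets its own
  argument.\<close>

lemma quadratic_nonneg_imp_discriminant_le:
  fixes a b c :: real
  assumes "\<And>s. 0 \<le> a + 2 * s * b + s\<^sup>2 * c"
  shows "b\<^sup>2 \<le> a * c"
proof (cases "c = 0")
  case True
  have "b = 0"
  proof (rule ccontr)
    assume "b \<noteq> 0"
    then show False using assms[of "- (a + 1) / (2 * b)"] True by (simp add: field_simps)
  qed
  then show ?thesis using True by simp
next
  case False
  have "0 \<le> c"
  proof (rule ccontr)
    assume c: "\<not> 0 \<le> c"
    \<comment> \<open>Adding the inequalities at \<open>s\<close> and \<open>- s\<close> removes the
      linear term; a negative \<open>c\<close> then loses for large \<open>s\<close>.\<close>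
    then have *: "0 \<le> a + s\<^sup>2 * c" for s using assms[of s] assms[of "- s"] by (simp only: power2_minus)
    have "a \<ge> 0" using *[of 0] by simp
    then show False using *[of "sqrt ((a + 1) / - c)"] c by (simp add: field_simps)
  qed
  with False have "c > 0" by simp
  have "0 \<le> a + 2 * (- b / c) * b + (- b / c)\<^sup>2 * c" by (rule assms)
  also have "\<dots> = a - b\<^sup>2 / c" using \<open>c > 0\<close> by (simp add: field_simps power2_eq_square)
  finally show ?thesis using \<open>c > 0\<close> by (simp add: field_simps)
qed

lemma Re_cinner_le: "\<bar>Re (cinner x y)\<bar> \<le> norm x * norm y"
proof -
  have "(Re (cinner x y))\<^sup>2 \<le> (norm x)\<^sup>2 * (norm y)\<^sup>2"
  proof (rule quadratic_nonneg_imp_discriminant_le)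
    fix s :: real
    have "0 \<le> (norm (x + s *\<^sub>R y))\<^sup>2" by simp
    then show "0 \<le> (norm x)\<^sup>2 + 2 * s * Re (cinner x y) + s\<^sup>2 * (norm y)\<^sup>2"
      by (simp add: norm_add_sq cinner_simps power_mult_distrib)
  qed
  then show ?thesis
    by (metis abs_le_square_iff abs_mult abs_norm_cancel power_mult_distrib)
qed

lemma Cauchy_Schwarz_cinner: "cmod (cinner x y) \<le> norm x * norm y"
proof (cases "cinner x y = 0")
  case False
  \<comment> \<open>A unimodular factor that turns the inner product into its modulus, so the
    estimate for real parts applies.\<close>
  define c where "c = cnj (cinner x y) / cmod (cinner x y)"
  have "cmod c = 1" using False by (simp add: c_def norm_divide)
  have "Re (cinner (c *\<^sub>C x) y) = cmod (cinner x y)"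
    using False by (simp add: c_def cinner_simps complex_norm_square[symmetric] mult.commute
        power2_eq_square flip: complex_norm_square)
  moreover have "\<bar>Re (cinner (c *\<^sub>C x) y)\<bar> \<le> norm (c *\<^sub>C x) * norm y" by (rule Re_cinner_le)
  ultimately show ?thesis using \<open>cmod c = 1\<close> by (simp add: norm_scaleC)
qed auto

lemma bounded_bilinear_cinner: "bounded_bilinear (cinner :: 'a::complex_inner \<Rightarrow> 'a \<Rightarrow> complex)"
proof
  show "\<exists>K. \<forall>a b. norm (cinner a (b::'a)) \<le> norm a * norm b * K"
    using Cauchy_Schwarz_cinner by (intro exI[of _ 1]) auto
qed (simp_all add: cinner_simps scaleR_conv_of_real)

lemmas tendsto_cinner [tendsto_intros] = bounded_bilinear.tendsto[OF bounded_bilinear_cinner]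
lemmas bounded_linear_cinner_left = bounded_bilinear.bounded_linear_left[OF bounded_bilinear_cinner]

lemma bounded_linear_scaleC: "bounded_linear (\<lambda>x::'a::complex_inner. c *\<^sub>C x)"
proof (rule bounded_linear_intro)
  fix x y :: 'a and r :: real
  show "c *\<^sub>C (x + y) = c *\<^sub>C x + c *\<^sub>C y" by (rule scaleC_add_right)
  show "c *\<^sub>C r *\<^sub>R x = r *\<^sub>R c *\<^sub>C x" by (simp add: scaleR_scaleC scaleC_scaleC mult.commute)
  show "norm (c *\<^sub>C x) \<le> norm x * cmod c" by (simp add: norm_scaleC)
qed

lemmas tendsto_scaleC [tendsto_intros] = bounded_linear.tendsto[OF bounded_linear_scaleC]

lemma cinner_eqI': "(\<And>z. cinner z x = cinner z y) \<Longrightarrow> x = y"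
  using cinner_eq_zero_iff[of "x - y"] by (simp only: cinner_diff_right eq_iff_diff_eq_0[of x y]) simp

lemma csubspace_scaleR: "csubspace M \<Longrightarrow> x \<in> M \<Longrightarrow> r *\<^sub>R x \<in> M"
  by (simp add: scaleR_scaleC complex_vector.subspace_scale)

text \<open>A minimising sequence for the distance is Cauchy by the parallelogram law, because
  midpoints stay in \<open>M\<close>. Minimality along lines through the limit gives
  orthogonality.\<close>

lemma projection_exists:
  fixes M :: "'a::chilbert_space set"
  assumes M: "csubspace M" "closed M"
  shows "\<exists>y\<in>M. \<forall>z\<in>M. cinner (x - y) z = 0"
proof -
  define d where "d = Inf ((\<lambda>y. (norm (x - y))\<^sup>2) ` M)"
  have bdd: "bdd_below ((\<lambda>y. (norm (x - y))\<^sup>2) ` M)" by (intro bdd_belowI[of _ 0]) auto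
  have d_le: "d \<le> (norm (x - y))\<^sup>2" if "y \<in> M" for y
    unfolding d_def using bdd that by (intro cInf_lower) auto
  have "0 \<in> M" using M by (simp add: complex_vector.subspace_0)
  have "\<exists>y\<in>M. (norm (x - y))\<^sup>2 < d + 1 / Suc k" for k
  proof -
    have "d < d + 1 / Suc k" by simp
    then show ?thesis using \<open>0 \<in> M\<close> unfolding d_def by (subst (asm) cInf_less_iff[OF _ bdd]) auto
  qed
  then obtain y where y: "\<And>k. y k \<in> M" "\<And>k. (norm (x - y k))\<^sup>2 < d + 1 / Suc k" by metis
  have par: "(norm (y j - y k))\<^sup>2 \<le> 2 / Suc j + 2 / Suc k" for j k
  proof -
    have "(1/2) *\<^sub>R (y j + y k) \<in> M"
      using M y by (intro csubspace_scaleR complex_vector.subspace_add)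
    then have "d \<le> (norm (x - (1/2) *\<^sub>R (y j + y k)))\<^sup>2" by (rule d_le)
    moreover have "4 * (norm (x - (1/2) *\<^sub>R (y j + y k)))\<^sup>2 = (norm ((x - y j) + (x - y k)))\<^sup>2"
    proof -
      have "(x - y j) + (x - y k) = 2 *\<^sub>R (x - (1/2) *\<^sub>R (y j + y k))"
        by (simp add: scaleR_right_diff_distrib scaleR_2)
      then show ?thesis by (simp only: norm_scaleR power_mult_distrib) simp
    qed
    moreover have "(norm (y j - y k))\<^sup>2 = (norm ((x - y k) - (x - y j)))\<^sup>2" by simp
    ultimately show ?thesis
      using y(2)[of j] y(2)[of k] norm_add_sq[of "x - y j" "x - y k"] norm_diff_sq[of "x - y k" "x - y j"]
        Re_cinner_commute[of "x - y j" "x - y k"]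
      by linarith
  qed
  have "Cauchy y"
  proof (rule metric_CauchyI)
    fix e :: real assume "0 < e"
    then have "0 < e\<^sup>2 / 4" by simp
    then obtain K where K: "1 / Suc K < e\<^sup>2 / 4" using nat_approx_posE by blast
    have "dist (y j) (y k) < e" if "j \<ge> K" "k \<ge> K" for j k
    proof -
      have "1 / Suc j \<le> 1 / Suc K" "1 / Suc k \<le> 1 / Suc K" using that by (auto simp: field_simps)
      then have "(norm (y j - y k))\<^sup>2 < e\<^sup>2" using par[of j k] K by auto
      then show ?thesis using \<open>0 < e\<close> by (simp add: dist_norm power_less_imp_less_base)
    qed
    then show "\<exists>K. \<forall>j\<ge>K. \<forall>k\<ge>K. dist (y j) (y k) < e" by blast
  qed
  then obtain l where l: "y \<longlonglongrightarrow> l" using Cauchy_convergent_iff convergent_def by blast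
  have "l \<in> M" using closed_sequentially[OF M(2) _ l] y by auto
  have nl: "(norm (x - l))\<^sup>2 \<le> d"
  proof (rule LIMSEQ_le)
    show "(\<lambda>k. (norm (x - y k))\<^sup>2) \<longlonglongrightarrow> (norm (x - l))\<^sup>2" by (intro tendsto_intros l)
    have "(\<lambda>k. d + 1 / Suc k) \<longlonglongrightarrow> d + 0" by (intro tendsto_intros LIMSEQ_Suc lim_1_over_n)
    then show "(\<lambda>k. d + 1 / Suc k) \<longlonglongrightarrow> d" by simp
    show "\<exists>N. \<forall>n\<ge>N. (norm (x - y n))\<^sup>2 \<le> d + 1 / Suc n" using y(2) less_imp_le by blast
  qed
  \<comment> \<open>With constant term 0 the discriminant bound forces the linear coefficient to
    vanish.\<close>
  have Re0: "Re (cinner (x - l) z) = 0" if "z \<in> M" for z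
  proof -
    have "(- Re (cinner (x - l) z))\<^sup>2 \<le> 0 * (norm z)\<^sup>2"
    proof (rule quadratic_nonneg_imp_discriminant_le)
      fix s :: real
      have "l + s *\<^sub>R z \<in> M"
        using M \<open>l \<in> M\<close> that by (intro complex_vector.subspace_add csubspace_scaleR)
      then have "(norm (x - l))\<^sup>2 \<le> (norm ((x - l) - s *\<^sub>R z))\<^sup>2"
        using d_le nl by (metis diff_diff_eq order_trans)
      then show "0 \<le> 0 + 2 * s * - Re (cinner (x - l) z) + s\<^sup>2 * (norm z)\<^sup>2"
        by (simp add: norm_diff_sq cinner_scaleR_right power_mult_distrib)
    qed
    then show ?thesis by simp
  qed
  have "cinner (x - l) z = 0" if "z \<in> M" for z
  proof -
    \<comment> \<open>Real lines control only real parts; replacing \<open>z\<close> by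
      \<open>\<i> z\<close> supplies the imaginary one.\<close>
    have "\<i> *\<^sub>C z \<in> M" using M that by (intro complex_vector.subspace_scale)
    from Re0[OF this] Re0[OF that] show ?thesis by (simp add: cinner_simps complex_eq_iff)
  qed
  then show ?thesis using \<open>l \<in> M\<close> by blast
qed

definition cortho :: "'a::complex_inner set \<Rightarrow> 'a set" where
  "cortho M = {x. \<forall>z\<in>M. cinner x z = 0}"

lemma corthoD: "x \<in> cortho M \<Longrightarrow> z \<in> M \<Longrightarrow> cinner x z = 0"
  by (simp add: cortho_def)

lemma csubspace_cortho: "csubspace (cortho M)"
  by (auto simp: cortho_def complex_vector.subspace_def cinner_simps)

lemma closed_cortho: "closed (cortho (M :: 'a::complex_inner set))"
proof -
  have "closed {x. cinner x z = 0}" for z :: 'a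
    by (intro closed_Collect_eq linear_continuous_on bounded_linear_cinner_left continuous_on_const)
  moreover have "cortho M = (\<Inter>z\<in>M. {x. cinner x z = 0})" by (auto simp: cortho_def)
  ultimately show ?thesis by auto
qed

lemma cortho_cspan: "cortho (cspan B) = cortho B"
proof
  show "cortho B \<subseteq> cortho (cspan B)"
  proof
    fix x assume x: "x \<in> cortho B"
    have "csubspace {z. cinner x z = 0}" by (auto simp: complex_vector.subspace_def cinner_simps)
    then have "cspan B \<subseteq> {z. cinner x z = 0}"
      using x by (intro complex_vector.span_minimal) (auto simp: cortho_def)
    then show "x \<in> cortho (cspan B)" by (auto simp: cortho_def)
  qed
qed (auto simp: cortho_def complex_vector.span_base)

text \<open>The residual of \<open>x\<close> after projection lies in \<open>cortho M\<close> and is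
  orthogonal both to \<open>x\<close> and to the projection, hence to itself.\<close>

lemma cortho_cortho_subset:
  fixes M :: "'a::chilbert_space set"
  assumes "csubspace M" "closed M" "\<And>z. z \<in> cortho M \<Longrightarrow> cinner x z = 0"
  shows "x \<in> M"
proof -
  obtain y where y: "y \<in> M" "\<forall>z\<in>M. cinner (x - y) z = 0"
    using projection_exists assms(1,2) by metis
  then have "x - y \<in> cortho M" by (simp add: cortho_def)
  then have "cinner (x - y) (x - y) = 0"
    using assms(3) y by (auto simp: cinner_diff_left[of x y "x - y"] cortho_def) (metis cinner_zero_commute)
  then show ?thesis using y by simp
qed

section \<open>Bounded operators\<close>

lemma bounded_clinear_bounded_linear: "bounded_clinear T \<Longrightarrow> bounded_linear T"
  by (simp add: bounded_clinear_def)

lemma bounded_clinearI: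
  assumes "\<And>x y. T (x + y) = T x + T y" "\<And>c x. T (c *\<^sub>C x) = c *\<^sub>C T x"
    "\<And>x. norm (T x) \<le> norm x * K"
  shows "bounded_clinear T"
  unfolding bounded_clinear_def using assms by (auto intro!: bounded_linear_intro simp: scaleR_scaleC)

lemma
  assumes "bounded_clinear T"
  shows bcl_add: "T (x + y) = T x + T y"
    and bcl_diff: "T (x - y) = T x - T y"
    and bcl_minus: "T (- x) = - T x"
    and bcl_zero: "T 0 = 0"
    and bcl_scaleC: "T (c *\<^sub>C x) = c *\<^sub>C T x"
    and bcl_scaleR: "T (r *\<^sub>R x) = r *\<^sub>R T x"
    and bcl_sum: "T (sum g A) = (\<Sum>a\<in>A. T (g a))"
    and bcl_onorm: "norm (T x) \<le> onorm T * norm x"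
proof -
  note bl = bounded_clinear_bounded_linear[OF assms]
  note l = bounded_linear.linear[OF bl]
  show "T (x + y) = T x + T y" "T (x - y) = T x - T y" "T (- x) = - T x" "T 0 = 0"
    "T (r *\<^sub>R x) = r *\<^sub>R T x" "T (sum g A) = (\<Sum>a\<in>A. T (g a))"
    using l by (simp_all add: linear_add linear_diff linear_neg linear_0 linear_scale linear_sum)
  show "T (c *\<^sub>C x) = c *\<^sub>C T x" using assms by (simp add: bounded_clinear_def)
  show "norm (T x) \<le> onorm T * norm x" by (rule onorm[OF bl])
qed

lemmas bcl_simps = bcl_add bcl_diff bcl_minus bcl_zero bcl_scaleC bcl_scaleR

lemma bcl_pos_bound:
  assumes "bounded_clinear T"
  obtains K where "0 < K" "\<And>x. norm (T x) \<le> K * norm x"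
  using bounded_linear.pos_bounded[OF bounded_clinear_bounded_linear[OF assms]]
  by (metis mult.commute)

lemma bounded_clinear_comp: "bounded_clinear S \<Longrightarrow> bounded_clinear T \<Longrightarrow> bounded_clinear (\<lambda>x. S (T x))"
  by (simp add: bounded_clinear_def bounded_linear_compose)

lemma bounded_clinear_add: "bounded_clinear S \<Longrightarrow> bounded_clinear T \<Longrightarrow> bounded_clinear (\<lambda>x. S x + T x)"
  by (simp add: bounded_clinear_def bounded_linear_add scaleC_add_right)

lemma bounded_clinear_minus: "bounded_clinear S \<Longrightarrow> bounded_clinear (\<lambda>x. - S x)"
  by (simp add: bounded_clinear_def bounded_linear_minus complex_vector.scale_minus_right)

lemma bounded_clinear_diff: "bounded_clinear S \<Longrightarrow> bounded_clinear T \<Longrightarrow> bounded_clinear (\<lambda>x. S x - T x)"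
  by (simp add: bounded_clinear_def bounded_linear_sub complex_vector.scale_right_diff_distrib)

lemma bounded_clinear_id: "bounded_clinear (\<lambda>x. x)"
  by (simp add: bounded_clinear_def bounded_linear_ident)

lemma bounded_clinear_zero: "bounded_clinear (\<lambda>x. 0)"
  by (simp add: bounded_clinear_def bounded_linear_zero)

lemma bounded_clinear_scaleC: "bounded_clinear S \<Longrightarrow> bounded_clinear (\<lambda>x. c *\<^sub>C S x)"
  using bounded_linear_compose[OF bounded_linear_scaleC, of S c]
  by (simp add: bounded_clinear_def scaleC_scaleC mult.commute)

lemma bounded_clinear_scaleR: "bounded_clinear S \<Longrightarrow> bounded_clinear (\<lambda>x. r *\<^sub>R S x)"
  by (simp add: scaleR_scaleC bounded_clinear_scaleC)

lemma bounded_clinear_cinner: "bounded_clinear (\<lambda>x. cinner x a *\<^sub>C b)"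
  by (rule bounded_clinearI[of _ "norm a * norm b"])
    (auto simp: cinner_simps scaleC_add_left scaleC_scaleC norm_scaleC mult.assoc[symmetric]
      intro!: mult_right_mono Cauchy_Schwarz_cinner)

lemma bounded_clinear_sum: "(\<And>a. a \<in> A \<Longrightarrow> bounded_clinear (S a)) \<Longrightarrow> bounded_clinear (\<lambda>x. \<Sum>a\<in>A. S a x)"
  by (induction A rule: infinite_finite_induct) (auto intro: bounded_clinear_zero bounded_clinear_add)

lemmas bounded_clinear_intros = bounded_clinear_add bounded_clinear_minus
  bounded_clinear_diff bounded_clinear_id bounded_clinear_zero bounded_clinear_scaleC
  bounded_clinear_scaleR bounded_clinear_cinner bounded_clinear_sum

lemma bcl_tendsto: "bounded_clinear T \<Longrightarrow> (f \<longlongrightarrow> l) F \<Longrightarrow> ((\<lambda>i. T (f i)) \<longlongrightarrow> T l) F"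
  using bounded_linear.tendsto bounded_clinear_bounded_linear by blast

text \<open>For a suitable \<open>t\<close> the map \<open>x - t (B x - y)\<close> is a contraction,
  and its fixed point solves \<open>B x = y\<close>. Coercivity bounds the inverse by
  \<open>1 / \<delta>\<close>.\<close>

lemma Lax_Milgram:
  fixes B :: "'a::chilbert_space \<Rightarrow> 'a"
  assumes B: "bounded_clinear B" and "0 < \<delta>" and coer: "\<And>x. \<delta> * (norm x)\<^sup>2 \<le> Re (cinner (B x) x)"
  shows "\<exists>R. bounded_clinear R \<and> (\<forall>x. R (B x) = x) \<and> (\<forall>x. B (R x) = x)"
proof -
  have low: "\<delta> * norm x \<le> norm (B x)" for x
  proof (cases "x = 0")
    case False
    have "\<delta> * norm x * norm x \<le> norm (B x) * norm x"
      using coer[of x] Re_cinner_le[of "B x" x] by (simp add: power2_eq_square mult.assoc)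
    then show ?thesis using False by simp
  qed (simp add: bcl_zero[OF B])
  obtain K0 where K0: "0 < K0" "\<And>x. norm (B x) \<le> K0 * norm x" using bcl_pos_bound[OF B] by blast
  \<comment> \<open>Adding \<open>\<delta>\<close> ensures \<open>\<delta> \<le> K\<close>, so that
    the root defining \<open>c\<close> is taken of a nonnegative number.\<close>
  define K where "K = K0 + \<delta>"
  have K: "0 < K" "\<delta> \<le> K" "\<And>x. norm (B x) \<le> K * norm x"
    using K0 \<open>0 < \<delta>\<close> by (auto simp: K_def distrib_right intro!: add_increasing2)
  \<comment> \<open>The minimiser of \<open>1 - 2 * t * \<delta> + t^2 * K^2\<close>; the minimum is
    \<open>c^2\<close>.\<close>
  define t where "t = \<delta> / K\<^sup>2"
  define c where "c = sqrt (1 - \<delta>\<^sup>2 / K\<^sup>2)"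
  have "\<delta>\<^sup>2 / K\<^sup>2 \<le> 1" using K \<open>0 < \<delta>\<close> by (simp add: power_mono)
  have "0 < \<delta>\<^sup>2 / K\<^sup>2" using K \<open>0 < \<delta>\<close> by simp
  have c: "0 \<le> c" "c < 1" "c\<^sup>2 = 1 - \<delta>\<^sup>2 / K\<^sup>2"
    using \<open>\<delta>\<^sup>2 / K\<^sup>2 \<le> 1\<close> \<open>0 < \<delta>\<^sup>2 / K\<^sup>2\<close> by (simp_all add: c_def)
  have contr: "norm (x - t *\<^sub>R B x) \<le> c * norm x" for x
  proof -
    have "(norm (x - t *\<^sub>R B x))\<^sup>2 = (norm x)\<^sup>2 - 2 * t * Re (cinner (B x) x) + t\<^sup>2 * (norm (B x))\<^sup>2"
      using Re_cinner_commute[of x "B x"] by (simp add: norm_diff_sq cinner_simps power_mult_distrib)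
    also have "\<dots> \<le> (norm x)\<^sup>2 - 2 * t * (\<delta> * (norm x)\<^sup>2) + t\<^sup>2 * (K * norm x)\<^sup>2"
      using K \<open>0 < \<delta>\<close> coer[of x]
      by (intro add_mono diff_mono mult_left_mono power_mono order_refl) (auto simp: t_def)
    also have "\<dots> = (c * norm x)\<^sup>2"
    proof -
      have "(c * norm x)\<^sup>2 = (1 - \<delta>\<^sup>2 / K\<^sup>2) * (norm x)\<^sup>2" by (simp add: power_mult_distrib c(3))
      then show ?thesis using K by (simp add: power_mult_distrib t_def field_simps power2_eq_square)
    qed
    finally show ?thesis by (rule power2_le_imp_le) (simp add: c(1))
  qed
  have "\<exists>!x. x - t *\<^sub>R (B x - y) = x" for y
  proof (rule banach_fix_type[OF c(1,2)], intro allI)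
    fix x z
    have eq: "(x - t *\<^sub>R (B x - y)) - (z - t *\<^sub>R (B z - y)) = (x - z) - t *\<^sub>R B (x - z)"
      by (simp add: bcl_simps[OF B] algebra_simps)
    then show "dist (x - t *\<^sub>R (B x - y)) (z - t *\<^sub>R (B z - y)) \<le> c * dist x z"
      using contr[of "x - z"] by (simp only: dist_norm eq)
  qed
  moreover have "t \<noteq> 0" using K \<open>0 < \<delta>\<close> by (simp add: t_def)
  ultimately have ex: "\<exists>!x. B x = y" for y by simp
  define R where "R y = (THE x. B x = y)" for y
  have BR: "B (R y) = y" for y unfolding R_def using theI'[OF ex] .
  have RB: "R (B x) = x" for x using ex BR by blast
  have "bounded_clinear R"
  proof (rule bounded_clinearI)
    show "R (x + y) = R x + R y" for x y by (metis BR RB bcl_add[OF B])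
    show "R (a *\<^sub>C x) = a *\<^sub>C R x" for a x by (metis BR RB bcl_scaleC[OF B])
    show "norm (R x) \<le> norm x * (1 / \<delta>)" for x
      using low[of "R x"] \<open>0 < \<delta>\<close> by (simp add: BR field_simps)
  qed
  then show ?thesis using BR RB by blast
qed

text \<open>The representing vector spans the orthogonal complement of the kernel of
  \<open>\<phi>\<close>; the scalar is fixed by the value at \<open>v\<close>.\<close>

lemma Riesz:
  fixes \<phi> :: "'a::chilbert_space \<Rightarrow> complex"
  assumes bl: "bounded_linear \<phi>" and sc: "\<And>c x. \<phi> (c *\<^sub>C x) = c * \<phi> x"
  obtains y where "\<And>x. \<phi> x = cinner x y"
proof (cases "\<forall>x. \<phi> x = 0")
  case True
  then show ?thesis using that[of 0] by simp
next
  case False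
  then obtain u where u: "\<phi> u \<noteq> 0" by blast
  note lin = bounded_linear.linear[OF bl]
  define M where "M = {x. \<phi> x = 0}"
  have "csubspace M" using lin by (auto simp: M_def complex_vector.subspace_def sc linear_add linear_0)
  moreover have "closed M"
    unfolding M_def by (intro closed_Collect_eq linear_continuous_on bl continuous_on_const)
  ultimately obtain p where p: "p \<in> M" "\<forall>z\<in>M. cinner (u - p) z = 0"
    using projection_exists by metis
  define v where "v = u - p"
  have v: "\<phi> v = \<phi> u" using p lin by (simp add: v_def M_def linear_diff)
  have "v \<noteq> 0" using u v lin by (auto simp: linear_0)
  have "\<phi> x = cinner x (cnj (\<phi> v / cinner v v) *\<^sub>C v)" for x
  proof -
    have "\<phi> v *\<^sub>C x - \<phi> x *\<^sub>C v \<in> M" using lin by (simp add: M_def linear_diff sc)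
    then have "cinner v (\<phi> v *\<^sub>C x - \<phi> x *\<^sub>C v) = 0" using p by (simp add: v_def)
    then have "cinner (\<phi> v *\<^sub>C x - \<phi> x *\<^sub>C v) v = 0" by (rule cinner_zero_commute[THEN iffD1])
    then show ?thesis using \<open>v \<noteq> 0\<close> by (simp add: cinner_simps field_simps)
  qed
  then show ?thesis by (rule that)
qed

section \<open>Adjoints\<close>

lemma cadjoint_eqI:
  assumes "bounded_clinear S" "\<And>x y. cinner (T x) y = cinner x (S y)"
  shows "cadjoint T = S"
  unfolding cadjoint_def
proof (rule the_equality)
  fix S' assume "bounded_clinear S' \<and> (\<forall>x y. cinner (T x) y = cinner x (S' y))"
  then have "cinner x (S' y) = cinner x (S y)" for x y using assms(2) by metis
  then show "S' = S" by (intro ext cinner_eqI')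
qed (use assms in auto)

lemma cadjoint_exists:
  fixes T :: "'a::chilbert_space \<Rightarrow> 'b::chilbert_space"
  assumes T: "bounded_clinear T"
  shows "\<exists>S. bounded_clinear S \<and> (\<forall>x y. cinner (T x) y = cinner x (S y))"
proof -
  have "\<exists>z. \<forall>x. cinner (T x) y = cinner x z" for y
  proof -
    have "bounded_linear (\<lambda>x. cinner (T x) y)"
      using bounded_linear_compose[OF bounded_linear_cinner_left bounded_clinear_bounded_linear[OF T]] .
    then obtain z where "\<And>x. cinner (T x) y = cinner x z"
      by (rule Riesz) (auto simp: bcl_scaleC[OF T] cinner_simps)
    then show ?thesis by blast
  qed
  then obtain S where S: "\<And>x y. cinner (T x) y = cinner x (S y)" by metis
  obtain K where K: "0 < K" "\<And>x. norm (T x) \<le> K * norm x" using bcl_pos_bound[OF T] by blast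
  have "bounded_clinear S"
  proof (rule bounded_clinearI)
    show "S (x + y) = S x + S y" for x y by (rule cinner_eqI') (simp add: cinner_simps flip: S)
    show "S (c *\<^sub>C x) = c *\<^sub>C S x" for c x by (rule cinner_eqI') (simp add: cinner_simps flip: S)
    fix y
    have "norm (S y) * norm (S y) = Re (cinner (T (S y)) y)"
      by (simp add: S norm_sq_cinner[symmetric] power2_eq_square)
    also have "\<dots> \<le> norm (T (S y)) * norm y" using Re_cinner_le abs_le_iff by blast
    also have "\<dots> \<le> K * norm (S y) * norm y" using K by (simp add: mult_right_mono)
    finally show "norm (S y) \<le> norm y * K"
      using K by (cases "S y = 0") (simp_all add: mult.commute mult.left_commute)
  qed
  then show ?thesis using S by blast
qed

lemma
  assumes "bounded_clinear T"
  shows bounded_clinear_cadjoint: "bounded_clinear (cadjoint T)"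
    and cinner_cadjoint: "cinner (T x) y = cinner x (cadjoint T y)"
proof -
  obtain S where S: "bounded_clinear S" "\<And>x y. cinner (T x) y = cinner x (S y)"
    using cadjoint_exists[OF assms] by blast
  then have "cadjoint T = S" by (rule cadjoint_eqI)
  with S show "bounded_clinear (cadjoint T)" "cinner (T x) y = cinner x (cadjoint T y)" by simp_all
qed

lemma cinner_cadjoint': "bounded_clinear T \<Longrightarrow> cinner (cadjoint T y) x = cinner y (T x)"
  by (simp only: cinner_cadjoint[symmetric] cinner_commute[of _ x] cinner_commute[of y])

lemma cadjoint_cadjoint: "bounded_clinear T \<Longrightarrow> cadjoint (cadjoint T) = T"
  by (rule cadjoint_eqI) (simp_all add: cinner_cadjoint')

section \<open>Hermitian and positive operators\<close>

definition hermitian :: "('a::complex_inner \<Rightarrow> 'a) \<Rightarrow> bool" where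
  "hermitian T \<longleftrightarrow> (\<forall>x y. cinner (T x) y = cinner x (T y))"

lemma hermitianD: "hermitian T \<Longrightarrow> cinner (T x) y = cinner x (T y)"
  by (simp add: hermitian_def)

lemma hermitian_cinner_real: "hermitian T \<Longrightarrow> cinner (T x) x = complex_of_real (Re (cinner (T x) x))"
  using hermitianD[of T x x] cinner_commute[of "T x" x] by (simp add: complex_eq_iff)

lemma positive_opI:
  assumes "bounded_clinear P" "hermitian P" "\<And>x. 0 \<le> Re (cinner (P x) x)"
  shows "positive_op P"
  unfolding positive_op_def
proof (intro conjI allI assms(1))
  show "cinner (P x) x \<in> \<real>\<^sub>\<ge>\<^sub>0" for x
    by (subst hermitian_cinner_real[OF assms(2)]) (simp only: nonneg_Reals_of_real_iff assms(3))
qed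

lemma positive_op_bcl: "positive_op P \<Longrightarrow> bounded_clinear P"
  by (simp add: positive_op_def)

lemma positive_op_nonneg: "positive_op P \<Longrightarrow> 0 \<le> Re (cinner (P x) x)"
  by (simp add: positive_op_def complex_nonneg_Reals_iff)

text \<open>Polarisation: reality of the form at \<open>x + y\<close> yields the imaginary part of
  the identity, reality at \<open>x + \<i> y\<close> the real part.\<close>

lemma positive_op_hermitian:
  assumes P: "positive_op P"
  shows "hermitian P"
  unfolding hermitian_def
proof (intro allI)
  fix x y
  note B = positive_op_bcl[OF P]
  have Im: "Im (cinner (P z) z) = 0" for z
    using P by (simp add: positive_op_def complex_nonneg_Reals_iff)
  have "cinner (P x) y = cnj (cinner (P y) x)"
    using Im[of "x + y"] Im[of "x + \<i> *\<^sub>C y"] Im[of x] Im[of y]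
    by (simp add: bcl_simps[OF B] cinner_simps complex_eq_iff)
  then show "cinner (P x) y = cinner x (P y)" by (simp only: cinner_commute[of x "P y"])
qed

text \<open>Cauchy--Schwarz for the semidefinite form of \<open>P\<close> at the pair
  \<open>x\<close>, \<open>P x\<close>, whose mixed value is \<open>(norm (P x))^2\<close>.\<close>

lemma positive_op_Cauchy_Schwarz:
  assumes P: "positive_op P"
  shows "(norm (P x)) ^ 4 \<le> Re (cinner (P x) x) * Re (cinner (P (P x)) (P x))"
proof -
  note B = positive_op_bcl[OF P] and H = hermitianD[OF positive_op_hermitian[OF P]]
  have "((norm (P x))\<^sup>2)\<^sup>2 \<le> Re (cinner (P x) x) * Re (cinner (P (P x)) (P x))"
  proof (rule quadratic_nonneg_imp_discriminant_le)
    fix s :: real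
    have "0 \<le> Re (cinner (P (x + s *\<^sub>R P x)) (x + s *\<^sub>R P x))" by (rule positive_op_nonneg[OF P])
    also have "\<dots> = Re (cinner (P x) x) + 2 * s * (norm (P x))\<^sup>2 + s\<^sup>2 * Re (cinner (P (P x)) (P x))"
      by (simp add: bcl_simps[OF B] cinner_simps H[of "P x" x] flip: norm_sq_cinner)
        (simp add: power2_eq_square algebra_simps)
    finally show "0 \<le> Re (cinner (P x) x) + 2 * s * (norm (P x))\<^sup>2 + s\<^sup>2 * Re (cinner (P (P x)) (P x))" .
  qed
  then show ?thesis by simp
qed

lemma positive_op_cinner_0:
  assumes "positive_op P" "Re (cinner (P x) x) = 0"
  shows "P x = 0"
proof -
  have "(norm (P x)) ^ 4 \<le> 0" using positive_op_Cauchy_Schwarz[OF assms(1), of x] assms(2) by simp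
  then have "(norm (P x)) ^ 4 = 0" by (intro order_antisym) auto
  then show ?thesis by simp
qed

lemma positive_op_norm_le:
  assumes P: "positive_op P" and K: "\<And>x. Re (cinner (P x) x) \<le> K * (norm x)\<^sup>2" "0 \<le> K"
  shows "norm (P x) \<le> K * norm x"
proof (cases "P x = 0")
  case False
  have "(norm (P x))\<^sup>2 * (norm (P x))\<^sup>2 \<le> (K * (norm x)\<^sup>2) * (K * (norm (P x))\<^sup>2)"
    using positive_op_Cauchy_Schwarz[OF P, of x] K positive_op_nonneg[OF P]
      mult_mono[OF K(1)[of x] K(1)[of "P x"]] by simp
  then have "(norm (P x))\<^sup>2 \<le> (K * norm x)\<^sup>2" using False by (simp add: power2_eq_square mult_ac)
  then show ?thesis by (rule power2_le_imp_le) (simp add: K(2))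
qed (simp add: K(2))

section \<open>Square roots of positive operators\<close>

text \<open>The iteration \<open>y \<mapsto> (e + y^2) / 2\<close> in the extreme case
  \<open>e = 1\<close>; its increments dominate those of the operator iteration.\<close>

primrec sqrt_iter_scalar :: "nat \<Rightarrow> real" where
  "sqrt_iter_scalar 0 = 0"
| "sqrt_iter_scalar (Suc k) = (1 + (sqrt_iter_scalar k)\<^sup>2) / 2"

lemma sqrt_iter_scalar_bounds: "0 \<le> sqrt_iter_scalar k \<and> sqrt_iter_scalar k \<le> 1"
  by (induction k) (auto simp: power_le_one)

lemma incseq_sqrt_iter_scalar: "incseq sqrt_iter_scalar"
proof (rule incseq_SucI)
  show "sqrt_iter_scalar k \<le> sqrt_iter_scalar (Suc k)" for k
    using zero_le_power2[of "sqrt_iter_scalar k - 1"] by (simp add: power2_eq_square algebra_simps)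
qed

primrec sqrt_iter :: "('a::complex_inner \<Rightarrow> 'a) \<Rightarrow> nat \<Rightarrow> 'a \<Rightarrow> 'a" where
  "sqrt_iter E 0 = (\<lambda>x. 0)"
| "sqrt_iter E (Suc k) = (\<lambda>x. (1/2) *\<^sub>R (E x + sqrt_iter E k (sqrt_iter E k x)))"

lemma bounded_clinear_sqrt_iter: "bounded_clinear E \<Longrightarrow> bounded_clinear (sqrt_iter E k)"
proof (induction k)
  case (Suc k)
  from bounded_clinear_comp[OF Suc.IH Suc.IH] Suc.prems show ?case
    by (simp add: bounded_clinear_add bounded_clinear_scaleR)
qed (simp add: bounded_clinear_zero)

text \<open>The iterates are polynomials in \<open>E\<close>. The commutation survives the limit and
  is what makes positive square roots unique below.\<close>

lemma sqrt_iter_commute: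
  assumes "bounded_clinear W" "\<And>x. W (E x) = E (W x)"
  shows "W (sqrt_iter E k x) = sqrt_iter E k (W x)"
  by (induction k arbitrary: x) (simp_all add: bcl_simps[OF assms(1)] assms(2))

lemma sqrt_iter_commute_self:
  assumes "bounded_clinear E"
  shows "sqrt_iter E j (sqrt_iter E k x) = sqrt_iter E k (sqrt_iter E j x)"
proof -
  have "E (sqrt_iter E j x) = sqrt_iter E j (E x)" for x
    by (rule sqrt_iter_commute[where W = E and E = E, OF assms refl])
  then show ?thesis
    by (intro sqrt_iter_commute[where W = "sqrt_iter E j" and E = E, OF bounded_clinear_sqrt_iter[OF assms]])
      (rule sym)
qed

lemma sqrt_iter_hermitian:
  assumes "bounded_clinear E" "hermitian E"
  shows "cinner (sqrt_iter E k x) y = cinner x (sqrt_iter E k y)"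
  by (induction k arbitrary: x y) (simp_all add: cinner_simps hermitianD[OF assms(2)])

lemma norm_sqrt_iter_le:
  assumes "\<And>x. norm (E x) \<le> norm x"
  shows "norm (sqrt_iter E k x) \<le> sqrt_iter_scalar k * norm x"
proof (induction k arbitrary: x)
  case (Suc k)
  let ?t = "sqrt_iter_scalar k"
  have "norm (E x + sqrt_iter E k (sqrt_iter E k x)) \<le> norm x + ?t * (?t * norm x)"
    using sqrt_iter_scalar_bounds[of k] Suc
    by (intro norm_triangle_mono assms) (meson mult_left_mono order_trans)
  then have "(1/2) * norm (E x + sqrt_iter E k (sqrt_iter E k x)) \<le> (1/2) * (norm x + ?t * (?t * norm x))"
    by simp
  also have "\<dots> = sqrt_iter_scalar (Suc k) * norm x"
    by (simp add: power2_eq_square algebra_simps)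
  finally show ?case by simp
qed simp

text \<open>Iterates commute, so a difference of their squares factors into sum times difference as
  for numbers; the sum is bounded by the scalar iterates, the difference by induction, and the
  scalar recursion factors in the same way.\<close>

lemma norm_sqrt_iter_Suc_diff_le:
  assumes E: "bounded_clinear E" and nE: "\<And>x. norm (E x) \<le> norm x"
  shows "norm (sqrt_iter E (Suc k) x - sqrt_iter E k x)
    \<le> (sqrt_iter_scalar (Suc k) - sqrt_iter_scalar k) * norm x"
proof (induction k arbitrary: x)
  case 0
  then show ?case using nE[of x] by simp
next
  case (Suc k)
  let ?Y = "sqrt_iter E" and ?t = sqrt_iter_scalar
  note B = bounded_clinear_sqrt_iter[OF E]
  define d where "d = ?Y (Suc k) x - ?Y k x"
  have "?Y (Suc (Suc k)) x - ?Y (Suc k) x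
      = (1/2) *\<^sub>R (?Y (Suc k) (?Y (Suc k) x) - ?Y k (?Y k x))"
  proof -
    have "a - b = (1/2) *\<^sub>R (p - q)" if "a = (1/2) *\<^sub>R (e + p)" "b = (1/2) *\<^sub>R (e + q)" for a b e p q :: 'a
      using that by (simp add: algebra_simps)
    from this[OF fun_cong[OF sqrt_iter.simps(2)] fun_cong[OF sqrt_iter.simps(2)]] show ?thesis .
  qed
  also have "?Y (Suc k) (?Y (Suc k) x) - ?Y k (?Y k x) = ?Y (Suc k) d + ?Y k d"
    by (simp add: d_def bcl_diff[OF B] sqrt_iter_commute_self[OF E, of k "Suc k" x] del: sqrt_iter.simps)
  finally have eq: "?Y (Suc (Suc k)) x - ?Y (Suc k) x = (1/2) *\<^sub>R (?Y (Suc k) d + ?Y k d)" .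
  have "norm (?Y (Suc (Suc k)) x - ?Y (Suc k) x) = (1/2) * norm (?Y (Suc k) d + ?Y k d)"
    unfolding eq by (simp del: sqrt_iter.simps)
  also have "norm (?Y (Suc k) d + ?Y k d) \<le> ?t (Suc k) * norm d + ?t k * norm d"
    by (intro norm_triangle_mono norm_sqrt_iter_le nE)
  also have "\<dots> = (?t (Suc k) + ?t k) * norm d" by (simp add: distrib_right)
  also have "\<dots> \<le> (?t (Suc k) + ?t k) * ((?t (Suc k) - ?t k) * norm x)"
    unfolding d_def using sqrt_iter_scalar_bounds[of k] sqrt_iter_scalar_bounds[of "Suc k"]
    by (intro mult_left_mono Suc.IH) linarith
  also have "\<dots> = 2 * ((?t (Suc (Suc k)) - ?t (Suc k)) * norm x)"
  proof -
    have "(b + c) * ((b - c) * m) = 2 * ((a - b) * m)" if "a = (1 + b\<^sup>2) / 2" "b = (1 + c\<^sup>2) / 2" for a b c m :: real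
    proof -
      have "2 * (a - b) = (b + c) * (b - c)" unfolding that(1) using that(2) by (simp add: power2_eq_square algebra_simps)
      then have "2 * (a - b) * m = (b + c) * (b - c) * m" by simp
      then show ?thesis by (simp only: mult.assoc)
    qed
    from this[OF sqrt_iter_scalar.simps(2) sqrt_iter_scalar.simps(2)] show ?thesis .
  qed
  finally show ?case by simp
qed

lemma norm_sqrt_iter_diff_le:
  assumes E: "bounded_clinear E" and nE: "\<And>x. norm (E x) \<le> norm x" and "j \<le> k"
  shows "norm (sqrt_iter E k x - sqrt_iter E j x) \<le> (sqrt_iter_scalar k - sqrt_iter_scalar j) * norm x"
  using \<open>j \<le> k\<close>
proof (induction k rule: dec_induct)
  case (step k)
  have "norm (sqrt_iter E (Suc k) x - sqrt_iter E j x)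
      \<le> norm (sqrt_iter E (Suc k) x - sqrt_iter E k x) + norm (sqrt_iter E k x - sqrt_iter E j x)"
    using norm_triangle_ineq[of "sqrt_iter E (Suc k) x - sqrt_iter E k x" "sqrt_iter E k x - sqrt_iter E j x"]
    by (simp del: sqrt_iter.simps)
  also have "\<dots> \<le> (sqrt_iter_scalar (Suc k) - sqrt_iter_scalar k) * norm x
      + (sqrt_iter_scalar k - sqrt_iter_scalar j) * norm x"
    by (intro add_mono norm_sqrt_iter_Suc_diff_le step E nE)
  finally show ?case by (simp add: algebra_simps)
qed simp

text \<open>The limit \<open>Y\<close> of the iteration satisfies \<open>Y = (E + Y\<^sup>2) / 2\<close>, so \<open>(1 - Y)\<^sup>2 = 1 - E\<close>.\<close>

lemma sqrt_iter_limit: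
  fixes E :: "'a::chilbert_space \<Rightarrow> 'a"
  assumes E: "bounded_clinear E" and nE: "\<And>x. norm (E x) \<le> norm x" and hE: "hermitian E"
  obtains Y where "bounded_clinear Y" "hermitian Y" "\<And>x. norm (Y x) \<le> norm x"
    "\<And>x. 2 *\<^sub>R Y x = E x + Y (Y x)"
    "\<And>W x. bounded_clinear W \<Longrightarrow> (\<And>x. W (E x) = E (W x)) \<Longrightarrow> W (Y x) = Y (W x)"
proof -
  let ?Y = "sqrt_iter E" and ?t = sqrt_iter_scalar
  note B = bounded_clinear_sqrt_iter[OF E]
  obtain L where L: "?t \<longlonglongrightarrow> L" "\<And>k. ?t k \<le> L"
    using incseq_convergent[OF incseq_sqrt_iter_scalar] sqrt_iter_scalar_bounds by metis
  have "Cauchy (\<lambda>k. ?Y k x)" for x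
  proof (rule metric_CauchyI)
    fix e :: real assume "0 < e"
    then have "0 < e / (2 * (norm x + 1))" by (simp add: add_nonneg_pos)
    then have "\<forall>\<^sub>F k in sequentially. L - e / (2 * (norm x + 1)) < ?t k"
      by (intro order_tendstoD(1)[OF L(1)]) linarith
    then obtain K where "L - e / (2 * (norm x + 1)) < ?t K" by (auto simp: eventually_sequentially)
    then have K: "L - ?t K < e / (2 * (norm x + 1))" by linarith
    have *: "norm (?Y k x - ?Y K x) < e / 2" if "K \<le> k" for k
    proof -
      have "norm (?Y k x - ?Y K x) \<le> (L - ?t K) * norm x"
        using norm_sqrt_iter_diff_le[OF E nE that, of x] L(2)[of k]
        by (meson diff_right_mono mult_right_mono norm_ge_zero order_trans)
      also have "\<dots> \<le> (L - ?t K) * (norm x + 1)" using L(2) by (intro mult_left_mono) auto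
      also have "(L - ?t K) * (norm x + 1) < e / (2 * (norm x + 1)) * (norm x + 1)"
        using K by (intro mult_strict_right_mono) (auto simp: add_nonneg_pos)
      also have "\<dots> = e / 2" using norm_ge_zero[of x] by (simp add: field_simps del: norm_ge_zero)
      finally show ?thesis .
    qed
    have "dist (?Y j x) (?Y k x) < e" if "K \<le> j" "K \<le> k" for j k
      using *[OF that(1)] *[OF that(2)] norm_triangle_ineq4[of "?Y j x - ?Y K x" "?Y k x - ?Y K x"]
      unfolding dist_norm by simp
    then show "\<exists>K. \<forall>j\<ge>K. \<forall>k\<ge>K. dist (?Y j x) (?Y k x) < e" by blast
  qed
  then have "\<exists>l. (\<lambda>k. ?Y k x) \<longlonglongrightarrow> l" for x unfolding Cauchy_convergent_iff convergent_def .
  then obtain Y where Y: "\<And>x. (\<lambda>k. ?Y k x) \<longlonglongrightarrow> Y x" by metis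
  have nYk: "norm (?Y k x) \<le> norm x" for k x
  proof -
    have "?t k * norm x \<le> 1 * norm x" using sqrt_iter_scalar_bounds by (intro mult_right_mono) auto
    then show ?thesis using norm_sqrt_iter_le[OF nE, of k x] by simp
  qed
  have nY: "norm (Y x) \<le> norm x" for x
    by (rule LIMSEQ_le_const2[OF tendsto_norm[OF Y]]) (auto intro: nYk)
  have bY: "bounded_clinear Y"
  proof (rule bounded_clinearI[of _ 1])
    show "Y (x + y) = Y x + Y y" for x y
      using LIMSEQ_unique[OF Y[of "x + y"]] tendsto_add[OF Y[of x] Y[of y]] by (simp add: bcl_add[OF B])
    show "Y (c *\<^sub>C x) = c *\<^sub>C Y x" for c x
      using LIMSEQ_unique[OF Y[of "c *\<^sub>C x"]] tendsto_scaleC[OF Y[of x]] by (simp add: bcl_scaleC[OF B])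
  qed (simp add: nY)
  have hY: "hermitian Y"
    unfolding hermitian_def
  proof (intro allI)
    fix x y
    have "(\<lambda>k. cinner (?Y k x) y) \<longlonglongrightarrow> cinner (Y x) y" by (intro tendsto_intros Y)
    moreover have "(\<lambda>k. cinner x (?Y k y)) \<longlonglongrightarrow> cinner x (Y y)" by (intro tendsto_intros Y)
    ultimately show "cinner (Y x) y = cinner x (Y y)"
      by (simp add: sqrt_iter_hermitian[OF E hE] LIMSEQ_unique)
  qed
  \<comment> \<open>All iterates are contractions, so convergence of the inner argument passes
    through the varying outer operator.\<close>
  have YY: "(\<lambda>k. ?Y k (?Y k x)) \<longlonglongrightarrow> Y (Y x)" for x
  proof -
    have "(\<lambda>k. ?Y k (?Y k x - Y x)) \<longlonglongrightarrow> 0"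
    proof (rule Lim_null_comparison)
      show "\<forall>\<^sub>F k in sequentially. norm (?Y k (?Y k x - Y x)) \<le> norm (?Y k x - Y x)"
        by (intro always_eventually allI nYk)
      show "(\<lambda>k. norm (?Y k x - Y x)) \<longlonglongrightarrow> 0" using Y[of x] by (simp add: LIM_zero tendsto_norm_zero)
    qed
    from tendsto_add[OF this Y[of "Y x"]] show ?thesis by (simp add: bcl_diff[OF B])
  qed
  have eq: "2 *\<^sub>R Y x = E x + Y (Y x)" for x
  proof -
    have "(\<lambda>k. 2 *\<^sub>R ?Y (Suc k) x) \<longlonglongrightarrow> 2 *\<^sub>R Y x" by (intro tendsto_intros LIMSEQ_Suc Y)
    moreover have "(\<lambda>k. E x + ?Y k (?Y k x)) \<longlonglongrightarrow> E x + Y (Y x)" by (intro tendsto_intros YY)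
    ultimately show ?thesis by (simp add: LIMSEQ_unique)
  qed
  show ?thesis
  proof (rule that[OF bY hY nY eq])
    fix W :: "'a \<Rightarrow> 'a" and x assume W: "bounded_clinear W" "\<And>x. W (E x) = E (W x)"
    have "(\<lambda>k. W (?Y k x)) \<longlonglongrightarrow> W (Y x)" by (rule bcl_tendsto[OF W(1) Y])
    then have "(\<lambda>k. ?Y k (W x)) \<longlonglongrightarrow> W (Y x)"
      by (simp only: sqrt_iter_commute[where W = W and E = E, OF W])
    then show "W (Y x) = Y (W x)" by (rule LIMSEQ_unique) (rule Y)
  qed
qed

text \<open>Dividing by a bound \<open>K\<close> of \<open>S\<close> puts
  \<open>E = 1 - S / K\<close> between 0 and 1, where the iteration converges; the factor
  \<open>sqrt K\<close> undoes the scaling.\<close>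

lemma positive_sqrt_exists:
  fixes S :: "'a::chilbert_space \<Rightarrow> 'a"
  assumes S: "positive_op S"
  obtains P where "positive_op P" "\<And>x. P (P x) = S x"
    "\<And>W x. bounded_clinear W \<Longrightarrow> (\<And>x. W (S x) = S (W x)) \<Longrightarrow> W (P x) = P (W x)"
proof -
  note B = positive_op_bcl[OF S] and H = positive_op_hermitian[OF S]
  obtain K where K: "0 < K" "\<And>x. norm (S x) \<le> K * norm x" using bcl_pos_bound[OF B] by blast
  define E where "E x = x - (1 / K) *\<^sub>R S x" for x
  have bE: "bounded_clinear E" unfolding E_def by (intro bounded_clinear_intros B)
  have hE: "hermitian E" using H by (simp add: hermitian_def E_def cinner_simps)
  have Re_E: "Re (cinner (E x) x) = (norm x)\<^sup>2 - Re (cinner (S x) x) / K" for x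
    by (simp add: E_def cinner_simps norm_sq_cinner)
  have "Re (cinner (S x) x) \<le> K * (norm x)\<^sup>2" for x
    using Re_cinner_le[of "S x" x] mult_right_mono[OF K(2)[of x], of "norm x"] by (simp add: power2_eq_square)
  then have pE: "positive_op E" using bE hE K by (intro positive_opI) (auto simp: Re_E field_simps)
  have "norm (E x) \<le> 1 * norm x" for x
    by (rule positive_op_norm_le[OF pE]) (use K positive_op_nonneg[OF S] in \<open>auto simp: Re_E\<close>)
  then have nE: "norm (E x) \<le> norm x" for x by simp
  obtain Y where Y: "bounded_clinear Y" "hermitian Y" "\<And>x. norm (Y x) \<le> norm x"
    "\<And>x. 2 *\<^sub>R Y x = E x + Y (Y x)"
    "\<And>W x. bounded_clinear W \<Longrightarrow> (\<And>x. W (E x) = E (W x)) \<Longrightarrow> W (Y x) = Y (W x)"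
    using sqrt_iter_limit[OF bE nE hE] by blast
  define P where "P x = sqrt K *\<^sub>R (x - Y x)" for x
  show ?thesis
  proof (rule that)
    have "Re (cinner (Y x) x) \<le> (norm x)\<^sup>2" for x
      using Re_cinner_le[of "Y x" x] mult_right_mono[OF Y(3)[of x], of "norm x"] by (simp add: power2_eq_square)
    then show "positive_op P"
      unfolding P_def using Y(1,2) K
      by (intro positive_opI bounded_clinear_intros) (auto simp: hermitian_def cinner_simps norm_sq_cinner)
    fix x
    have "P (P x) = K *\<^sub>R (x - 2 *\<^sub>R Y x + Y (Y x))"
    proof -
      have "P (P x) = (sqrt K * sqrt K) *\<^sub>R ((x - Y x) - Y (x - Y x))"
        by (simp only: P_def bcl_simps[OF Y(1)] flip: scaleR_scaleR scaleR_right_diff_distrib)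
      also have "(x - Y x) - Y (x - Y x) = x - 2 *\<^sub>R Y x + Y (Y x)"
        by (simp add: bcl_diff[OF Y(1)] scaleR_2)
      finally show ?thesis using K by simp
    qed
    also have "\<dots> = S x" using K by (simp add: Y(4) E_def)
    finally show "P (P x) = S x" .
  next
    fix W :: "'a \<Rightarrow> 'a" and x assume W: "bounded_clinear W" "\<And>x. W (S x) = S (W x)"
    then have WE: "W (E x) = E (W x)" for x by (simp add: E_def bcl_simps[OF W(1)])
    have "W (Y x) = Y (W x)" by (rule Y(5)) (fact W(1), fact WE)
    then show "W (P x) = P (W x)" by (simp add: P_def bcl_simps[OF W(1)])
  qed
qed

text \<open>With \<open>D = P - Q\<close> commutation gives \<open>(P + Q) D = 0\<close>. The forms
  of \<open>P\<close> and \<open>Q\<close> at \<open>D x\<close> are nonnegative with sum 0, so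
  \<open>P D = Q D = 0\<close> and \<open>D^2 = 0\<close>.\<close>

lemma positive_sqrt_unique:
  fixes P Q :: "'a::chilbert_space \<Rightarrow> 'a"
  assumes P: "positive_op P" and Q: "positive_op Q" and eq: "\<And>x. P (P x) = Q (Q x)"
    and comm: "\<And>x. Q (P x) = P (Q x)"
  shows "P = Q"
proof
  fix x
  note bP = positive_op_bcl[OF P] and bQ = positive_op_bcl[OF Q]
  define D where "D x = P x - Q x" for x
  have hD: "cinner (D x) y = cinner x (D y)" for x y
    using hermitianD[OF positive_op_hermitian[OF P]] hermitianD[OF positive_op_hermitian[OF Q]]
    by (simp add: D_def cinner_simps)
  have "P (D x) + Q (D x) = 0" for x by (simp add: D_def bcl_simps[OF bP] bcl_simps[OF bQ] eq comm)
  then have "Re (cinner (P (D x)) (D x)) + Re (cinner (Q (D x)) (D x)) = 0" for x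
    by (metis cinner_add_left cinner_zero_left plus_complex.sel(1) zero_complex.sel(1))
  then have "Re (cinner (P (D x)) (D x)) = 0" "Re (cinner (Q (D x)) (D x)) = 0" for x
    using positive_op_nonneg[OF P, of "D x"] positive_op_nonneg[OF Q, of "D x"] by (metis add_nonneg_eq_0_iff)+
  then have "P (D x) = 0" "Q (D x) = 0"
    using positive_op_cinner_0 P Q by blast+
  then have "D (D x) = 0" by (simp add: D_def[of "D x"])
  then have "cinner (D x) (D x) = 0" by (simp add: hD)
  then show "P x = Q x" by (simp add: D_def)
qed

lemma
  fixes S :: "'a::chilbert_space \<Rightarrow> 'a"
  assumes S: "positive_op S"
  shows positive_op_sqrt: "positive_op (op_sqrt S)"
    and op_sqrt_square: "op_sqrt S (op_sqrt S x) = S x"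
    and op_sqrt_commute: "bounded_clinear W \<Longrightarrow> (\<And>x. W (S x) = S (W x)) \<Longrightarrow> W (op_sqrt S x) = op_sqrt S (W x)"
    and op_sqrt_eqI: "positive_op Q \<Longrightarrow> (\<And>x. Q (Q x) = S x) \<Longrightarrow> op_sqrt S = Q"
proof -
  obtain P where P: "positive_op P" "\<And>x. P (P x) = S x"
    "\<And>W x. bounded_clinear W \<Longrightarrow> (\<And>x. W (S x) = S (W x)) \<Longrightarrow> W (P x) = P (W x)"
    using positive_sqrt_exists[OF S] by blast
  have uniq: "P = Q" if Q: "positive_op Q" "\<And>x. Q (Q x) = S x" for Q
  proof (rule positive_sqrt_unique[OF P(1) Q(1)])
    \<comment> \<open>\<open>Q\<close> commutes with its own square \<open>S\<close>, hence with the
      root already constructed.\<close>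
    have "Q (S x) = S (Q x)" for x by (simp only: Q(2)[symmetric])
    then show "Q (P x) = P (Q x)" for x by (rule P(3)[OF positive_op_bcl[OF Q(1)]])
  qed (simp add: P Q)
  have eq: "op_sqrt S = P"
    unfolding op_sqrt_def
  proof (rule the_equality)
    show "positive_op P \<and> P \<circ> P = S" using P by auto
    show "Q = P" if "positive_op Q \<and> Q \<circ> Q = S" for Q
      using that uniq[of Q] by (auto simp: fun_eq_iff)
  qed
  show "positive_op (op_sqrt S)" unfolding eq by (rule P(1))
  show "op_sqrt S (op_sqrt S x) = S x" unfolding eq by (rule P(2))
  show "W (op_sqrt S x) = op_sqrt S (W x)"
    if "bounded_clinear W" "\<And>x. W (S x) = S (W x)"
    unfolding eq by (rule P(3)) (fact that)+
  show "op_sqrt S = Q" if "positive_op Q" "\<And>x. Q (Q x) = S x"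
    unfolding eq by (rule uniq) (fact that)+
qed

section \<open>Finite-dimensional subspaces\<close>

lemma clinear_image_cspan:
  assumes "\<And>x y. \<psi> (x + y) = \<psi> x + \<psi> y" "\<And>c x. \<psi> (c *\<^sub>C x) = c *\<^sub>C \<psi> x"
  shows "x \<in> cspan B \<Longrightarrow> \<psi> x \<in> cspan (\<psi> ` B)"
proof -
  have "\<psi> 0 = 0" using assms(1)[of 0 0] by simp
  then have "csubspace {x. \<psi> x \<in> cspan (\<psi> ` B)}"
    by (auto simp: complex_vector.subspace_def assms intro: complex_vector.span_zero
        complex_vector.span_add complex_vector.span_scale)
  then have "cspan B \<subseteq> {x. \<psi> x \<in> cspan (\<psi> ` B)}"
    by (intro complex_vector.span_minimal) (auto intro: complex_vector.span_base)
  then show "x \<in> cspan B \<Longrightarrow> \<psi> x \<in> cspan (\<psi> ` B)" by blast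
qed

text \<open>An injective map would carry \<open>B\<close> to an independent set of the same size
  inside the span of fewer vectors.\<close>

lemma clinear_kernel_nontrivial:
  fixes \<psi> :: "'a::complex_inner \<Rightarrow> 'b::complex_inner"
  assumes lin: "\<And>x y. \<psi> (x + y) = \<psi> x + \<psi> y" "\<And>c x. \<psi> (c *\<^sub>C x) = c *\<^sub>C \<psi> x"
    and B: "finite B" "\<not> cdependent B" and L: "finite L" "\<And>b. b \<in> B \<Longrightarrow> \<psi> b \<in> cspan L" "card L < card B"
  shows "\<exists>x\<in>cspan B. x \<noteq> 0 \<and> \<psi> x = 0"
proof (rule ccontr)
  assume *: "\<not> ?thesis"
  interpret \<psi>: module_hom "scaleC :: complex \<Rightarrow> 'a \<Rightarrow> 'a" "scaleC :: complex \<Rightarrow> 'b \<Rightarrow> 'b" \<psi>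
    by unfold_locales (simp_all add: lin)
  have inj: "inj_on \<psi> (cspan B)"
  proof (rule inj_onI)
    fix x y assume xy: "x \<in> cspan B" "y \<in> cspan B" "\<psi> x = \<psi> y"
    then have "\<psi> (x - y) = 0" by (simp add: \<psi>.diff)
    moreover have "x - y \<in> cspan B" using xy by (intro complex_vector.span_diff)
    ultimately show "x = y" using * by auto
  qed
  then have "\<not> cdependent (\<psi> ` B)"
    using \<psi>.independent_injective_image B(2) unfolding cdependent_def cspan_def by blast
  moreover have "\<psi> ` B \<subseteq> cspan L" using L by auto
  ultimately have "card (\<psi> ` B) \<le> card L"
    using complex_vector.independent_span_bound L(1) by blast
  moreover have "card (\<psi> ` B) = card B"
    using inj_on_subset[OF inj] complex_vector.span_superset by (intro card_image) blast
  ultimately show False using L(3) by simp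
qed

text \<open>For \<open>\<psi> x\<close> as below, \<open>cinner (\<psi> x) x\<close> is the sum of
  the squared moduli of \<open>cinner x l\<close>, so the kernel of \<open>\<psi>\<close> consists
  of vectors orthogonal to \<open>L\<close>.\<close>

lemma exists_orthogonal_in_cspan:
  fixes B :: "'a::complex_inner set"
  assumes B: "finite B" "\<not> cdependent B" and L: "finite L" "card L < card B"
  shows "\<exists>x\<in>cspan B. x \<noteq> 0 \<and> x \<in> cortho L"
proof -
  define \<psi> where "\<psi> x = (\<Sum>l\<in>L. cinner x l *\<^sub>C l)" for x :: 'a
  have "\<exists>x\<in>cspan B. x \<noteq> 0 \<and> \<psi> x = 0"
  proof (rule clinear_kernel_nontrivial[OF _ _ B L(1) _ L(2)])
    show "\<psi> (x + y) = \<psi> x + \<psi> y" for x y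
      by (simp add: \<psi>_def cinner_simps scaleC_add_left sum.distrib)
    show "\<psi> (c *\<^sub>C x) = c *\<^sub>C \<psi> x" for c x
      by (simp add: \<psi>_def cinner_simps complex_vector.scale_sum_right)
    show "\<psi> b \<in> cspan L" for b
      unfolding \<psi>_def by (intro complex_vector.span_sum complex_vector.span_scale complex_vector.span_base)
  qed
  then obtain x where x: "x \<in> cspan B" "x \<noteq> 0" "\<psi> x = 0" by blast
  have "0 = Re (cinner (\<psi> x) x)" by (simp add: x)
  also have "\<dots> = (\<Sum>l\<in>L. (cmod (cinner x l))\<^sup>2)"
  proof -
    have "cinner x l * cinner l x = complex_of_real ((cmod (cinner x l))\<^sup>2)" for l
      using complex_norm_square[of "cinner x l"] by (simp add: cinner_commute[of l x])
    then show ?thesis by (simp add: \<psi>_def cinner_sum_left cinner_scaleC_left)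
  qed
  finally have "\<forall>l\<in>L. (cmod (cinner x l))\<^sup>2 = 0"
    using sum_nonneg_eq_0_iff[OF L(1), of "\<lambda>l. (cmod (cinner x l))\<^sup>2"] by simp
  then show ?thesis using x by (auto simp: cortho_def)
qed

text \<open>More than \<open>card L\<close> independent vectors in \<open>N\<close> would have a
  nonzero combination orthogonal to \<open>L\<close>. This turns a bound off a finite set into
  finite dimension.\<close>

lemma has_cdim_if_cortho_trivial:
  assumes N: "csubspace N" and L: "finite L" and triv: "\<And>x. x \<in> N \<Longrightarrow> x \<in> cortho L \<Longrightarrow> x = 0"
  obtains k where "k \<le> card L" "has_cdim N k"
proof -
  obtain B where B: "B \<subseteq> N" "\<not> cdependent B" "N \<subseteq> cspan B"
    using complex_vector.maximal_independent_subset by blast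
  have bound: "card B' \<le> card L" if B': "B' \<subseteq> B" "finite B'" for B'
  proof (rule ccontr)
    assume "\<not> card B' \<le> card L"
    moreover have "\<not> cdependent B'" using B(2) B'(1) complex_vector.independent_mono by blast
    ultimately obtain x where x: "x \<in> cspan B'" "x \<noteq> 0" "x \<in> cortho L"
      using exists_orthogonal_in_cspan[OF B'(2) _ L] by force
    have "cspan B' \<subseteq> N" using B' B by (intro complex_vector.span_minimal N) auto
    then show False using x triv by auto
  qed
  have "finite B"
  proof (rule ccontr)
    assume "infinite B"
    then obtain B' where "B' \<subseteq> B" "finite B'" "card B' = Suc (card L)"
      using infinite_arbitrarily_large by metis
    then show False using bound[of B'] by simp
  qed
  moreover have "cspan B = N" using B by (intro equalityI complex_vector.span_minimal N)
  ultimately have "has_cdim N (card B)" using B unfolding has_cdim_def by blast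
  then show ?thesis using that bound[of B] \<open>finite B\<close> by blast
qed

lemma infinite_cdim_orthogonal:
  assumes "\<not> finite_cdim (UNIV :: 'a::complex_inner set)" "finite L"
  obtains x :: "'a::complex_inner" where "x \<noteq> 0" "x \<in> cortho L"
proof (rule ccontr)
  assume "\<not> thesis"
  then have "x = 0" if "x \<in> cortho L" for x :: 'a using that \<open>\<And>x. x \<noteq> 0 \<Longrightarrow> x \<in> cortho L \<Longrightarrow> thesis\<close> by blast
  then obtain k where "has_cdim (UNIV :: 'a set) k"
    using has_cdim_if_cortho_trivial[OF complex_vector.subspace_UNIV assms(2)] by metis
  then show False using assms(1) by (auto simp: finite_cdim_def)
qed

lemma has_cdim_orthogonal:
  assumes "has_cdim M k" "finite L" "card L < k"
  obtains x where "x \<in> M" "x \<noteq> 0" "x \<in> cortho L"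
proof -
  obtain B where B: "finite B" "\<not> cdependent B" "card B = k" "cspan B = M"
    using assms(1) unfolding has_cdim_def by blast
  then show ?thesis using exists_orthogonal_in_cspan[OF B(1,2) assms(2)] assms(3) that by auto
qed

lemma has_cdim_csubspace: "has_cdim M k \<Longrightarrow> csubspace M"
  by (auto simp: has_cdim_def)

text \<open>Only the first \<open>k\<close> values count, so initial segments of a longer or
  infinite system need no new indexing.\<close>

definition orthonormal :: "(nat \<Rightarrow> 'a::complex_inner) \<Rightarrow> nat \<Rightarrow> bool" where
  "orthonormal e k \<longleftrightarrow> (\<forall>i<k. \<forall>j<k. cinner (e i) (e j) = (if i = j then 1 else 0))"

definition oproj :: "(nat \<Rightarrow> 'a::complex_inner) \<Rightarrow> nat \<Rightarrow> 'a \<Rightarrow> 'a" where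
  "oproj e k x = (\<Sum>i<k. cinner x (e i) *\<^sub>C e i)"

lemma bounded_clinear_oproj: "bounded_clinear (oproj e k)"
  unfolding oproj_def by (intro bounded_clinear_intros)

lemma oproj_in_cspan: "oproj e k x \<in> cspan (e ` {..<k})"
  unfolding oproj_def
  by (intro complex_vector.span_sum complex_vector.span_scale complex_vector.span_base) auto

lemma cinner_lincomb_orthonormal:
  assumes "orthonormal e k" "j < k"
  shows "cinner (\<Sum>i<k. c i *\<^sub>C e i) (e j) = c j"
proof -
  have "cinner (\<Sum>i<k. c i *\<^sub>C e i) (e j) = (\<Sum>i<k. if i = j then c i else 0)"
    unfolding cinner_sum_left using assms by (intro sum.cong) (auto simp: cinner_simps orthonormal_def)
  then show ?thesis using assms(2) by simp
qed

lemma diff_oproj_cortho: "orthonormal e k \<Longrightarrow> x - oproj e k x \<in> cortho (cspan (e ` {..<k}))"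
  unfolding cortho_cspan
  by (auto simp: cortho_def oproj_def cinner_diff_left
      cinner_lincomb_orthonormal[where c = "\<lambda>i. cinner x (e i)"])

lemma orth_proj_eqI:
  assumes "csubspace M" "y \<in> M" "x - y \<in> cortho M"
  shows "orth_proj M x = y"
  unfolding orth_proj_def
proof (rule the_equality)
  show "y \<in> M \<and> (\<forall>z\<in>M. cinner (x - y) z = 0)" using assms by (auto simp: cortho_def)
  fix y' assume y': "y' \<in> M \<and> (\<forall>z\<in>M. cinner (x - y') z = 0)"
  have "y - y' \<in> M" using assms y' by (intro complex_vector.subspace_diff) auto
  then have "cinner ((x - y') - (x - y)) (y - y') = 0"
    using assms y' by (subst cinner_diff_left) (auto simp: cortho_def)
  then show "y' = y" by simp
qed

lemma orth_proj_cspan: "orthonormal e k \<Longrightarrow> orth_proj (cspan (e ` {..<k})) = oproj e k"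
  by (intro ext orth_proj_eqI complex_vector.subspace_span oproj_in_cspan diff_oproj_cortho)

lemma oproj_cspan:
  fixes x :: "'a::chilbert_space"
  assumes "orthonormal e k" "x \<in> cspan (e ` {..<k})"
  shows "oproj e k x = x"
proof -
  have "x - x \<in> cortho (cspan (e ` {..<k}))" by (simp add: complex_vector.subspace_0[OF csubspace_cortho])
  from orth_proj_eqI[OF _ assms(2) this] show ?thesis by (simp add: orth_proj_cspan[OF assms(1)])
qed

lemma hermitian_oproj: "hermitian (oproj e k)"
  unfolding hermitian_def oproj_def
proof (intro allI)
  fix x y
  show "cinner (\<Sum>i<k. cinner x (e i) *\<^sub>C e i) y = cinner x (\<Sum>i<k. cinner y (e i) *\<^sub>C e i)"
    unfolding cinner_sum_left cinner_sum_right cinner_scaleC_left cinner_scaleC_right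
    by (intro sum.cong refl) (simp add: mult.commute flip: cinner_commute)
qed

lemma norm_lincomb_orthonormal:
  assumes "orthonormal e k"
  shows "(norm (\<Sum>i<k. c i *\<^sub>C e i))\<^sup>2 = (\<Sum>i<k. (cmod (c i))\<^sup>2)"
proof -
  let ?z = "\<Sum>i<k. c i *\<^sub>C e i"
  have "cinner ?z ?z = (\<Sum>j<k. cnj (c j) * c j)"
    unfolding cinner_sum_right[of ?z] cinner_scaleC_right
    using cinner_lincomb_orthonormal[OF assms] by simp
  also have "\<dots> = complex_of_real (\<Sum>i<k. (cmod (c i))\<^sup>2)"
    by (simp add: complex_norm_square mult.commute del: of_real_power)
  finally show ?thesis by (simp add: norm_sq_cinner)
qed

lemma norm_oproj_sq: "orthonormal e k \<Longrightarrow> (norm (oproj e k x))\<^sup>2 = (\<Sum>i<k. (cmod (cinner x (e i)))\<^sup>2)"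
  unfolding oproj_def by (rule norm_lincomb_orthonormal)

text \<open>Gram--Schmidt, one vector at a time; independence keeps the residual \<open>v\<close>
  nonzero.\<close>

lemma orthonormal_basis_exists:
  assumes "finite B" "\<not> cdependent (B :: 'a::complex_inner set)"
  shows "\<exists>e. orthonormal e (card B) \<and> cspan (e ` {..<card B}) = cspan B"
  using assms
proof (induction B rule: finite_induct)
  case empty
  then show ?case by (simp add: orthonormal_def)
next
  case (insert b B)
  have indep: "\<not> cdependent B" "b \<notin> cspan B"
    using insert.prems insert.hyps by (simp_all add: complex_vector.independent_insert)
  define k where "k = card B"
  obtain e where e: "orthonormal e k" "cspan (e ` {..<k}) = cspan B"
    using insert.IH indep unfolding k_def by blast
  define v where "v = b - oproj e k b"
  have p: "oproj e k b \<in> cspan B" using oproj_in_cspan[of e k b] e by simp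
  have "v \<noteq> 0" using p indep by (auto simp: v_def)
  have v: "cinner v (e i) = 0" if "i < k" for i
    using diff_oproj_cortho[OF e(1), of b] that unfolding cortho_cspan by (auto simp: v_def cortho_def)
  define w where "w = (1 / norm v) *\<^sub>R v"
  have w: "cinner w w = 1"
    using \<open>v \<noteq> 0\<close> by (simp add: w_def cinner_simps cinner_self_norm power2_eq_square)
  have we: "cinner w (e i) = 0" "cinner (e i) w = 0" if "i < k" for i
    using v[OF that] cinner_zero_commute[of v "e i"] by (auto simp: w_def cinner_simps)
  define e' where "e' = e(k := w)"
  have "orthonormal e' (Suc k)"
    using e(1) w we unfolding orthonormal_def e'_def by (auto simp: less_Suc_eq)
  moreover have "cspan (e' ` {..<Suc k}) = cspan (insert b B)"
  proof -
    have im: "e' ` {..<Suc k} = insert w (e ` {..<k})" by (auto simp: e'_def less_Suc_eq image_iff)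
    have sub: "cspan B \<subseteq> cspan (insert b B)" by (intro complex_vector.span_mono) auto
    have "v \<in> cspan (insert b B)"
      unfolding v_def using p sub by (intro complex_vector.span_diff) (auto intro: complex_vector.span_base)
    then have "w \<in> cspan (insert b B)" by (simp add: w_def scaleR_scaleC complex_vector.span_scale)
    moreover have "e ` {..<k} \<subseteq> cspan (insert b B)"
      using complex_vector.span_superset[of "e ` {..<k}"] sub unfolding e(2) by (rule order_trans)
    ultimately have 1: "cspan (insert w (e ` {..<k})) \<subseteq> cspan (insert b B)"
      by (intro complex_vector.span_minimal complex_vector.subspace_span) auto
    have sub': "cspan B \<subseteq> cspan (insert w (e ` {..<k}))"
      unfolding e(2)[symmetric] by (intro complex_vector.span_mono) auto
    have "v = norm v *\<^sub>R w" using \<open>v \<noteq> 0\<close> by (simp add: w_def)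
    then have "v \<in> cspan (insert w (e ` {..<k}))"
      using complex_vector.span_scale[OF complex_vector.span_base[of w "insert w (e ` {..<k})"], of "norm v"]
      by (simp flip: scaleR_scaleC)
    then have "v + oproj e k b \<in> cspan (insert w (e ` {..<k}))"
      using p sub' by (intro complex_vector.span_add) auto
    then have "b \<in> cspan (insert w (e ` {..<k}))" by (simp add: v_def)
    then have 2: "cspan (insert b B) \<subseteq> cspan (insert w (e ` {..<k}))"
      using sub' complex_vector.span_superset[of B]
      by (intro complex_vector.span_minimal complex_vector.subspace_span) auto
    show ?thesis unfolding im using 1 2 by blast
  qed
  ultimately show ?case using insert.hyps by (auto simp: k_def)
qed

lemma has_cdim_orthonormal_basis:
  assumes "has_cdim M k"
  obtains e where "orthonormal e k" "cspan (e ` {..<k}) = M"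
proof -
  obtain B where B: "finite B" "\<not> cdependent B" "card B = k" "cspan B = M"
    using assms(1) unfolding has_cdim_def by blast
  then show ?thesis using orthonormal_basis_exists[OF B(1,2)] that by auto
qed

lemma has_cdim_cspan_orthonormal:
  assumes e: "orthonormal e k"
  shows "has_cdim (cspan (e ` {..<k})) k"
proof -
  have "inj_on e {..<k}"
    using e by (intro inj_onI) (metis lessThan_iff orthonormal_def zero_neq_one)
  moreover have "\<not> cdependent (e ` {..<k})"
  proof
    assume "cdependent (e ` {..<k})"
    then obtain i where i: "i < k" "e i \<in> cspan (e ` {..<k} - {e i})"
      unfolding complex_vector.dependent_def by auto
    have "e i \<in> cortho (cspan (e ` {..<k} - {e i}))"
      unfolding cortho_cspan using e i(1) by (auto simp: cortho_def orthonormal_def split: if_splits)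
    then have "cinner (e i) (e i) = 0" using i(2) by (rule corthoD)
    then show False using e i(1) by (auto simp: orthonormal_def simp del: cinner_eq_zero_iff)
  qed
  ultimately show ?thesis unfolding has_cdim_def by (intro exI[of _ "e ` {..<k}"]) (auto simp: card_image)
qed

lemma has_cdim_mono:
  assumes "has_cdim M k" "j \<le> k"
  obtains M' where "M' \<subseteq> M" "has_cdim M' j"
proof -
  obtain e where e: "orthonormal e k" "cspan (e ` {..<k}) = M" using has_cdim_orthonormal_basis assms by metis
  have "orthonormal e j" using e(1) assms(2) by (auto simp: orthonormal_def)
  then have "has_cdim (cspan (e ` {..<j})) j" by (rule has_cdim_cspan_orthonormal)
  moreover have "cspan (e ` {..<j}) \<subseteq> M"
    unfolding e(2)[symmetric] using assms(2) by (intro complex_vector.span_mono) auto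
  ultimately show ?thesis using that by blast
qed

text \<open>With \<open>v\<close> the part of \<open>b\<close> orthogonal to \<open>M\<close>, the
  coefficient of \<open>b\<close> in \<open>x\<close> can only be
  \<open>cinner x v / cinner b v\<close>. The span is thus the preimage of \<open>M\<close> under a
  continuous map.\<close>

lemma closed_cspan_insert:
  fixes M :: "'a::chilbert_space set"
  assumes M: "csubspace M" "closed M"
  shows "closed (cspan (insert b M))"
proof (cases "b \<in> M")
  case True
  moreover have "cspan M = M" using M by simp
  ultimately show ?thesis using M(2) by (simp add: insert_absorb del: complex_vector.span_eq_iff)
next
  case False
  obtain p where p: "p \<in> M" "\<forall>z\<in>M. cinner (b - p) z = 0" using projection_exists[OF M] by metis
  define v where "v = b - p"
  have "v \<noteq> 0" using p False by (auto simp: v_def)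
  have mv: "cinner z v = 0" if "z \<in> M" for z using p(2) that cinner_zero_commute v_def by metis
  have "cinner b v = cinner v v" using mv[OF p(1)] by (simp add: v_def cinner_simps)
  then have bv: "cinner b v \<noteq> 0" using \<open>v \<noteq> 0\<close> by simp
  have "cspan (insert b M) = {x. x - (cinner x v / cinner b v) *\<^sub>C b \<in> M}"
  proof -
    have M_eq: "cspan M = M" using M by simp
    have "k = cinner x v / cinner b v" if "x - k *\<^sub>C b \<in> M" for x k
      using mv[OF that] bv by (simp add: cinner_simps)
    then show ?thesis unfolding complex_vector.span_insert M_eq by blast
  qed
  moreover have "bounded_clinear (\<lambda>x. x - (cinner x v / cinner b v) *\<^sub>C b)"
  proof -
    have "bounded_clinear (\<lambda>x. x - cinner x v *\<^sub>C ((1 / cinner b v) *\<^sub>C b))"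
      by (intro bounded_clinear_diff bounded_clinear_id bounded_clinear_cinner)
    then show ?thesis by (simp add: scaleC_scaleC)
  qed
  then have "continuous_on UNIV (\<lambda>x. x - (cinner x v / cinner b v) *\<^sub>C b)"
    using bounded_clinear_bounded_linear linear_continuous_on by blast
  then have "closed ((\<lambda>x. x - (cinner x v / cinner b v) *\<^sub>C b) -` M)"
    using M(2) by (simp add: continuous_on_closed_vimage)
  ultimately show ?thesis by (simp add: vimage_def)
qed

lemma closed_cspan_Un_finite:
  fixes M :: "'a::chilbert_space set"
  assumes M: "csubspace M" "closed M" and "finite B"
  shows "closed (cspan (B \<union> M))"
  using \<open>finite B\<close>
proof (induction B)
  case empty
  have "cspan M = M" using M by simp
  then show ?case using M(2) by (simp del: complex_vector.span_eq_iff)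
next
  case (insert b B)
  have "cspan (insert b (cspan (B \<union> M))) = cspan (insert b B \<union> M)"
  proof (rule subset_antisym)
    have "cspan (B \<union> M) \<subseteq> cspan (insert b B \<union> M)" by (intro complex_vector.span_mono) auto
    then show "cspan (insert b (cspan (B \<union> M))) \<subseteq> cspan (insert b B \<union> M)"
      by (intro complex_vector.span_minimal complex_vector.subspace_span)
        (auto intro: complex_vector.span_base)
    show "cspan (insert b B \<union> M) \<subseteq> cspan (insert b (cspan (B \<union> M)))"
      using complex_vector.span_superset[of "B \<union> M"] by (intro complex_vector.span_mono) auto
  qed
  then show ?case using closed_cspan_insert[OF complex_vector.subspace_span insert.IH, of b] by simp
qed

lemma closed_cspan_finite:
  fixes B :: "'a::chilbert_space set"
  assumes "finite B"
  shows "closed (cspan B)"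
  using closed_cspan_Un_finite[of "{0}" B] assms by (simp add: complex_vector.span_insert_0)

text \<open>A surjection \<open>1 + Q\<close> with \<open>Q\<close> of finite rank preserves the span \<open>E\<close> of the range of
  \<open>Q\<close> and maps it onto itself, and \<open>E\<close> contains the kernel.\<close>

lemma Fredholm_alternative:
  fixes A :: "'a::complex_inner \<Rightarrow> 'b::complex_inner"
  assumes R: "bounded_clinear R" "\<And>x. R (A x) = x" and T: "bounded_clinear T" "\<And>x. T x \<in> cspan E0" "finite E0"
    and surj: "\<And>y. \<exists>x. A x + T x = y" and Rs: "\<And>y. A (R y) = y"
    and x: "A x + T x = 0"
  shows "x = 0"
proof (rule ccontr)
  assume "x \<noteq> 0"
  define E where "E = cspan (R ` E0)"
  have sE: "csubspace E" by (simp add: E_def)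
  define Q where "Q z = R (T z)" for z
  have Q: "Q z \<in> E" for z
    unfolding Q_def E_def by (rule clinear_image_cspan[OF bcl_add[OF R(1)] bcl_scaleC[OF R(1)] T(2)])
  define \<psi> where "\<psi> z = z + Q z" for z
  have \<psi>_eq: "\<psi> z = R (A z + T z)" for z by (simp add: \<psi>_def Q_def bcl_add[OF R(1)] R(2))
  have lin: "\<psi> (y + z) = \<psi> y + \<psi> z" "\<psi> (c *\<^sub>C z) = c *\<^sub>C \<psi> z" for y z c
    by (simp_all add: \<psi>_def Q_def bcl_simps[OF R(1)] bcl_simps[OF T(1)] scaleC_add_right)
  have \<psi>0: "\<psi> x = 0" unfolding \<psi>_eq x by (rule bcl_zero[OF R(1)])
  have inE: "z \<in> E" if "\<psi> z \<in> E" for z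
    using complex_vector.subspace_diff[OF sE that Q[of z]] by (simp add: \<psi>_def)
  have "x \<in> E" using inE \<psi>0 complex_vector.subspace_0[OF sE] by simp
  have "\<not> cdependent {x}" using \<open>x \<noteq> 0\<close> by simp
  \<comment> \<open>The kernel vector \<open>x\<close> is made part of the basis, so that the images
    of the remaining \<open>card B - 1\<close> vectors already span \<open>E\<close>.\<close>
  then obtain B where B: "{x} \<subseteq> B" "B \<subseteq> E" "\<not> cdependent B" "E \<subseteq> cspan B"
    using complex_vector.maximal_independent_subset_extend[of "{x}" E] \<open>x \<in> E\<close> by blast
  have fB: "finite B"
    using complex_vector.independent_span_bound[of "R ` E0" B] B T(3) by (simp add: E_def)
  have "E \<subseteq> cspan (\<psi> ` (B - {x}))"
  proof
    fix y assume "y \<in> E"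
    obtain z where "A z + T z = A y" using surj by blast
    then have z: "\<psi> z = y" by (simp add: \<psi>_eq R(2))
    then have "z \<in> cspan B" using inE \<open>y \<in> E\<close> B by blast
    then have "y \<in> cspan (\<psi> ` B)" using clinear_image_cspan[of \<psi>, OF lin] z by blast
    moreover have "\<psi> ` B = insert 0 (\<psi> ` (B - {x}))" using B(1) \<psi>0 by force
    ultimately show "y \<in> cspan (\<psi> ` (B - {x}))" by (simp add: complex_vector.span_insert_0)
  qed
  then have "card B \<le> card (\<psi> ` (B - {x}))"
    using complex_vector.independent_span_bound[of "\<psi> ` (B - {x})" B] B fB by auto
  also have "\<dots> \<le> card (B - {x})" using fB by (intro card_image_le) auto
  also have "\<dots> < card B" using fB B(1) by (intro card_Diff1_less) auto
  finally show False by simp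
qed

text \<open>Recursive choice, with \<open>L k\<close> collecting the earlier vectors and their
  \<open>H\<close>-images. Taking \<open>H\<close> as \<open>Th\<close> after \<open>F\<close> makes
  the images under \<open>F\<close> orthogonal too; the index in \<open>P\<close> allows shrinking
  tolerances.\<close>

lemma orthogonal_sequence:
  fixes P :: "nat \<Rightarrow> 'a::complex_inner \<Rightarrow> bool"
  assumes ex: "\<And>k L. finite L \<Longrightarrow> \<exists>x. x \<in> cortho L \<and> P k x"
  shows "\<exists>x. (\<forall>k. P k (x k)) \<and> (\<forall>j k. j < k \<longrightarrow> cinner (x k) (x j) = 0 \<and> cinner (x k) (H (x j)) = 0)"
proof -
  define pick where "pick k L = (SOME x. x \<in> cortho L \<and> P k x)" for k L
  have pick: "pick k L \<in> cortho L \<and> P k (pick k L)" if "finite L" for k L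
    unfolding pick_def by (rule someI_ex) (rule ex[OF that])
  define L where "L = rec_nat {} (\<lambda>k L. L \<union> {pick k L, H (pick k L)})"
  have L: "L 0 = {}" "L (Suc k) = L k \<union> {pick k (L k), H (pick k (L k))}" for k
    by (simp_all add: L_def)
  have fin: "finite (L k)" for k by (induction k) (auto simp: L)
  have mono: "L j \<subseteq> L k" if "j \<le> k" for j k
    using that by (induction k rule: dec_induct) (auto simp: L)
  have mem: "pick j (L j) \<in> L k" "H (pick j (L j)) \<in> L k" if "j < k" for j k
    using mono[of "Suc j" k] that by (auto simp: L)
  have "P k (pick k (L k))" for k using pick[OF fin] by blast
  moreover have "cinner (pick k (L k)) (pick j (L j)) = 0 \<and> cinner (pick k (L k)) (H (pick j (L j))) = 0"
    if "j < k" for j k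
    using pick[OF fin, of k k] mem[OF that] by (simp add: cortho_def)
  ultimately show ?thesis by (intro exI[of _ "\<lambda>k. pick k (L k)"]) simp
qed

section \<open>Spectra of compressions\<close>

text \<open>\<open>t\<close> is the infimum of the Rayleigh quotient, which need not be attained on
  an infinite-dimensional \<open>M\<close>; hence the clause with \<open>\<epsilon>\<close>.\<close>

lemma form_infimum_exists:
  fixes G :: "'a::chilbert_space \<Rightarrow> 'a"
  assumes G: "bounded_clinear G" and M: "csubspace M" "x0 \<in> M" "x0 \<noteq> 0"
  shows "\<exists>t. (\<forall>x\<in>M. t * (norm x)\<^sup>2 \<le> Re (cinner (G x) x)) \<and>
    (\<forall>\<epsilon>>0. \<exists>x\<in>M. x \<noteq> 0 \<and> Re (cinner (G x) x) \<le> (t + \<epsilon>) * (norm x)\<^sup>2)"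
proof -
  obtain K where K: "0 < K" "\<And>x. norm (G x) \<le> K * norm x" using bcl_pos_bound[OF G] by blast
  define Q where "Q = (\<lambda>x. Re (cinner (G x) x) / (norm x)\<^sup>2) ` {x\<in>M. x \<noteq> 0}"
  have ne: "Q \<noteq> {}" using M by (auto simp: Q_def)
  have "- K \<le> Re (cinner (G x) x) / (norm x)\<^sup>2" if "x \<noteq> 0" for x
  proof -
    have "\<bar>Re (cinner (G x) x)\<bar> \<le> K * (norm x)\<^sup>2"
      using Re_cinner_le[of "G x" x] mult_right_mono[OF K(2)[of x], of "norm x"] by (simp add: power2_eq_square)
    then have "- (K * (norm x)\<^sup>2) \<le> Re (cinner (G x) x)" by linarith
    then show ?thesis using that by (simp add: field_simps)
  qed
  then have bdd: "bdd_below Q" unfolding Q_def by (intro bdd_belowI[of _ "- K"]) auto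
  show ?thesis
  proof (intro exI[of _ "Inf Q"] conjI ballI allI impI)
    fix x assume "x \<in> M"
    show "Inf Q * (norm x)\<^sup>2 \<le> Re (cinner (G x) x)"
    proof (cases "x = 0")
      case False
      then have "Inf Q \<le> Re (cinner (G x) x) / (norm x)\<^sup>2"
        using \<open>x \<in> M\<close> by (intro cInf_lower bdd) (auto simp: Q_def)
      then show ?thesis using False by (simp add: field_simps)
    qed simp
  next
    fix \<epsilon> :: real assume "0 < \<epsilon>"
    then have "\<exists>q\<in>Q. q < Inf Q + \<epsilon>" using cInf_less_iff[OF ne bdd, of "Inf Q + \<epsilon>"] by simp
    then obtain x where x: "x \<in> M" "x \<noteq> 0" "Re (cinner (G x) x) / (norm x)\<^sup>2 < Inf Q + \<epsilon>"
      by (auto simp: Q_def)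
    then have "Re (cinner (G x) x) \<le> (Inf Q + \<epsilon>) * (norm x)\<^sup>2" by (simp add: field_simps)
    then show "\<exists>x\<in>M. x \<noteq> 0 \<and> Re (cinner (G x) x) \<le> (Inf Q + \<epsilon>) * (norm x)\<^sup>2" using x by blast
  qed
qed

text \<open>Cauchy--Schwarz for the form \<open>cinner ((G - t) x) y\<close>, which is positive semidefinite on
  \<open>M\<close>, in the case where \<open>y\<close> is the component of \<open>(G - t) x\<close> in \<open>M\<close>.\<close>

lemma form_Cauchy_Schwarz:
  fixes G :: "'a::chilbert_space \<Rightarrow> 'a"
  assumes G: "bounded_clinear G" "hermitian G" and M: "csubspace M"
    and low: "\<And>x. x \<in> M \<Longrightarrow> t * (norm x)\<^sup>2 \<le> Re (cinner (G x) x)"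
    and xy: "x \<in> M" "y \<in> M" "cinner (G x - t *\<^sub>R x) y = cinner y y"
  shows "((norm y)\<^sup>2)\<^sup>2 \<le> (Re (cinner (G x) x) - t * (norm x)\<^sup>2) * (Re (cinner (G y) y) - t * (norm y)\<^sup>2)"
proof (rule quadratic_nonneg_imp_discriminant_le)
  fix s :: real
  have "Re (cinner (G x) y) - t * Re (cinner x y) = (norm y)\<^sup>2"
    using arg_cong[OF xy(3), of Re] by (simp add: cinner_simps norm_sq_cinner)
  moreover have "Re (cinner (G y) x) - t * Re (cinner y x) = (norm y)\<^sup>2"
    using calculation hermitianD[OF G(2), of y x] Re_cinner_commute[of y "G x"] Re_cinner_commute[of y x] by simp
  moreover have "x + s *\<^sub>R y \<in> M" using M xy by (intro complex_vector.subspace_add csubspace_scaleR)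
  then have "0 \<le> Re (cinner (G (x + s *\<^sub>R y)) (x + s *\<^sub>R y)) - t * (norm (x + s *\<^sub>R y))\<^sup>2"
    using low by simp
  then have "0 \<le> Re (cinner (G x) x) - t * (norm x)\<^sup>2
      + s * (Re (cinner (G x) y) - t * Re (cinner x y)) + s * (Re (cinner (G y) x) - t * Re (cinner y x))
      + s\<^sup>2 * (Re (cinner (G y) y) - t * (norm y)\<^sup>2)"
  proof -
    have "(norm (x + s *\<^sub>R y))\<^sup>2 = (norm x)\<^sup>2 + 2 * s * Re (cinner x y) + s\<^sup>2 * (norm y)\<^sup>2"
      by (simp add: norm_add_sq cinner_scaleR_right power_mult_distrib)
    moreover have "Re (cinner (G (x + s *\<^sub>R y)) (x + s *\<^sub>R y)) = Re (cinner (G x) x)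
        + s * Re (cinner (G x) y) + s * Re (cinner (G y) x) + s\<^sup>2 * Re (cinner (G y) y)"
      by (simp add: bcl_simps[OF G(1)] cinner_simps power2_eq_square algebra_simps)
    ultimately show ?thesis
      using Re_cinner_commute[of y x] \<open>0 \<le> Re _ - _\<close> by (simp add: algebra_simps)
  qed
  ultimately show "0 \<le> Re (cinner (G x) x) - t * (norm x)\<^sup>2 + 2 * s * (norm y)\<^sup>2
      + s\<^sup>2 * (Re (cinner (G y) y) - t * (norm y)\<^sup>2)" by simp
qed

text \<open>Almost minimisers of a form are almost eigenvectors: in
  \<open>form_Cauchy_Schwarz\<close> the first factor is at most
  \<open>\<epsilon> * (norm x)^2\<close>, and the second contributes \<open>(norm y)^2\<close>,
  which cancels.\<close>

lemma form_almost_minimiser: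
  fixes G :: "'a::chilbert_space \<Rightarrow> 'a"
  assumes G: "bounded_clinear G" "hermitian G" and M: "csubspace M"
    and low: "\<And>x. x \<in> M \<Longrightarrow> t * (norm x)\<^sup>2 \<le> Re (cinner (G x) x)"
    and K: "\<And>x. norm (G x) \<le> K * norm x"
    and xy: "x \<in> M" "y \<in> M" "cinner (G x - t *\<^sub>R x) y = cinner y y"
    and \<epsilon>: "Re (cinner (G x) x) \<le> (t + \<epsilon>) * (norm x)\<^sup>2"
  shows "(norm y)\<^sup>2 \<le> \<epsilon> * (K + \<bar>t\<bar>) * (norm x)\<^sup>2"
proof (cases "y = 0")
  \<comment> \<open>Nothing is cancelled here, so the right-hand side must be shown nonnegative,
    with the signs of \<open>K\<close> and \<open>\<epsilon>\<close> derived.\<close>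
  case True
  have "0 \<le> K * norm z" for z :: 'a by (rule order_trans[OF norm_ge_zero K])
  then have "x = 0 \<or> 0 \<le> K" using zero_le_mult_iff[of K "norm x"] by auto
  moreover have "x = 0 \<or> 0 \<le> \<epsilon>"
  proof -
    have "t * (norm x)\<^sup>2 \<le> (t + \<epsilon>) * (norm x)\<^sup>2" using \<epsilon> low xy by (meson order_trans)
    then have "0 \<le> \<epsilon> * (norm x)\<^sup>2" by (simp add: algebra_simps)
    then show ?thesis by (auto simp: zero_le_mult_iff)
  qed
  ultimately show ?thesis using True by auto
next
  case False
  have "Re (cinner (G y) y) - t * (norm y)\<^sup>2 \<le> (K + \<bar>t\<bar>) * (norm y)\<^sup>2"
  proof -
    have "Re (cinner (G y) y) \<le> K * (norm y)\<^sup>2"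
      using Re_cinner_le[of "G y" y] mult_right_mono[OF K[of y], of "norm y"] by (simp add: power2_eq_square)
    moreover have "- t * (norm y)\<^sup>2 \<le> \<bar>t\<bar> * (norm y)\<^sup>2" by (intro mult_right_mono) auto
    ultimately show ?thesis by (simp add: distrib_right)
  qed
  moreover have "Re (cinner (G x) x) - t * (norm x)\<^sup>2 \<le> \<epsilon> * (norm x)\<^sup>2" using \<epsilon> by (simp add: algebra_simps)
  moreover have "0 \<le> Re (cinner (G x) x) - t * (norm x)\<^sup>2" "0 \<le> Re (cinner (G y) y) - t * (norm y)\<^sup>2"
    using low xy by simp_all
  ultimately have "((norm y)\<^sup>2)\<^sup>2 \<le> (\<epsilon> * (norm x)\<^sup>2) * ((K + \<bar>t\<bar>) * (norm y)\<^sup>2)"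
    using form_Cauchy_Schwarz[OF G M low xy] by (meson mult_mono order_trans)
  then have "(norm y)\<^sup>2 * (norm y)\<^sup>2 \<le> (\<epsilon> * (K + \<bar>t\<bar>) * (norm x)\<^sup>2) * (norm y)\<^sup>2"
    by (simp only: power2_eq_square[of "(norm y)\<^sup>2"] mult_ac)
  then show ?thesis by (rule mult_right_le_imp_le) (simp add: False)
qed

text \<open>The infimum \<open>t\<close> of the form is an approximate eigenvalue. At its
  approximate eigenvectors \<open>norm (T z)\<close> is nearly \<open>t * norm z\<close>, so
  \<open>a \<le> t\<close>.\<close>

lemma positive_op_form_ge:
  assumes T: "positive_op T" and low: "\<And>x. a * norm x \<le> norm (T x)"
  shows "a * (norm x)\<^sup>2 \<le> Re (cinner (T x) x)"
proof (cases "x = 0")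
  case False
  note B = positive_op_bcl[OF T] and H = positive_op_hermitian[OF T]
  obtain K where K: "0 < K" "\<And>x. norm (T x) \<le> K * norm x" using bcl_pos_bound[OF B] by blast
  obtain t where "\<forall>x\<in>UNIV. t * (norm x)\<^sup>2 \<le> Re (cinner (T x) x)"
    and t2: "\<forall>\<epsilon>>0. \<exists>x\<in>UNIV. x \<noteq> 0 \<and> Re (cinner (T x) x) \<le> (t + \<epsilon>) * (norm x)\<^sup>2"
    using form_infimum_exists[OF B complex_vector.subspace_UNIV UNIV_I False] by blast
  then have t1: "t * (norm z)\<^sup>2 \<le> Re (cinner (T z) z)" for z by simp
  have "0 \<le> t"
  proof (rule field_le_epsilon)
    fix \<epsilon> :: real assume "0 < \<epsilon>"
    then obtain z where "z \<noteq> 0" "Re (cinner (T z) z) \<le> (t + \<epsilon>) * (norm z)\<^sup>2" using t2 by blast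
    then have "0 \<le> (t + \<epsilon>) * (norm z)\<^sup>2" "0 < (norm z)\<^sup>2"
      using positive_op_nonneg[OF T, of z] by auto
    then show "0 \<le> t + \<epsilon>" by (simp add: zero_le_mult_iff)
  qed
  have "a \<le> t"
  proof (rule field_le_epsilon)
    fix \<eta> :: real assume "0 < \<eta>"
    \<comment> \<open>Chosen so that the residual bound becomes exactly
      \<open>\<eta> * norm z\<close>.\<close>
    define \<epsilon> where "\<epsilon> = \<eta>\<^sup>2 / (K + \<bar>t\<bar>)"
    have "0 < \<epsilon>" using K \<open>0 < \<eta>\<close> by (simp add: \<epsilon>_def add_pos_nonneg)
    then obtain z where z: "z \<noteq> 0" "Re (cinner (T z) z) \<le> (t + \<epsilon>) * (norm z)\<^sup>2" using t2 by blast
    have "(norm (T z - t *\<^sub>R z))\<^sup>2 \<le> \<epsilon> * (K + \<bar>t\<bar>) * (norm z)\<^sup>2"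
      by (rule form_almost_minimiser[OF B H complex_vector.subspace_UNIV t1 K(2)]) (use z in auto)
    also have "\<dots> = (\<eta> * norm z)\<^sup>2" using K by (simp add: \<epsilon>_def power_mult_distrib add_pos_nonneg)
    finally have "norm (T z - t *\<^sub>R z) \<le> \<eta> * norm z"
      by (rule power2_le_imp_le) (use \<open>0 < \<eta>\<close> in simp)
    then have "norm (T z) \<le> (t + \<eta>) * norm z"
      using norm_triangle_ineq2[of "T z" "t *\<^sub>R z"] \<open>0 \<le> t\<close> by (simp add: distrib_right)
    then have "a * norm z \<le> (t + \<eta>) * norm z" using low[of z] by linarith
    then show "a \<le> t + \<eta>" using z(1) by simp
  qed
  then have "a * (norm x)\<^sup>2 \<le> t * (norm x)\<^sup>2" by (intro mult_right_mono) auto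
  then show ?thesis using t1[of x] by simp
qed (simp add: bcl_zero[OF positive_op_bcl[OF T]])

lemma real_min_eqI:
  assumes "complex_of_real t \<in> \<Lambda>" "\<And>r. r < t \<Longrightarrow> complex_of_real r \<notin> \<Lambda>"
  shows "real_min \<Lambda> = t"
  unfolding real_min_def using assms by (intro Least_equality) (auto simp: not_less[symmetric])

text \<open>Almost minimisers of the form on \<open>M\<close> are almost eigenvectors of the
  compression, which excludes a bounded inverse at \<open>t\<close>; for \<open>r < t\<close> the
  shifted form is coercive.\<close>

lemma real_min_spectrum_compression:
  fixes G :: "'a::chilbert_space \<Rightarrow> 'a"
  assumes G: "bounded_clinear G" "hermitian G" and M: "has_cdim M k"
    and low: "\<And>x. x \<in> M \<Longrightarrow> t * (norm x)\<^sup>2 \<le> Re (cinner (G x) x)"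
    and approx: "\<And>\<epsilon>. 0 < \<epsilon> \<Longrightarrow> \<exists>x\<in>M. x \<noteq> 0 \<and> Re (cinner (G x) x) \<le> (t + \<epsilon>) * (norm x)\<^sup>2"
  shows "real_min (spectrum_on M (compression M G)) = t"
proof (rule real_min_eqI)
  obtain e where e: "orthonormal e k" "cspan (e ` {..<k}) = M" using has_cdim_orthonormal_basis[OF M] by blast
  define P where "P = oproj e k"
  have S: "compression M G x = P (G x)" for x
    unfolding compression_def P_def e(2)[symmetric] orth_proj_cspan[OF e(1)] ..
  note bP = bounded_clinear_oproj[of e k, folded P_def]
  have PM: "P x \<in> M" for x using oproj_in_cspan[of e k x] e by (simp add: P_def)
  have Pid: "P x = x" if "x \<in> M" for x using oproj_cspan[OF e(1)] that e by (simp add: P_def)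
  have Pdiff: "cinner (x - P x) z = 0" if "z \<in> M" for x z
    using diff_oproj_cortho[OF e(1), of x] that e by (simp add: P_def cortho_def)
  note sM = has_cdim_csubspace[OF M]
  obtain K where K: "0 < K" "\<And>x. norm (G x) \<le> K * norm x" using bcl_pos_bound[OF G(1)] by blast
  show "complex_of_real t \<in> spectrum_on M (compression M G)"
    unfolding spectrum_on_def
  proof (intro CollectI notI, elim exE conjE)
    fix R assume R: "bounded_clinear R" "\<forall>x\<in>M. R x \<in> M \<and>
      R (compression M G x - complex_of_real t *\<^sub>C x) = x \<and>
      compression M G (R x) - complex_of_real t *\<^sub>C R x = x"
    obtain \<beta> where \<beta>: "0 < \<beta>" "\<And>x. norm (R x) \<le> \<beta> * norm x" using bcl_pos_bound[OF R(1)] by blast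
    define \<kappa> where "\<kappa> = K + \<bar>t\<bar>"
    have "0 < \<kappa>" using K by (simp add: \<kappa>_def)
    \<comment> \<open>Small enough that a bound \<open>\<beta>\<close> for the inverse would give
      \<open>(norm y)^2 \<le> (norm y)^2 / 2\<close>.\<close>
    define \<epsilon> where "\<epsilon> = 1 / (2 * \<kappa> * \<beta>\<^sup>2)"
    have "0 < \<epsilon>" using \<open>0 < \<kappa>\<close> \<beta> by (simp add: \<epsilon>_def)
    then obtain x where x: "x \<in> M" "x \<noteq> 0" "Re (cinner (G x) x) \<le> (t + \<epsilon>) * (norm x)\<^sup>2"
      using approx by blast
    define y where "y = P (G x) - t *\<^sub>R x"
    have yM: "y \<in> M" unfolding y_def using PM x by (intro complex_vector.subspace_diff sM csubspace_scaleR)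
    have "R y = x" using R(2) x(1) by (simp add: y_def S scaleR_scaleC)
    then have xy: "norm x \<le> \<beta> * norm y" using \<beta>(2)[of y] by simp
    have "cinner (G x - t *\<^sub>R x) y = cinner (G x - P (G x)) y + cinner y y"
      by (simp add: y_def cinner_diff_left)
    also have "\<dots> = cinner y y" using Pdiff[OF yM] by simp
    finally have "(norm y)\<^sup>2 \<le> \<epsilon> * \<kappa> * (norm x)\<^sup>2"
      unfolding \<kappa>_def by (intro form_almost_minimiser[OF G sM low K(2) x(1) yM _ x(3)])
    also have "\<dots> \<le> \<epsilon> * \<kappa> * (\<beta> * norm y)\<^sup>2"
      using \<open>0 < \<epsilon>\<close> \<open>0 < \<kappa>\<close> xy by (intro mult_left_mono power_mono) auto
    also have "\<dots> = (norm y)\<^sup>2 / 2" using \<open>0 < \<kappa>\<close> \<beta> by (simp add: \<epsilon>_def power_mult_distrib)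
    finally have "y = 0" by simp
    then show False using xy x by simp
  qed
  fix r assume "r < t"
  \<comment> \<open>The identity is put on the complement of \<open>M\<close>:
    \<open>spectrum_on\<close> asks for an inverse bounded on the whole space, and the extended
    operator is coercive there.\<close>
  define B where "B x = P (G (P x)) - r *\<^sub>R P x + (x - P x)" for x
  have bB: "bounded_clinear B"
    unfolding B_def
    by (intro bounded_clinear_intros bP bounded_clinear_comp[OF bP bounded_clinear_comp[OF G(1) bP]])
  define \<delta> where "\<delta> = min (t - r) 1"
  have "0 < \<delta>" using \<open>r < t\<close> by (simp add: \<delta>_def)
  have hP: "cinner (P x) y = cinner x (P y)" for x y
    using hermitianD[OF hermitian_oproj] by (simp add: P_def)
  have pyth: "(norm x)\<^sup>2 = (norm (P x))\<^sup>2 + (norm (x - P x))\<^sup>2" for x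
    using norm_add_sq[of "x - P x" "P x"] Pdiff[OF PM, of x x] by simp
  have "\<delta> * (norm x)\<^sup>2 \<le> Re (cinner (B x) x)" for x
  proof -
    have "Re (cinner (P (G (P x)) - r *\<^sub>R P x) x) = Re (cinner (G (P x)) (P x)) - r * (norm (P x))\<^sup>2"
    proof -
      have "cinner (P x) x = cinner (P x) (P x)" using hP[of "P x" x] Pid[OF PM, of x] by simp
      then show ?thesis
        by (simp only: cinner_diff_left cinner_scaleR_left hP[of "G (P x)" x] norm_sq_cinner) simp
    qed
    also have "\<dots> \<ge> (t - r) * (norm (P x))\<^sup>2" using low[OF PM, of x] by (simp add: algebra_simps)
    moreover have "Re (cinner (x - P x) x) = (norm (x - P x))\<^sup>2"
    proof -
      have "cinner (x - P x) x = cinner (x - P x) (x - P x) + cinner (x - P x) (P x)"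
        by (simp flip: cinner_add_right)
      then show ?thesis using Pdiff[OF PM, of x x] by (simp add: norm_sq_cinner)
    qed
    moreover have "\<delta> * (norm (P x))\<^sup>2 \<le> (t - r) * (norm (P x))\<^sup>2" "\<delta> * (norm (x - P x))\<^sup>2 \<le> 1 * (norm (x - P x))\<^sup>2"
      by (intro mult_right_mono; simp add: \<delta>_def)+
    ultimately show ?thesis unfolding pyth[of x] B_def cinner_add_left[of _ "x - P x"] plus_complex.sel(1)
      by (simp only: distrib_left)
  qed
  then obtain R where R: "bounded_clinear R" "\<forall>x. R (B x) = x" "\<forall>x. B (R x) = x"
    using Lax_Milgram[OF bB \<open>0 < \<delta>\<close>] by blast
  have BM: "B x = P (G x) - r *\<^sub>R x" if "x \<in> M" for x using Pid[OF that] by (simp add: B_def)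
  \<comment> \<open>Applying \<open>P\<close> to \<open>B (R x) = x\<close> cancels the part of
    \<open>R x\<close> off \<open>M\<close>.\<close>
  have RM: "R x \<in> M" if "x \<in> M" for x
  proof -
    have "P (B (R x)) = P (G (P (R x))) - r *\<^sub>R P (R x)"
      unfolding B_def by (simp add: bcl_simps[OF bP] Pid[OF PM])
    moreover have "B (R x) = P (G (P (R x))) - r *\<^sub>R P (R x) + (R x - P (R x))" by (simp add: B_def)
    ultimately have "R x = P (R x)" using R(3)[rule_format, of x] Pid[OF that] by simp
    then show ?thesis using PM[of "R x"] by simp
  qed
  have "\<forall>x\<in>M. R x \<in> M \<and> R (compression M G x - complex_of_real r *\<^sub>C x) = x \<and>
      compression M G (R x) - complex_of_real r *\<^sub>C R x = x"
  proof (intro ballI conjI)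
    fix x assume x: "x \<in> M"
    show "R x \<in> M" by (rule RM[OF x])
    show "R (compression M G x - complex_of_real r *\<^sub>C x) = x"
      unfolding S scaleR_scaleC[symmetric] BM[OF x, symmetric] by (rule R(2)[rule_format])
    show "compression M G (R x) - complex_of_real r *\<^sub>C R x = x"
      unfolding S scaleR_scaleC[symmetric] BM[OF RM[OF x], symmetric] by (rule R(3)[rule_format])
  qed
  then show "complex_of_real r \<notin> spectrum_on M (compression M G)"
    unfolding spectrum_on_def using R(1) by blast
qed

text \<open>\<open>0 < k\<close> excludes the zero space, where the spectrum is empty and its
  minimum unspecified.\<close>

lemma
  fixes G :: "'a::chilbert_space \<Rightarrow> 'a"
  assumes G: "bounded_clinear G" "hermitian G" and M: "has_cdim M k" "0 < k"
  shows real_min_compression_le: "x \<in> M \<Longrightarrow>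
      real_min (spectrum_on M (compression M G)) * (norm x)\<^sup>2 \<le> Re (cinner (G x) x)"
    and le_real_min_compression: "(\<And>x. x \<in> M \<Longrightarrow> c * (norm x)\<^sup>2 \<le> Re (cinner (G x) x)) \<Longrightarrow>
      c \<le> real_min (spectrum_on M (compression M G))"
proof -
  have "card ({} :: 'a set) < k" using M(2) by simp
  from has_cdim_orthogonal[OF M(1) finite.emptyI this] obtain x0 where x0: "x0 \<in> M" "x0 \<noteq> 0" by metis
  obtain t where t: "\<forall>x\<in>M. t * (norm x)\<^sup>2 \<le> Re (cinner (G x) x)"
    "\<forall>\<epsilon>>0. \<exists>x\<in>M. x \<noteq> 0 \<and> Re (cinner (G x) x) \<le> (t + \<epsilon>) * (norm x)\<^sup>2"
    using form_infimum_exists[OF G(1) has_cdim_csubspace[OF M(1)] x0] by blast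
  have eq: "real_min (spectrum_on M (compression M G)) = t"
    by (rule real_min_spectrum_compression[OF G M(1)]) (use t in auto)
  show "real_min (spectrum_on M (compression M G)) * (norm x)\<^sup>2 \<le> Re (cinner (G x) x)" if "x \<in> M"
    unfolding eq using t(1) that by simp
  show "c \<le> real_min (spectrum_on M (compression M G))"
    if c: "\<And>x. x \<in> M \<Longrightarrow> c * (norm x)\<^sup>2 \<le> Re (cinner (G x) x)"
    unfolding eq
  proof (rule field_le_epsilon)
    fix \<epsilon> :: real assume "0 < \<epsilon>"
    then obtain x where x: "x \<in> M" "x \<noteq> 0" "Re (cinner (G x) x) \<le> (t + \<epsilon>) * (norm x)\<^sup>2" using t(2) by blast
    then have "c * (norm x)\<^sup>2 \<le> (t + \<epsilon>) * (norm x)\<^sup>2" using c[OF x(1)] by linarith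
    then show "c \<le> t + \<epsilon>" using x(2) by simp
  qed
qed

section \<open>The bottom of the essential spectrum\<close>

lemma csubspace_image:
  assumes "bounded_clinear D" "csubspace M"
  shows "csubspace (D ` M)"
  unfolding complex_vector.subspace_def
proof (intro conjI ballI allI)
  show "0 \<in> D ` M"
    by (rule image_eqI[where x = 0]) (simp_all add: bcl_zero[OF assms(1)] complex_vector.subspace_0[OF assms(2)])
qed (auto simp: complex_vector.subspace_add[OF assms(2)] complex_vector.subspace_scale[OF assms(2)]
    simp flip: bcl_add[OF assms(1)] bcl_scaleC[OF assms(1)])

lemma csubspace_range: "bounded_clinear D \<Longrightarrow> csubspace (range D)"
  by (rule csubspace_image[OF _ complex_vector.subspace_UNIV])

lemma csubspace_kernel:
  assumes "bounded_clinear D"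
  shows "csubspace {x. D x = 0}"
  unfolding complex_vector.subspace_def by (simp add: bcl_simps[OF assms])

lemma closed_image_if_bounded_below:
  fixes D :: "'a::chilbert_space \<Rightarrow> 'a"
  assumes D: "bounded_clinear D" and M: "csubspace M" "closed M"
    and "0 < \<delta>" and low: "\<And>x. x \<in> M \<Longrightarrow> \<delta> * norm x \<le> norm (D x)"
  shows "closed (D ` M)"
proof (rule closed_sequential_limits[THEN iffD2], intro allI impI, elim conjE)
  fix y l assume y: "\<forall>n. y n \<in> D ` M" "y \<longlonglongrightarrow> l"
  have "\<exists>x. x \<in> M \<and> D x = y n" for n using y(1)[rule_format, of n] by auto
  then obtain x where x: "\<And>n. x n \<in> M" "\<And>n. D (x n) = y n" by metis
  have "Cauchy x"
  proof (rule metric_CauchyI)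
    fix e :: real assume "0 < e"
    then have "0 < \<delta> * e" using \<open>0 < \<delta>\<close> by simp
    then obtain N where N: "\<And>m n. m \<ge> N \<Longrightarrow> n \<ge> N \<Longrightarrow> dist (y m) (y n) < \<delta> * e"
      using LIMSEQ_imp_Cauchy[OF y(2)] metric_CauchyD by blast
    have "dist (x m) (x n) < e" if "m \<ge> N" "n \<ge> N" for m n
    proof -
      have "\<delta> * norm (x m - x n) \<le> norm (D (x m - x n))"
        by (intro low complex_vector.subspace_diff M x)
      also have "\<dots> < \<delta> * e" using N[OF that] by (simp add: bcl_diff[OF D] x dist_norm)
      finally show ?thesis using \<open>0 < \<delta>\<close> by (simp add: dist_norm)
    qed
    then show "\<exists>N. \<forall>m\<ge>N. \<forall>n\<ge>N. dist (x m) (x n) < e" by blast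
  qed
  then obtain p where p: "x \<longlonglongrightarrow> p" using Cauchy_convergent_iff convergent_def by blast
  have "p \<in> M" using closed_sequentially[OF M(2) _ p] x by blast
  moreover have "(\<lambda>n. D (x n)) \<longlonglongrightarrow> D p" by (rule bcl_tendsto[OF D p])
  then have "D p = l" using y(2) LIMSEQ_unique by (simp add: x)
  ultimately show "l \<in> D ` M" by blast
qed

text \<open>The kernel meets \<open>cortho L\<close> only in 0. The range is the closed image of
  \<open>cortho L\<close> enlarged by finitely many vectors, and by symmetry its orthogonal
  complement is the kernel.\<close>

lemma fredholm_if_bounded_below:
  fixes D :: "'a::chilbert_space \<Rightarrow> 'a"
  assumes D: "bounded_clinear D" "hermitian D" and L: "finite L" and "0 < \<delta>"
    and low: "\<And>x. x \<in> cortho L \<Longrightarrow> \<delta> * norm x \<le> norm (D x)"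
  shows "fredholm D"
proof -
  let ?N = "{x. D x = 0}"
  obtain k where k: "has_cdim ?N k"
  proof (rule has_cdim_if_cortho_trivial[OF csubspace_kernel[OF D(1)] L])
    show "x = 0" if "x \<in> ?N" "x \<in> cortho L" for x
      using low[OF that(2)] that(1) \<open>0 < \<delta>\<close> by (auto simp: mult_le_0_iff)
  qed
  define W where "W = D ` cortho L"
  have "closed W"
    unfolding W_def
    by (rule closed_image_if_bounded_below[OF D(1) csubspace_cortho closed_cortho \<open>0 < \<delta>\<close> low])
  have "csubspace W"
    unfolding W_def by (rule csubspace_image[OF D(1) csubspace_cortho])
  have "range D = cspan (D ` L \<union> W)"
  proof (rule subset_antisym)
    have "D ` L \<union> W \<subseteq> range D" by (auto simp: W_def)
    then show "cspan (D ` L \<union> W) \<subseteq> range D"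
      by (intro complex_vector.span_minimal csubspace_range D)
    show "range D \<subseteq> cspan (D ` L \<union> W)"
    proof
      fix y assume "y \<in> range D"
      then obtain x where x: "y = D x" by blast
      obtain p where p: "p \<in> cspan L" "\<forall>z\<in>cspan L. cinner (x - p) z = 0"
        using projection_exists[OF complex_vector.subspace_span closed_cspan_finite[OF L]] by metis
      have "D p \<in> cspan (D ` L)"
        by (rule clinear_image_cspan[OF bcl_add[OF D(1)] bcl_scaleC[OF D(1)] p(1)])
      also have "\<dots> \<subseteq> cspan (D ` L \<union> W)" by (rule complex_vector.span_mono) simp
      finally have "D p \<in> cspan (D ` L \<union> W)" .
      moreover have "x - p \<in> cortho (cspan L)" using p(2) by (simp add: cortho_def)
      then have "D (x - p) \<in> cspan (D ` L \<union> W)"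
        unfolding cortho_cspan by (intro complex_vector.span_base) (simp add: W_def)
      ultimately have "D p + D (x - p) \<in> cspan (D ` L \<union> W)" by (rule complex_vector.span_add)
      then show "y \<in> cspan (D ` L \<union> W)" by (simp add: x flip: bcl_add[OF D(1)])
    qed
  qed
  then have cl: "closed (range D)"
    using closed_cspan_Un_finite[OF \<open>csubspace W\<close> \<open>closed W\<close>, of "D ` L"] L by simp
  obtain B where B: "finite B" "cspan B = ?N" using k unfolding has_cdim_def by blast
  have "\<exists>x. y - D x \<in> cspan B" for y
  proof -
    obtain p where p: "p \<in> range D" "\<forall>z\<in>range D. cinner (y - p) z = 0"
      using projection_exists[OF csubspace_range[OF D(1)] cl] by metis
    have "cinner (D (y - p)) z = 0" for z using p(2) hermitianD[OF D(2)] by simp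
    then have "D (y - p) = 0" using cinner_eq_zero_iff by blast
    then show ?thesis using p(1) B(2) by auto
  qed
  then show ?thesis
    unfolding fredholm_def finite_cdim_def using D(1) k cl B(1) by blast
qed

lemma normalise_in_cortho:
  assumes "x \<in> cortho L" "x \<noteq> 0" and T: "bounded_clinear T" and "norm (T x) < \<mu> * norm x"
  shows "\<exists>x. x \<in> cortho L \<and> norm x = 1 \<and> norm (T x) < \<mu>"
proof (intro exI[of _ "(1 / norm x) *\<^sub>R x"] conjI)
  show "(1 / norm x) *\<^sub>R x \<in> cortho L" using assms(1) by (rule csubspace_scaleR[OF csubspace_cortho])
  show "norm (T ((1 / norm x) *\<^sub>R x)) < \<mu>" using assms by (simp add: bcl_scaleR[OF T] divide_less_eq mult.commute)
qed (simp add: assms(2))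

text \<open>For \<open>\<mu>\<close> slightly below \<open>m\<close> the form of \<open>G\<^sup>2 - \<mu>\<^sup>2\<close> is positive on \<open>cortho L1\<close> for a finite \<open>L1\<close>.
  Choosing \<open>x\<close> orthogonal to \<open>L1\<close> and \<open>G\<^sup>2 L1\<close> keeps \<open>(G\<^sup>2 - \<mu>\<^sup>2) x\<close> in that subspace, where
  Cauchy--Schwarz applies.\<close>

lemma almost_eigenvector_exists:
  fixes G :: "'a::chilbert_space \<Rightarrow> 'a"
  assumes G: "positive_op G" and "0 \<le> m"
    and low: "\<And>\<mu>. 0 \<le> \<mu> \<Longrightarrow> \<mu> < m \<Longrightarrow> \<exists>L. finite L \<and> (\<forall>x\<in>cortho L. \<mu> * norm x \<le> norm (G x))"
    and up: "\<And>\<mu> L. m < \<mu> \<Longrightarrow> finite L \<Longrightarrow> \<exists>x. x \<in> cortho L \<and> norm x = 1 \<and> norm (G x) < \<mu>"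
    and "0 < \<eta>" "finite L"
  shows "\<exists>x. x \<in> cortho L \<and> norm x = 1 \<and> norm (G x - m *\<^sub>R x) \<le> \<eta>"
\<comment> \<open>The main argument needs room below \<open>m\<close>; at \<open>m = 0\<close> a
  small image is itself a small residual.\<close>
proof (cases "m = 0")
  case True
  then have "m < \<eta>" using \<open>0 < \<eta>\<close> by simp
  from up[OF this \<open>finite L\<close>] obtain x where "x \<in> cortho L" "norm x = 1" "norm (G x) < \<eta>" by blast
  then show ?thesis using True by (intro exI[of _ x]) simp
next
  case False
  then have "0 < m" using \<open>0 \<le> m\<close> by simp
  note B = positive_op_bcl[OF G] and H = positive_op_hermitian[OF G]
  obtain K where K: "0 < K" "\<And>x. norm (G x) \<le> K * norm x" using bcl_pos_bound[OF B] by blast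
  \<comment> \<open>Three demands on \<open>\<delta>\<close>: \<open>\<mu> = m - \<delta>\<close> is
    at least \<open>m / 2\<close>, replacing \<open>\<mu>\<close> by \<open>m\<close> at the end
    costs at most \<open>\<eta> / 2\<close>, and the residual \<open>y\<close> below has norm at
    most \<open>\<eta> * m / 4\<close>.\<close>
  have "0 < m / 2" "0 < \<eta> / 2" "0 < (\<eta> * m / (16 * K))\<^sup>2 / m" using \<open>0 < m\<close> \<open>0 < \<eta>\<close> K(1) by auto
  then have "\<exists>\<delta>>0. \<delta> \<le> m / 2 \<and> \<delta> \<le> \<eta> / 2 \<and> \<delta> \<le> (\<eta> * m / (16 * K))\<^sup>2 / m"
    by (intro exI[of _ "min (m / 2) (min (\<eta> / 2) ((\<eta> * m / (16 * K))\<^sup>2 / m))"])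
      (simp only: min_less_iff_conj min.cobounded1 min.coboundedI2 min.cobounded2 simp_thms)
  then obtain \<delta> where \<delta>: "0 < \<delta>" "\<delta> \<le> m / 2" "\<delta> \<le> \<eta> / 2" "\<delta> \<le> (\<eta> * m / (16 * K))\<^sup>2 / m"
    by blast
  define \<mu> where "\<mu> = m - \<delta>"
  have \<mu>: "0 \<le> \<mu>" "\<mu> < m" "m / 2 \<le> \<mu>" using \<delta> \<open>0 < m\<close> by (auto simp: \<mu>_def)
  obtain L1 where L1: "finite L1" "\<forall>x\<in>cortho L1. \<mu> * norm x \<le> norm (G x)" using low[OF \<mu>(1,2)] by blast
  have fin: "finite (L \<union> L1 \<union> (\<lambda>x. G (G x)) ` L1)" using \<open>finite L\<close> L1(1) by simp
  have "m < m + \<delta>" using \<delta> by simp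
  from up[OF this fin] obtain x where x: "x \<in> cortho (L \<union> L1 \<union> (\<lambda>x. G (G x)) ` L1)" "norm x = 1" "norm (G x) < m + \<delta>"
    by blast
  have xL: "x \<in> cortho L" "x \<in> cortho L1" "\<And>l. l \<in> L1 \<Longrightarrow> cinner x (G (G l)) = 0"
    using x(1) by (auto simp: cortho_def)
  define y where "y = G (G x) - (\<mu>\<^sup>2) *\<^sub>R x"
  have "cinner y l = 0" if "l \<in> L1" for l
    using xL(2) xL(3)[OF that] that by (simp add: y_def cinner_simps hermitianD[OF H] cortho_def)
  then have yL: "y \<in> cortho L1" by (simp add: cortho_def)
  have GG: "bounded_clinear (\<lambda>x. G (G x))" by (rule bounded_clinear_comp[OF B B])
  have hGG: "hermitian (\<lambda>x. G (G x))" using hermitianD[OF H] by (simp add: hermitian_def)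
  have Re_GG: "Re (cinner (G (G z)) z) = (norm (G z))\<^sup>2" for z
    by (simp add: hermitianD[OF H, of "G z" z] norm_sq_cinner)
  have lowGG: "\<mu>\<^sup>2 * (norm z)\<^sup>2 \<le> Re (cinner (G (G z)) z)" if "z \<in> cortho L1" for z
    using L1(2) that \<mu>(1) unfolding Re_GG power_mult_distrib[symmetric] by (intro power_mono) auto
  have bGG: "norm (G (G z)) \<le> K\<^sup>2 * norm z" for z
  proof -
    have "norm (G (G z)) \<le> K * norm (G z)" by (rule K(2))
    also have "\<dots> \<le> K * (K * norm z)" using K by (intro mult_left_mono) auto
    finally show ?thesis by (simp add: power2_eq_square)
  qed
  have \<mu>K: "\<mu> \<le> K"
  proof -
    have "\<mu> * norm x \<le> norm (G x)" using L1(2) xL(2) by blast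
    then show ?thesis using K(2)[of x] x(2) by simp
  qed
  have "(norm (G x))\<^sup>2 \<le> (m + \<delta>)\<^sup>2" using x(3) by (intro power_mono) auto
  also have "\<dots> = \<mu>\<^sup>2 + 4 * m * \<delta>" by (simp add: \<mu>_def power2_eq_square algebra_simps)
  finally have \<epsilon>: "Re (cinner (G (G x)) x) \<le> (\<mu>\<^sup>2 + 4 * m * \<delta>) * (norm x)\<^sup>2"
    unfolding Re_GG x(2) by simp
  have "(norm y)\<^sup>2 \<le> 4 * m * \<delta> * (K\<^sup>2 + \<bar>\<mu>\<^sup>2\<bar>) * (norm x)\<^sup>2"
    by (rule form_almost_minimiser[OF GG hGG csubspace_cortho lowGG bGG xL(2) yL _ \<epsilon>])
      (simp_all add: y_def)
  also have "\<dots> \<le> 4 * m * \<delta> * (4 * K\<^sup>2)"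
  proof -
    have "\<mu>\<^sup>2 \<le> K\<^sup>2" using \<mu>K \<mu>(1) by (rule power_mono)
    moreover have "\<bar>\<mu>\<^sup>2\<bar> = \<mu>\<^sup>2" "0 \<le> K\<^sup>2" by simp_all
    ultimately have "K\<^sup>2 + \<bar>\<mu>\<^sup>2\<bar> \<le> 4 * K\<^sup>2" by linarith
    then have "4 * m * \<delta> * (K\<^sup>2 + \<bar>\<mu>\<^sup>2\<bar>) \<le> 4 * m * \<delta> * (4 * K\<^sup>2)"
      by (rule mult_left_mono) (use \<open>0 < m\<close> \<delta>(1) in simp)
    then show ?thesis unfolding x(2) by simp
  qed
  also have "\<dots> = 16 * K\<^sup>2 * m * \<delta>" by simp
  also have "\<dots> \<le> 16 * K\<^sup>2 * m * ((\<eta> * m / (16 * K))\<^sup>2 / m)"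
    using \<delta>(4) \<open>0 < m\<close> by (intro mult_left_mono) auto
  also have "\<dots> = (4 * K * (\<eta> * m / (16 * K)))\<^sup>2"
  proof -
    have "16 * K\<^sup>2 * m * (c\<^sup>2 / m) = (4 * K * c)\<^sup>2" for c using \<open>0 < m\<close> by (simp add: power_mult_distrib)
    then show ?thesis .
  qed
  also have "4 * K * (\<eta> * m / (16 * K)) = \<eta> * m / 4" using K(1) by simp
  finally have "(norm y)\<^sup>2 \<le> (\<eta> * m / 4)\<^sup>2" .
  then have ny: "norm y \<le> \<eta> * m / 4" by (rule power2_le_imp_le) (use \<open>0 < \<eta>\<close> \<open>0 < m\<close> in simp)
  \<comment> \<open>\<open>G^2 - \<mu>^2\<close> factors as \<open>(G + \<mu>) (G - \<mu>)\<close>,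
    and positivity bounds \<open>G + \<mu>\<close> below by \<open>\<mu>\<close>; so a small
    \<open>y\<close> forces a small \<open>w\<close>.\<close>
  define w where "w = G x - \<mu> *\<^sub>R x"
  have y_w: "y = G w + \<mu> *\<^sub>R w"
    by (simp add: y_def w_def bcl_simps[OF B] power2_eq_square scaleR_right_diff_distrib)
  have "\<mu> * norm w \<le> norm y"
  proof (cases "w = 0")
    case False
    have "\<mu> * (norm w)\<^sup>2 \<le> Re (cinner y w)"
      using positive_op_nonneg[OF G, of w] by (simp add: y_w cinner_simps norm_sq_cinner)
    also have "\<dots> \<le> norm y * norm w" using Re_cinner_le abs_le_iff by blast
    finally show ?thesis using False by (simp add: power2_eq_square)
  qed simp
  moreover have "m / 2 * norm w \<le> \<mu> * norm w" using \<mu>(3) by (intro mult_right_mono) auto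
  ultimately have "m / 2 * norm w \<le> \<eta> * m / 4" using ny by linarith
  also have "\<dots> = m / 2 * (\<eta> / 2)" by simp
  finally have nw: "norm w \<le> \<eta> / 2" using \<open>0 < m\<close> by simp
  have "G x - m *\<^sub>R x = w - \<delta> *\<^sub>R x" by (simp add: w_def \<mu>_def scaleR_left_diff_distrib)
  then have "norm (G x - m *\<^sub>R x) \<le> norm w + norm (\<delta> *\<^sub>R x)" by (simp only: norm_triangle_ineq4)
  also have "\<dots> \<le> \<eta>" using nw \<delta>(1,3) x(2) by simp
  finally show ?thesis using xL(1) x(2) by blast
qed

text \<open>If \<open>D\<close> were Fredholm, its range would be the orthogonal complement of its kernel and would
  contain \<open>y = (\<Sum>k. 2\<^sup>-\<^sup>k x k)\<close> for orthonormal \<open>x k\<close> in it with \<open>norm (D (x k)) \<le> 4\<^sup>-\<^sup>k\<close>.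
  But \<open>y = D z\<close> gives \<open>2\<^sup>-\<^sup>k = cinner z (D (x k)) \<le> 4\<^sup>-\<^sup>k * norm z\<close>.\<close>

lemma not_fredholm_if_almost_kernel:
  fixes D :: "'a::chilbert_space \<Rightarrow> 'a"
  assumes D: "bounded_clinear D" "hermitian D"
    and small: "\<And>\<eta> L. 0 < \<eta> \<Longrightarrow> finite L \<Longrightarrow> \<exists>x. x \<in> cortho L \<and> norm x = 1 \<and> norm (D x) \<le> \<eta>"
  shows "\<not> fredholm D"
proof
  assume fr: "fredholm D"
  then obtain B where B: "finite B" "cspan B = {x. D x = 0}"
    unfolding fredholm_def finite_cdim_def has_cdim_def by blast
  have cl: "closed (range D)" using fr by (simp add: fredholm_def)
  define P where "P k x \<longleftrightarrow> norm x = 1 \<and> norm (D x) \<le> (1/4) ^ k \<and> x \<in> cortho B" for k :: nat and x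
  have ex: "\<exists>x. x \<in> cortho L \<and> P k x" if L: "finite L" for k and L :: "'a set"
  proof -
    obtain x where "x \<in> cortho (L \<union> B)" "norm x = 1" "norm (D x) \<le> (1/4) ^ k"
      using small[of "(1/4) ^ k" "L \<union> B"] L B(1) by auto
    then show ?thesis by (intro exI[of _ x]) (auto simp: P_def cortho_def)
  qed
  have "\<exists>x. (\<forall>k. P k (x k)) \<and> (\<forall>j k. j < k \<longrightarrow> cinner (x k) (x j) = 0 \<and> cinner (x k) (x j) = 0)"
    by (rule orthogonal_sequence[where H = "\<lambda>x. x"]) (rule ex)
  then obtain x where P: "\<And>k. P k (x k)" and orth: "\<And>j k. j < k \<Longrightarrow> cinner (x k) (x j) = 0"
    by blast
  have x: "norm (x k) = 1" "norm (D (x k)) \<le> (1/4) ^ k" "x k \<in> cortho B" for k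
    using P[of k] by (auto simp: P_def)
  have orth': "cinner (x k) (x j) = 0" if "k \<noteq> j" for j k
    using orth[of j k] orth[of k j] that cinner_zero_commute by (metis linorder_neqE_nat)
  define s where "s k = (1/2) ^ k *\<^sub>R x k" for k
  have "summable (\<lambda>k. norm (s k))" by (simp add: s_def x(1))
  then have "summable s" by (rule summable_norm_cancel)
  define y where "y = suminf s"
  have sums: "s sums y" unfolding y_def using \<open>summable s\<close> by (rule summable_sums)
  have inner_sums: "(\<lambda>k. cinner (s k) z) sums cinner y z" for z
    by (rule bounded_linear.sums[OF bounded_linear_cinner_left sums])
  have y_orth: "cinner y z = 0" if "D z = 0" for z
  proof -
    have "z \<in> cspan B" using B that by simp
    then have "cinner (x k) z = 0" for k using x(3)[of k] unfolding cortho_cspan[of B, symmetric] by (rule corthoD[rotated])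
    then have "(\<lambda>k. cinner (s k) z) = (\<lambda>_. 0)" by (simp add: s_def cinner_simps)
    then show ?thesis using inner_sums[of z] by (simp add: sums_iff)
  qed
  have y_x: "cinner y (x j) = (1/2) ^ j" for j
  proof -
    have "(\<lambda>k. cinner (s k) (x j)) = (\<lambda>k. if k = j then (1/2) ^ j else 0)"
    proof
      fix k
      have "cinner (x j) (x j) = 1" by (simp add: cinner_self_norm x(1))
      then show "cinner (s k) (x j) = (if k = j then (1/2) ^ j else 0)"
        using orth'[of k j] by (simp add: s_def cinner_simps)
    qed
    then have "(\<lambda>k. cinner (s k) (x j)) sums (1/2) ^ j" using sums_single[of j "\<lambda>_. (1/2) ^ j"] by simp
    then show ?thesis using inner_sums sums_unique2 by blast
  qed
  have "y \<in> range D"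
  proof (rule cortho_cortho_subset[OF csubspace_range[OF D(1)] cl])
    fix z assume "z \<in> cortho (range D)"
    then have "cinner (D z) u = 0" for u using hermitianD[OF D(2), of z u] by (simp add: cortho_def)
    then have "D z = 0" using cinner_eq_zero_iff by blast
    then show "cinner y z = 0" by (rule y_orth)
  qed
  then obtain z where z: "y = D z" by blast
  have "2 ^ j \<le> norm z" for j :: nat
  proof -
    have "(1/2) ^ j = Re (cinner z (D (x j)))"
      using y_x[of j] unfolding z hermitianD[OF D(2)]
      by (metis Re_complex_of_real of_real_1 of_real_divide of_real_numeral of_real_power)
    also have "\<dots> \<le> norm z * norm (D (x j))" using Re_cinner_le abs_le_iff by blast
    also have "\<dots> \<le> norm z * (1/4) ^ j" by (intro mult_left_mono x) auto
    finally have "(1/2) ^ j * 4 ^ j \<le> norm z * (1/4) ^ j * 4 ^ j" by (rule mult_right_mono) simp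
    then show ?thesis by (simp add: mult.assoc flip: power_mult_distrib)
  qed
  moreover obtain j where "norm z < 2 ^ j" using real_arch_pow[of 2 "norm z"] by auto
  ultimately show False by (meson not_less)
qed

text \<open>By \<open>low\<close> and \<open>up\<close>, \<open>m\<close> is the best lower bound of
  \<open>G\<close> modulo finite-dimensional subspaces. Together they give almost eigenvectors at
  \<open>m\<close> off any finite set, so \<open>G - m\<close> is not Fredholm; for
  \<open>r < m\<close> the operator \<open>G - r\<close> is bounded below off a finite set.\<close>

lemma real_min_ess_spectrum:
  fixes G :: "'a::chilbert_space \<Rightarrow> 'a"
  assumes G: "positive_op G" and "0 \<le> m"
    and low: "\<And>\<mu>. 0 \<le> \<mu> \<Longrightarrow> \<mu> < m \<Longrightarrow> \<exists>L. finite L \<and> (\<forall>x\<in>cortho L. \<mu> * norm x \<le> norm (G x))"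
    and up: "\<And>\<mu> L. m < \<mu> \<Longrightarrow> finite L \<Longrightarrow> \<exists>x. x \<in> cortho L \<and> norm x = 1 \<and> norm (G x) < \<mu>"
  shows "real_min (ess_spectrum G) = m"
proof (rule real_min_eqI)
  note B = positive_op_bcl[OF G] and H = positive_op_hermitian[OF G]
  have D: "bounded_clinear (\<lambda>x. G x - r *\<^sub>R x)" "hermitian (\<lambda>x. G x - r *\<^sub>R x)" for r
    using H by (auto intro!: bounded_clinear_intros B simp: hermitian_def cinner_simps)
  have "\<not> fredholm (\<lambda>x. G x - m *\<^sub>R x)"
    by (rule not_fredholm_if_almost_kernel[OF D]) (rule almost_eigenvector_exists[OF G \<open>0 \<le> m\<close> low up])
  then show "complex_of_real m \<in> ess_spectrum G" by (simp add: ess_spectrum_def scaleR_scaleC)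
  fix r assume "r < m"
  have "fredholm (\<lambda>x. G x - r *\<^sub>R x)"
  proof (cases "0 \<le> r")
    case True
    define \<mu> where "\<mu> = (r + m) / 2"
    have "0 \<le> \<mu>" "\<mu> < m" "0 < \<mu> - r" using True \<open>r < m\<close> by (auto simp: \<mu>_def)
    then obtain L where L: "finite L" "\<forall>x\<in>cortho L. \<mu> * norm x \<le> norm (G x)" using low by blast
    have "(\<mu> - r) * norm x \<le> norm (G x - r *\<^sub>R x)" if "x \<in> cortho L" for x
    proof -
      have "\<mu> * norm x \<le> norm (G x)" using L(2) that by blast
      then show ?thesis using norm_triangle_ineq2[of "G x" "r *\<^sub>R x"] True by (simp add: left_diff_distrib)
    qed
    then show ?thesis by (rule fredholm_if_bounded_below[OF D L(1) \<open>0 < \<mu> - r\<close>])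
  next
    case False
    \<comment> \<open>For \<open>r < 0\<close> positivity alone bounds \<open>G - r\<close> below,
      with no vectors removed.\<close>
    have "- r * norm x \<le> norm (G x - r *\<^sub>R x)" for x
    proof (cases "x = 0")
      case False
      have "- r * (norm x)\<^sup>2 \<le> Re (cinner (G x - r *\<^sub>R x) x)"
        using positive_op_nonneg[OF G, of x] by (simp add: cinner_simps norm_sq_cinner)
      also have "\<dots> \<le> norm (G x - r *\<^sub>R x) * norm x" using Re_cinner_le abs_le_iff by blast
      finally have "(- r * norm x) * norm x \<le> norm (G x - r *\<^sub>R x) * norm x"
        by (simp only: power2_eq_square mult.assoc)
      then show ?thesis by (rule mult_right_le_imp_le) (simp add: False)
    qed simp
    then show ?thesis using False by (intro fredholm_if_bounded_below[OF D, of "{}" "- r"]) auto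
  qed
  then show "complex_of_real r \<notin> ess_spectrum G" by (simp add: ess_spectrum_def scaleR_scaleC)
qed

section \<open>Bessel sequences\<close>

definition unit_ell2 :: "nat \<Rightarrow> ell2" where
  "unit_ell2 i = Abs_ell2 (\<lambda>j. if j = i then 1 else 0)"

lemma coord_unit_ell2: "coord (unit_ell2 i) j = (if j = i then 1 else 0)"
proof -
  have "summable (\<lambda>j. (cmod (if j = i then 1 else 0))\<^sup>2)"
    by (rule summable_finite[of "{i}"]) auto
  then show ?thesis by (simp add: unit_ell2_def coord_Abs)
qed

lemma cinner_unit_ell2: "cinner a (unit_ell2 i) = coord a i"
proof -
  have "(\<lambda>j. coord a j * cnj (coord (unit_ell2 i) j)) = (\<lambda>j. if j = i then coord a i else 0)"
    by (auto simp: coord_unit_ell2)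
  then show ?thesis
    unfolding cinner_ell2_def using sums_single[of i "\<lambda>_. coord a i"] by (simp add: sums_iff)
qed

lemma orthonormal_unit_ell2: "orthonormal unit_ell2 k"
  by (auto simp: orthonormal_def cinner_unit_ell2 coord_unit_ell2)

lemma infinite_cdim_ell2: "\<not> finite_cdim (UNIV :: ell2 set)"
proof
  assume "finite_cdim (UNIV :: ell2 set)"
  then obtain L :: "ell2 set" where L: "finite L" "cspan L = UNIV"
    unfolding finite_cdim_def has_cdim_def by blast
  have "has_cdim (cspan (unit_ell2 ` {..<Suc (card L)})) (Suc (card L))"
    by (rule has_cdim_cspan_orthonormal[OF orthonormal_unit_ell2])
  then obtain x where "x \<noteq> 0" "x \<in> cortho L" by (rule has_cdim_orthogonal[OF _ L(1)]) auto
  moreover have "x \<in> cspan L" using L by simp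
  ultimately have "cinner x x = 0" using cortho_cspan corthoD by blast
  then show False using \<open>x \<noteq> 0\<close> by simp
qed

lemma norm_sum_orthogonal:
  fixes y :: "nat \<Rightarrow> 'a::complex_inner"
  assumes "\<And>i j. i < k \<Longrightarrow> j < k \<Longrightarrow> i \<noteq> j \<Longrightarrow> cinner (y i) (y j) = 0"
  shows "(norm (\<Sum>i<k. y i))\<^sup>2 = (\<Sum>i<k. (norm (y i))\<^sup>2)"
  using assms
proof (induction k)
  case (Suc k)
  have "cinner (\<Sum>i<k. y i) (y k) = 0"
    unfolding cinner_sum_left by (rule sum.neutral) (use Suc.prems in auto)
  then have "(norm ((\<Sum>i<k. y i) + y k))\<^sup>2 = (norm (\<Sum>i<k. y i))\<^sup>2 + (norm (y k))\<^sup>2"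
    by (simp add: norm_add_sq)
  moreover have "(norm (\<Sum>i<k. y i))\<^sup>2 = (\<Sum>i<k. (norm (y i))\<^sup>2)"
    by (rule Suc.IH) (use Suc.prems in auto)
  ultimately show ?case by simp
qed simp

lemma ell2_sums: "(\<lambda>i. coord a i *\<^sub>C unit_ell2 i) sums a"
  unfolding sums_def
proof (rule LIM_zero_cancel, rule tendsto_norm_zero_cancel)
  let ?s = "\<lambda>k. \<Sum>i<k. coord a i *\<^sub>C unit_ell2 i"
  let ?t = "\<lambda>k. \<Sum>i<k. (cmod (coord a i))\<^sup>2"
  have sq: "(norm (?s k - a))\<^sup>2 = (norm a)\<^sup>2 - ?t k" for k
  proof -
    have s: "?s k = oproj unit_ell2 k a" by (simp add: oproj_def cinner_unit_ell2)
    have "cinner (a - ?s k) (?s k) = 0"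
      unfolding s by (rule corthoD[OF diff_oproj_cortho[OF orthonormal_unit_ell2] oproj_in_cspan])
    then have "(norm ((a - ?s k) + ?s k))\<^sup>2 = (norm (a - ?s k))\<^sup>2 + (norm (?s k))\<^sup>2"
      by (simp only: norm_add_sq) simp
    moreover have "(norm (?s k))\<^sup>2 = ?t k" by (rule norm_lincomb_orthonormal[OF orthonormal_unit_ell2])
    ultimately show ?thesis by (simp add: norm_minus_commute)
  qed
  have "?t \<longlonglongrightarrow> (norm a)\<^sup>2"
    unfolding norm_ell2_sq by (rule summable_LIMSEQ[OF summable_coord])
  then have "(\<lambda>k. (norm a)\<^sup>2 - ?t k) \<longlonglongrightarrow> (norm a)\<^sup>2 - (norm a)\<^sup>2" by (intro tendsto_intros)
  then have "(\<lambda>k. (norm (?s k - a))\<^sup>2) \<longlonglongrightarrow> 0" by (simp add: sq)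
  from tendsto_real_sqrt[OF this] show "(\<lambda>k. norm (?s k - a)) \<longlonglongrightarrow> 0" by simp
qed

text \<open>Introduced before \<open>synthesis\<close> is known to be bounded: here boundedness is
  the Bessel inequality itself, and \<open>synthesis\<close> is then recognised as the
  adjoint.\<close>

definition analysis_op :: "(nat \<Rightarrow> 'h::chilbert_space) \<Rightarrow> 'h \<Rightarrow> ell2" where
  "analysis_op f h = Abs_ell2 (\<lambda>i. cinner h (f i))"

text \<open>The upper half of the frame inequality, kept apart because it also covers infinite
  orthonormal systems, which need not be frames.\<close>

definition Bessel :: "(nat \<Rightarrow> 'h::chilbert_space) \<Rightarrow> real \<Rightarrow> bool" where
  "Bessel f B \<longleftrightarrow> 0 \<le> B \<and> (\<forall>x. summable (\<lambda>i. (cmod (cinner x (f i)))\<^sup>2) \<and>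
     (\<Sum>i. (cmod (cinner x (f i)))\<^sup>2) \<le> B * (norm x)\<^sup>2)"

context
  fixes f :: "nat \<Rightarrow> 'h::chilbert_space" and B :: real
  assumes Bessel: "Bessel f B"
begin

lemma coord_analysis_op: "coord (analysis_op f h) i = cinner h (f i)"
  using Bessel by (simp add: analysis_op_def coord_Abs Bessel_def)

lemma norm_analysis_op_sq: "(norm (analysis_op f h))\<^sup>2 = (\<Sum>i. (cmod (cinner h (f i)))\<^sup>2)"
  by (simp add: norm_ell2_sq coord_analysis_op)

lemma bounded_clinear_analysis_op: "bounded_clinear (analysis_op f)"
proof (rule bounded_clinearI)
  show "analysis_op f (x + y) = analysis_op f x + analysis_op f y" for x y
    by (rule ell2_eqI) (simp add: coord_analysis_op coord_add cinner_add_left)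
  show "analysis_op f (c *\<^sub>C x) = c *\<^sub>C analysis_op f x" for c x
    by (rule ell2_eqI) (simp add: coord_analysis_op coord_scaleC cinner_scaleC_left)
  show "norm (analysis_op f x) \<le> norm x * sqrt B" for x
  proof (rule power2_le_imp_le)
    show "(norm (analysis_op f x))\<^sup>2 \<le> (norm x * sqrt B)\<^sup>2"
      using Bessel by (simp add: norm_analysis_op_sq power_mult_distrib Bessel_def mult.commute)
    show "0 \<le> norm x * sqrt B" using Bessel by (simp add: Bessel_def)
  qed
qed

text \<open>The adjoint sends unit vectors to the \<open>f i\<close>, and continuity carries this
  through the expansion of \<open>a\<close>; in particular the synthesis series converges.\<close>

lemma cadjoint_analysis_op_sums: "(\<lambda>i. coord a i *\<^sub>C f i) sums cadjoint (analysis_op f) a"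
proof -
  note b = bounded_clinear_analysis_op and b' = bounded_clinear_cadjoint[OF bounded_clinear_analysis_op]
  have "cadjoint (analysis_op f) (unit_ell2 i) = f i" for i
  proof (rule cinner_eqI')
    show "cinner h (cadjoint (analysis_op f) (unit_ell2 i)) = cinner h (f i)" for h
      by (simp only: cinner_cadjoint[OF b, symmetric] cinner_unit_ell2 coord_analysis_op)
  qed
  then show ?thesis
    using bounded_linear.sums[OF bounded_clinear_bounded_linear[OF b'] ell2_sums[of a]]
    by (simp add: bcl_scaleC[OF b'])
qed

lemma synthesis_eq_cadjoint: "synthesis f = cadjoint (analysis_op f)"
  unfolding synthesis_def using cadjoint_analysis_op_sums by (intro ext) (simp add: sums_iff)

lemma bounded_clinear_synthesis: "bounded_clinear (synthesis f)"
  unfolding synthesis_eq_cadjoint by (rule bounded_clinear_cadjoint[OF bounded_clinear_analysis_op])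

lemma cadjoint_synthesis: "cadjoint (synthesis f) = analysis_op f"
  unfolding synthesis_eq_cadjoint by (rule cadjoint_cadjoint[OF bounded_clinear_analysis_op])

lemma synthesis_sums: "(\<lambda>i. coord a i *\<^sub>C f i) sums synthesis f a"
  unfolding synthesis_eq_cadjoint by (rule cadjoint_analysis_op_sums)

end

lemma Bessel_orthonormal:
  assumes e: "\<And>k. orthonormal e k"
  shows "Bessel e 1"
proof -
  have le: "(\<Sum>i<k. (cmod (cinner x (e i)))\<^sup>2) \<le> (norm x)\<^sup>2" for x k
  proof -
    have "cinner (x - oproj e k x) (oproj e k x) = 0"
      by (rule corthoD[OF diff_oproj_cortho[OF e] oproj_in_cspan])
    then have "(norm ((x - oproj e k x) + oproj e k x))\<^sup>2 = (norm (x - oproj e k x))\<^sup>2 + (norm (oproj e k x))\<^sup>2"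
      by (simp only: norm_add_sq) simp
    then show ?thesis using norm_oproj_sq[OF e, of k x] by simp
  qed
  have "summable (\<lambda>i. (cmod (cinner x (e i)))\<^sup>2)" for x
    by (rule summableI_nonneg_bounded[OF _ le]) simp
  then show ?thesis using le by (auto simp: Bessel_def intro!: suminf_le_const)
qed

text \<open>The difference \<open>P\<close> has vanishing form, so it counts as positive, and a
  positive operator vanishes wherever its form does.\<close>

lemma isometry_cadjoint:
  fixes V :: "'a::chilbert_space \<Rightarrow> 'b::chilbert_space"
  assumes V: "bounded_clinear V" and iso: "\<And>x. norm (V x) = norm x"
  shows "cadjoint V (V x) = x"
proof -
  note V' = bounded_clinear_cadjoint[OF V]
  define P where "P x = cadjoint V (V x) - x" for x
  have bP: "bounded_clinear P"
    unfolding P_def by (intro bounded_clinear_diff bounded_clinear_comp[OF V' V] bounded_clinear_id)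
  have hP: "hermitian P"
    unfolding hermitian_def P_def
    by (simp add: cinner_diff_left cinner_diff_right cinner_cadjoint'[OF V] flip: cinner_cadjoint[OF V])
  have z: "Re (cinner (P x) x) = 0" for x
    by (simp add: P_def cinner_diff_left cinner_cadjoint'[OF V] iso flip: norm_sq_cinner)
  have "positive_op P" by (rule positive_opI[OF bP hP]) (simp add: z)
  then have "P x = 0" using z by (rule positive_op_cinner_0)
  then show ?thesis by (simp add: P_def)
qed

text \<open>For hermitian operators the norm is controlled by the form alone, without loss of a
  factor; the exact constant is needed for the final distance.\<close>

lemma hermitian_norm_le:
  fixes N :: "'a::chilbert_space \<Rightarrow> 'a"
  assumes N: "bounded_clinear N" "hermitian N" and "0 \<le> \<rho>"
    and bd: "\<And>x. \<bar>Re (cinner (N x) x)\<bar> \<le> \<rho> * (norm x)\<^sup>2"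
  shows "norm (N x) \<le> \<rho> * norm x"
proof (rule field_le_epsilon)
  fix \<epsilon> :: real assume "0 < \<epsilon>"
  \<comment> \<open>Slightly above \<open>\<rho>\<close>, hence positive and available for division;
    the excess costs at most \<open>\<epsilon>\<close> at this \<open>x\<close>.\<close>
  define \<sigma> where "\<sigma> = \<rho> + \<epsilon> / (norm x + 1)"
  have pos: "0 < \<epsilon> / (norm x + 1)" using \<open>0 < \<epsilon>\<close> by (simp add: add_nonneg_pos)
  then have "0 < \<sigma>" using \<open>0 \<le> \<rho>\<close> by (simp add: \<sigma>_def)
  have bd': "\<bar>Re (cinner (N y) y)\<bar> \<le> \<sigma> * (norm y)\<^sup>2" for y
    using bd[of y] mult_right_mono[of \<rho> \<sigma> "(norm y)\<^sup>2"] pos by (simp add: \<sigma>_def)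
  define u where "u = \<sigma> *\<^sub>R x + N x"
  define v where "v = \<sigma> *\<^sub>R x - N x"
  \<comment> \<open>The identity \<open>(\<sigma> + N) (\<sigma> - N)^2 + (\<sigma> - N) (\<sigma> +
    N)^2 = 2 \<sigma> (\<sigma>^2 - N^2)\<close> tested at \<open>x\<close>; both terms on the left
    have nonnegative forms.\<close>
  have "Re (cinner (\<sigma> *\<^sub>R v + N v) v) + Re (cinner (\<sigma> *\<^sub>R u - N u) u) = 2 * \<sigma> * (\<sigma>\<^sup>2 * (norm x)\<^sup>2 - (norm (N x))\<^sup>2)"
  proof -
    have "Re (cinner x x) = norm x * norm x" "Re (cinner x (N (N x))) = norm (N x) * norm (N x)"
      using norm_sq_cinner[of x] norm_sq_cinner[of "N x"] hermitianD[OF N(2), of x "N x"]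
      by (simp_all add: power2_eq_square)
    then show ?thesis
      using hermitianD[OF N(2)] Re_cinner_commute[of x "N x"]
      by (simp add: u_def v_def bcl_simps[OF N(1)] cinner_simps power2_eq_square algebra_simps)
  qed
  moreover have "0 \<le> Re (cinner (\<sigma> *\<^sub>R v + N v) v)" "0 \<le> Re (cinner (\<sigma> *\<^sub>R u - N u) u)"
    using bd'[of v] bd'[of u] by (simp_all add: cinner_simps flip: norm_sq_cinner)
  ultimately have "0 \<le> 2 * \<sigma> * (\<sigma>\<^sup>2 * (norm x)\<^sup>2 - (norm (N x))\<^sup>2)" by linarith
  then have "(norm (N x))\<^sup>2 \<le> (\<sigma> * norm x)\<^sup>2"
    using \<open>0 < \<sigma>\<close> by (simp add: zero_le_mult_iff power_mult_distrib)
  then have "norm (N x) \<le> \<sigma> * norm x" by (rule power2_le_imp_le) (use \<open>0 < \<sigma>\<close> in simp)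
  also have "\<dots> \<le> \<rho> * norm x + \<epsilon>"
  proof -
    have "\<epsilon> / (norm x + 1) * norm x \<le> \<epsilon> / (norm x + 1) * (norm x + 1)"
      using pos by (intro mult_left_mono) auto
    also have "\<dots> = \<epsilon>" using norm_ge_zero[of x] by (simp add: add_nonneg_eq_0_iff)
    finally show ?thesis by (simp add: \<sigma>_def distrib_right)
  qed
  finally show "norm (N x) \<le> \<rho> * norm x + \<epsilon>" .
qed

text \<open>Lets a dimension bound be proved by excluding subspaces of dimension
  \<open>n + 1\<close>, with finite dimension not known beforehand.\<close>

lemma has_cdim_dichotomy:
  assumes N: "csubspace N"
  shows "(\<exists>k\<le>n. has_cdim N k) \<or> (\<exists>M\<subseteq>N. has_cdim M (Suc n))"
proof -
  obtain B where B: "B \<subseteq> N" "\<not> cdependent B" "N \<subseteq> cspan B"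
    using complex_vector.maximal_independent_subset by blast
  have span: "cspan B = N" using B by (intro equalityI complex_vector.span_minimal N)
  show ?thesis
  proof (cases "finite B \<and> card B \<le> n")
    case True
    then have "has_cdim N (card B)" using B span unfolding has_cdim_def by blast
    then show ?thesis using True by blast
  next
    case False
    then obtain B' where B': "B' \<subseteq> B" "finite B'" "card B' = Suc n"
      by (metis infinite_arbitrarily_large not_less_eq_eq obtain_subset_with_card_n)
    have "\<not> cdependent B'" using B(2) B'(1) complex_vector.independent_mono by blast
    then have "has_cdim (cspan B') (Suc n)" using B' unfolding has_cdim_def by blast
    moreover have "cspan B' \<subseteq> N" using B' B by (intro complex_vector.span_minimal N) auto
    ultimately show ?thesis by blast
  qed
qed

lemma has_cdim_cspan_finite:
  assumes "finite (L :: 'a::complex_inner set)"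
  shows "\<exists>k. has_cdim (cspan L) k"
proof -
  have "x = 0" if "x \<in> cspan L" "x \<in> cortho L" for x
    using that corthoD[of x "cspan L" x] by (simp add: cortho_cspan)
  then show ?thesis using has_cdim_if_cortho_trivial[OF complex_vector.subspace_span assms] by metis
qed

section \<open>Polar decomposition of the synthesis operator\<close>

lemma positive_op_cadjoint_comp:
  fixes F :: "'a::chilbert_space \<Rightarrow> 'b::chilbert_space"
  assumes F: "bounded_clinear F"
  shows "positive_op (cadjoint F \<circ> F)"
proof (rule positive_opI)
  note F' = bounded_clinear_cadjoint[OF F]
  show "bounded_clinear (cadjoint F \<circ> F)" using bounded_clinear_comp[OF F' F] by (simp add: comp_def)
  show "hermitian (cadjoint F \<circ> F)"
    by (simp add: hermitian_def cinner_cadjoint'[OF F] flip: cinner_cadjoint[OF F])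
  show "0 \<le> Re (cinner ((cadjoint F \<circ> F) x) x)" for x
    by (simp add: cinner_cadjoint'[OF F] flip: norm_sq_cinner)
qed

lemma norm_positive_sqrt:
  fixes P :: "'a::chilbert_space \<Rightarrow> 'a" and B :: "'a \<Rightarrow> 'b::chilbert_space"
  assumes P: "positive_op P" and B: "bounded_clinear B" and eq: "\<And>x. P (P x) = cadjoint B (B x)"
  shows "norm (P x) = norm (B x)"
proof -
  have "(norm (P x))\<^sup>2 = Re (cinner (P (P x)) x)"
    by (simp add: norm_sq_cinner hermitianD[OF positive_op_hermitian[OF P], of "P x" x])
  also have "\<dots> = (norm (B x))\<^sup>2" unfolding eq cinner_cadjoint'[OF B] by (simp only: norm_sq_cinner)
  finally show ?thesis by (simp add: power2_eq_iff_nonneg)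
qed

lemma
  fixes F :: "'a::chilbert_space \<Rightarrow> 'b::chilbert_space"
  assumes F: "bounded_clinear F"
  shows positive_op_abs: "positive_op (op_abs F)"
    and norm_op_abs: "norm (op_abs F x) = norm (F x)"
proof -
  note p = positive_op_cadjoint_comp[OF F]
  show 1: "positive_op (op_abs F)" unfolding op_abs_def by (rule positive_op_sqrt[OF p])
  have 2: "op_abs F (op_abs F x) = cadjoint F (F x)" for x
    using op_sqrt_square[OF p, of x] by (simp add: op_abs_def)
  show "norm (op_abs F x) = norm (F x)" by (rule norm_positive_sqrt[OF 1 F 2])
qed

text \<open>The optimal bound enters as a lower inequality together with almost minimisers; the
  passage from \<open>GREATEST\<close> to this form is made once, at the end.\<close>

locale frame_op =
  fixes F :: "ell2 \<Rightarrow> 'h::chilbert_space" and a :: real and n :: nat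
  assumes F: "bounded_clinear F" and a_pos: "0 < a"
    and frame_lower: "\<And>h. a * (norm h)\<^sup>2 \<le> (norm (cadjoint F h))\<^sup>2"
    and frame_lower_sharp: "\<And>\<epsilon>. 0 < \<epsilon> \<Longrightarrow> \<exists>h. h \<noteq> 0 \<and> (norm (cadjoint F h))\<^sup>2 \<le> (a + \<epsilon>) * (norm h)\<^sup>2"
    and cdim_kernel: "has_cdim {x. F x = 0} n"
begin

abbreviation "Th \<equiv> cadjoint F"

lemmas bTh = bounded_clinear_cadjoint[OF F]

lemma sqrt_a_le_Th: "sqrt a * norm h \<le> norm (Th h)"
  using frame_lower[of h] a_pos
  by (intro power2_le_imp_le[OF _ norm_ge_zero]) (simp add: power_mult_distrib)

definition "S h = F (Th h)"

lemma bS: "bounded_clinear S"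
  unfolding S_def by (rule bounded_clinear_comp[OF F bTh])

lemma S_form: "Re (cinner (S h) h) = (norm (Th h))\<^sup>2"
  by (simp add: S_def cinner_cadjoint[OF F] norm_sq_cinner)

lemma positive_S: "positive_op S"
  using positive_op_cadjoint_comp[OF bTh] by (simp add: cadjoint_cadjoint[OF F] comp_def S_def[abs_def])

definition "Si = (SOME R. bounded_clinear R \<and> (\<forall>x. R (S x) = x) \<and> (\<forall>x. S (R x) = x))"

lemma SSi: "S (Si x) = x"
proof -
  have "\<exists>R. bounded_clinear R \<and> (\<forall>x. R (S x) = x) \<and> (\<forall>x. S (R x) = x)"
    by (rule Lax_Milgram[OF bS a_pos]) (simp add: S_form frame_lower)
  from someI_ex[OF this, folded Si_def]
  show ?thesis by simp
qed

text \<open>So \<open>F\<close> is onto, with explicit preimages in the range of \<open>Th\<close>,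
  that is, orthogonal to the kernel of \<open>F\<close>.\<close>

lemma F_Th_Si: "F (Th (Si y)) = y"
  using SSi[of y] by (simp add: S_def)

definition "T = op_sqrt S"

lemma positive_T: "positive_op T"
  unfolding T_def by (rule positive_op_sqrt[OF positive_S])

lemma TT: "T (T x) = S x"
  unfolding T_def by (rule op_sqrt_square[OF positive_S])

lemmas bT = positive_op_bcl[OF positive_T]
lemmas hT = hermitianD[OF positive_op_hermitian[OF positive_T]]

lemma norm_T: "norm (T x) = norm (Th x)"
  by (rule norm_positive_sqrt[OF positive_T bTh]) (simp add: cadjoint_cadjoint[OF F] TT S_def)

lemma T_ge: "sqrt a * (norm x)\<^sup>2 \<le> Re (cinner (T x) x)"
  by (rule positive_op_form_ge[OF positive_T]) (simp add: norm_T sqrt_a_le_Th)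

definition "Ti = (SOME R. bounded_clinear R \<and> (\<forall>x. R (T x) = x) \<and> (\<forall>x. T (R x) = x))"

lemma bTi: "bounded_clinear Ti" and TiT: "Ti (T x) = x" and TTi: "T (Ti x) = x"
proof -
  have "0 < sqrt a" using a_pos by simp
  then have "\<exists>R. bounded_clinear R \<and> (\<forall>x. R (T x) = x) \<and> (\<forall>x. T (R x) = x)"
    by (rule Lax_Milgram[OF bT]) (rule T_ge)
  from someI_ex[OF this, folded Ti_def]
  show "bounded_clinear Ti" "Ti (T x) = x" "T (Ti x) = x" by auto
qed

lemma hTi: "cinner (Ti x) y = cinner x (Ti y)"
  using hT[of "Ti x" "Ti y"] by (simp add: TTi)

text \<open>The polar decomposition \<open>F = T U\<close> with \<open>U\<close> a coisometry; \<open>W\<close> is the adjoint of \<open>U\<close>.\<close>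

definition "W x = Th (Ti x)"
definition "U x = Ti (F x)"

lemma bW: "bounded_clinear W"
  unfolding W_def by (rule bounded_clinear_comp[OF bTh bTi])

lemma bU: "bounded_clinear U"
  unfolding U_def by (rule bounded_clinear_comp[OF bTi F])

lemma norm_W: "norm (W x) = norm x"
  by (simp add: W_def norm_T[symmetric] TTi)

lemma FW: "F (W x) = T x"
  using TT[of "Ti x"] by (simp add: W_def TTi S_def)

lemma UW: "U (W x) = x"
  by (simp add: U_def FW TiT)

lemma cinner_W: "cinner (W y) x = cinner y (U x)"
  by (simp add: W_def U_def cinner_cadjoint'[OF F] hTi)

lemma cinner_W_right: "cinner x (W y) = cinner (U x) y"
  by (metis cinner_W cinner_commute)

text \<open>\<open>W T U\<close> is positive because \<open>W\<close> is the adjoint of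
  \<open>U\<close>, and \<open>U W = 1\<close> makes its square \<open>Th\<close> after
  \<open>F\<close>; uniqueness of the positive root does the rest.\<close>

lemma op_abs_F: "op_abs F = (\<lambda>x. W (T (U x)))"
  unfolding op_abs_def
proof (rule op_sqrt_eqI[OF positive_op_cadjoint_comp[OF F]])
  show "positive_op (\<lambda>x. W (T (U x)))"
  proof (rule positive_opI)
    show "bounded_clinear (\<lambda>x. W (T (U x)))"
      by (rule bounded_clinear_comp[OF bW bounded_clinear_comp[OF bT bU]])
    show "hermitian (\<lambda>x. W (T (U x)))"
      by (simp add: hermitian_def cinner_W cinner_W_right hT)
    show "0 \<le> Re (cinner (W (T (U x))) x)" for x
      by (simp add: cinner_W positive_op_nonneg[OF positive_T])
  qed
  show "W (T (U (W (T (U x))))) = (Th \<circ> F) x" for x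
    by (simp add: UW) (simp add: W_def U_def TiT TTi)
qed

abbreviation "G \<equiv> op_abs F"

lemmas positive_G = positive_op_abs[OF F]
lemmas bG = positive_op_bcl[OF positive_G]
lemmas hG = positive_op_hermitian[OF positive_G]
lemmas norm_G = norm_op_abs[OF F]

lemma form_G_W: "Re (cinner (G (W x)) (W x)) = Re (cinner (T x) x)"
  by (simp add: op_abs_F UW cinner_W)

text \<open>Off the kernel \<open>x\<close> has the form \<open>Th y\<close>, so
  \<open>(norm x)^2\<close> is \<open>Re (cinner y (F x))\<close>, while the frame bound gives
  \<open>sqrt a * norm y \<le> norm x\<close>.\<close>

lemma F_lower_cortho_kernel:
  assumes "x \<in> cortho {x. F x = 0}"
  shows "sqrt a * norm x \<le> norm (F x)"
proof (cases "x = 0")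
  case False
  define y where "y = Si (F x)"
  have "F (x - Th y) = 0" by (simp add: bcl_diff[OF F] y_def F_Th_Si)
  then have "cinner x (x - Th y) = 0" "cinner (Th y) (x - Th y) = 0"
    using corthoD[OF assms] by (auto simp: cinner_cadjoint'[OF F])
  then have "cinner (x - Th y) (x - Th y) = 0" by (simp only: cinner_diff_left[of x]) simp
  then have x: "x = Th y" by simp
  have "sqrt a * (norm x * norm x) = sqrt a * Re (cinner y (F x))"
    using norm_sq_cinner[of x] by (simp add: power2_eq_square) (simp add: x cinner_cadjoint'[OF F])
  also have "\<dots> \<le> sqrt a * (norm y * norm (F x))"
    using a_pos Re_cinner_le[of y "F x"] by (intro mult_left_mono) auto
  also have "\<dots> = (sqrt a * norm y) * norm (F x)" by simp
  also have "\<dots> \<le> norm x * norm (F x)" using sqrt_a_le_Th[of y] x by (intro mult_right_mono) auto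
  finally have "norm x * (sqrt a * norm x) \<le> norm x * norm (F x)" by (simp only: mult_ac)
  then show ?thesis using False by simp
qed (simp add: bcl_zero[OF F])

text \<open>Lower bounds of \<open>F\<close> on subspaces of finite codimension; their supremum
  \<open>m\<close> turns out to be the essential minimum modulus.\<close>

definition "lower_set = {\<mu>. 0 \<le> \<mu> \<and> (\<exists>L. finite L \<and> (\<forall>x\<in>cortho L. \<mu> * norm x \<le> norm (F x)))}"
definition "m = Sup lower_set"

lemma sqrt_a_in_lower_set: "sqrt a \<in> lower_set"
proof -
  obtain B where B: "finite B" "cspan B = {x. F x = 0}" using cdim_kernel unfolding has_cdim_def by blast
  have "sqrt a * norm x \<le> norm (F x)" if "x \<in> cortho B" for x
    by (rule F_lower_cortho_kernel) (use that cortho_cspan[of B] B in simp)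
  then show ?thesis using B(1) a_pos unfolding lower_set_def by auto
qed

lemma bdd_above_lower_set: "bdd_above lower_set"
proof (rule bdd_aboveI)
  fix \<mu> assume "\<mu> \<in> lower_set"
  then obtain L where L: "finite L" "\<forall>x\<in>cortho L. \<mu> * norm x \<le> norm (F x)" by (auto simp: lower_set_def)
  obtain x where x: "x \<noteq> 0" "x \<in> cortho L" using infinite_cdim_orthogonal[OF infinite_cdim_ell2 L(1)] .
  have "\<mu> * norm x \<le> onorm F * norm x" using L(2) x(2) bcl_onorm[OF F, of x] by force
  then show "\<mu> \<le> onorm F" using x(1) by simp
qed

lemma sqrt_a_le_m: "sqrt a \<le> m"
  unfolding m_def by (rule cSup_upper[OF sqrt_a_in_lower_set bdd_above_lower_set])

lemma m_pos: "0 < m"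
  using sqrt_a_le_m a_pos real_sqrt_gt_zero[of a] by linarith

lemma F_lower_below_m:
  assumes "\<mu> < m"
  shows "\<exists>L. finite L \<and> (\<forall>x\<in>cortho L. \<mu> * norm x \<le> norm (F x))"
proof -
  have "lower_set \<noteq> {}" using sqrt_a_in_lower_set by auto
  then obtain \<nu> where \<nu>: "\<nu> \<in> lower_set" "\<mu> < \<nu>"
    using assms less_cSup_iff[OF _ bdd_above_lower_set] unfolding m_def by blast
  then obtain L where L: "finite L" "\<forall>x\<in>cortho L. \<nu> * norm x \<le> norm (F x)" by (auto simp: lower_set_def)
  have "\<mu> * norm x \<le> norm (F x)" if "x \<in> cortho L" for x
  proof -
    have "\<mu> * norm x \<le> \<nu> * norm x" using \<nu>(2) by (intro mult_right_mono) auto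
    then show ?thesis using L(2) that by force
  qed
  then show ?thesis using L(1) by blast
qed

lemma F_small_above_m:
  assumes "m < \<mu>" "finite L"
  shows "\<exists>x. x \<in> cortho L \<and> norm x = 1 \<and> norm (F x) < \<mu>"
proof -
  have "\<mu> \<notin> lower_set" using cSup_upper[OF _ bdd_above_lower_set] assms(1) unfolding m_def by (meson not_le)
  then obtain x where x: "x \<in> cortho L" "norm (F x) < \<mu> * norm x"
    using assms m_pos unfolding lower_set_def by (auto simp: not_le)
  have "x \<noteq> 0" using x(2) by auto
  then show ?thesis by (rule normalise_in_cortho[OF x(1) _ F x(2)])
qed

lemma ess_min_modulus_F: "ess_min_modulus F = m"
  unfolding ess_min_modulus_def
proof (rule real_min_ess_spectrum[OF positive_G])
  show "0 \<le> m" using m_pos by simp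
  show "\<exists>L. finite L \<and> (\<forall>x\<in>cortho L. \<mu> * norm x \<le> norm (G x))" if "0 \<le> \<mu>" "\<mu> < m" for \<mu>
    unfolding norm_G by (rule F_lower_below_m[OF that(2)])
  show "\<exists>x. x \<in> cortho L \<and> norm x = 1 \<and> norm (G x) < \<mu>" if "m < \<mu>" "finite L" for \<mu> L
    unfolding norm_G by (rule F_small_above_m[OF that])
qed

section \<open>Max-min values of the modulus of \<open>F\<close>\<close>

abbreviation "qmin M \<equiv> real_min (spectrum_on M (compression M G))"

lemma u_number_F: "u_number k F = Sup {qmin M | M. has_cdim M k}"
  by (simp add: u_number_def)

lemma qmin_le_onorm:
  assumes "has_cdim M k" "0 < k"
  shows "qmin M \<le> onorm F"
proof -
  have "card ({} :: ell2 set) < k" using assms(2) by simp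
  from has_cdim_orthogonal[OF assms(1) finite.emptyI this] obtain y where y: "y \<in> M" "y \<noteq> 0" by metis
  have "qmin M * (norm y)\<^sup>2 \<le> Re (cinner (G y) y)"
    by (rule real_min_compression_le[OF bG hG assms y(1)])
  also have "\<dots> \<le> norm (F y) * norm y" using Re_cinner_le[of "G y" y] by (simp add: norm_G)
  also have "\<dots> \<le> onorm F * (norm y)\<^sup>2"
    using mult_right_mono[OF bcl_onorm[OF F, of y], of "norm y"] by (simp add: power2_eq_square mult.assoc)
  finally show ?thesis using y(2) by simp
qed

lemma qmin_le_u_number:
  assumes "has_cdim M k" "0 < k"
  shows "qmin M \<le> u_number k F"
  unfolding u_number_F
proof (rule cSup_upper)
  show "bdd_above {qmin M | M. has_cdim M k}"
    using qmin_le_onorm[OF _ assms(2)] by (intro bdd_aboveI[of _ "onorm F"]) auto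
qed (use assms in auto)


section \<open>Distance to the coisometries\<close>

lemma upper_bound_m:
  assumes "0 < \<epsilon>"
  shows "\<exists>V. bounded_clinear V \<and> (\<forall>h. norm (V h) = norm h) \<and> (\<forall>h. norm (F (V h) - h) \<le> (1 + m + \<epsilon>) * norm h)"
proof -
  define P where "P k x \<longleftrightarrow> norm x = 1 \<and> norm (F x) < m + \<epsilon>" for k :: nat and x
  have ex: "\<exists>x. x \<in> cortho L \<and> P k x" if "finite L" for k L
    unfolding P_def by (rule F_small_above_m[OF _ that]) (use \<open>0 < \<epsilon>\<close> in simp)
  \<comment> \<open>Orthogonality to \<open>Th (F (x j))\<close> is orthogonality of the images
    under \<open>F\<close>, so the estimate for the single \<open>x k\<close> passes to their
    combinations with no loss.\<close>
  have "\<exists>x. (\<forall>k. P k (x k)) \<and> (\<forall>j k. j < k \<longrightarrow> cinner (x k) (x j) = 0 \<and> cinner (x k) (Th (F (x j))) = 0)"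
    by (rule orthogonal_sequence[where H = "\<lambda>y. Th (F y)"]) (rule ex)
  then obtain x where "\<And>k. P k (x k)"
    and x2: "\<And>j k. j < k \<Longrightarrow> cinner (x k) (x j) = 0" "\<And>j k. j < k \<Longrightarrow> cinner (x k) (Th (F (x j))) = 0"
    by blast
  then have x1: "norm (x k) = 1" "norm (F (x k)) < m + \<epsilon>" for k by (auto simp: P_def)
  have x_orth: "cinner (x i) (x j) = 0" if "i \<noteq> j" for i j
    using x2(1)[of i j] x2(1)[of j i] that cinner_zero_commute[of "x i" "x j"] by (cases "i < j") auto
  have Fx_orth: "cinner (F (x i)) (F (x j)) = 0" if "i \<noteq> j" for i j
  proof (cases "j < i")
    case True
    then show ?thesis using x2(2)[of j i] by (simp add: cinner_cadjoint[OF F])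
  next
    case False
    then have "cinner (F (x j)) (F (x i)) = 0" using x2(2)[of i j] that by (simp add: cinner_cadjoint[OF F])
    then show ?thesis using cinner_zero_commute[of "F (x j)"] by blast
  qed
  have "orthonormal x k" for k
    using x_orth by (auto simp: orthonormal_def cinner_self_norm x1)
  then have Bes: "Bessel x 1" by (rule Bessel_orthonormal)
  define E where "E = synthesis x"
  have bE: "bounded_clinear E" unfolding E_def by (rule bounded_clinear_synthesis[OF Bes])
  have sumsE: "(\<lambda>i. coord b i *\<^sub>C x i) sums E b" for b unfolding E_def by (rule synthesis_sums[OF Bes])
  have sumsb: "(\<lambda>k. \<Sum>i<k. (cmod (coord b i))\<^sup>2) \<longlonglongrightarrow> (norm b)\<^sup>2" for b
    unfolding norm_ell2_sq by (rule summable_LIMSEQ[OF summable_coord])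
  have normE: "norm (E b) = norm b" for b
  proof -
    have "(norm (\<Sum>i<k. coord b i *\<^sub>C x i))\<^sup>2 = (\<Sum>i<k. (cmod (coord b i))\<^sup>2)" for k
      by (subst norm_sum_orthogonal) (auto simp: cinner_simps x_orth norm_scaleC x1)
    moreover have "(\<lambda>k. (norm (\<Sum>i<k. coord b i *\<^sub>C x i))\<^sup>2) \<longlonglongrightarrow> (norm (E b))\<^sup>2"
      using sumsE[of b] unfolding sums_def by (intro tendsto_intros)
    ultimately have "(\<lambda>k. \<Sum>i<k. (cmod (coord b i))\<^sup>2) \<longlonglongrightarrow> (norm (E b))\<^sup>2" by (simp only:)
    then have "(norm (E b))\<^sup>2 = (norm b)\<^sup>2" using sumsb[of b] by (rule LIMSEQ_unique)
    then show ?thesis by (simp add: power2_eq_iff_nonneg)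
  qed
  have normFE: "norm (F (E b)) \<le> (m + \<epsilon>) * norm b" for b
  proof -
    have le: "(norm (\<Sum>i<k. F (coord b i *\<^sub>C x i)))\<^sup>2 \<le> (m + \<epsilon>)\<^sup>2 * (\<Sum>i<k. (cmod (coord b i))\<^sup>2)" for k
    proof -
      have "(norm (\<Sum>i<k. F (coord b i *\<^sub>C x i)))\<^sup>2 = (\<Sum>i<k. (cmod (coord b i))\<^sup>2 * (norm (F (x i)))\<^sup>2)"
        by (subst norm_sum_orthogonal)
          (auto simp: cinner_simps Fx_orth norm_scaleC bcl_scaleC[OF F] power_mult_distrib)
      also have "\<dots> \<le> (\<Sum>i<k. (cmod (coord b i))\<^sup>2 * (m + \<epsilon>)\<^sup>2)"
        by (intro sum_mono mult_left_mono power_mono less_imp_le[OF x1(2)]) auto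
      finally show ?thesis by (simp add: sum_distrib_left mult.commute)
    qed
    have "(\<lambda>k. (norm (\<Sum>i<k. F (coord b i *\<^sub>C x i)))\<^sup>2) \<longlonglongrightarrow> (norm (F (E b)))\<^sup>2"
      using bounded_linear.sums[OF bounded_clinear_bounded_linear[OF F] sumsE[of b]]
      unfolding sums_def by (intro tendsto_intros)
    moreover have "(\<lambda>k. (m + \<epsilon>)\<^sup>2 * (\<Sum>i<k. (cmod (coord b i))\<^sup>2)) \<longlonglongrightarrow> (m + \<epsilon>)\<^sup>2 * (norm b)\<^sup>2"
      by (intro tendsto_intros sumsb)
    ultimately have "(norm (F (E b)))\<^sup>2 \<le> (m + \<epsilon>)\<^sup>2 * (norm b)\<^sup>2"
      by (rule LIMSEQ_le) (use le in auto)
    then have "(norm (F (E b)))\<^sup>2 \<le> ((m + \<epsilon>) * norm b)\<^sup>2" by (simp only: power_mult_distrib)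
    then show ?thesis by (rule power2_le_imp_le) (use m_pos \<open>0 < \<epsilon>\<close> in simp)
  qed
  show ?thesis
  \<comment> \<open>\<open>W\<close> is an isometry into \<open>ell2\<close> already at hand, so no
    basis of the codomain is chosen; \<open>E\<close> then moves \<open>ell2\<close> onto the closed
    span of the \<open>x k\<close>.\<close>
  proof (intro exI[of _ "\<lambda>h. E (W h)"] conjI allI)
    show "bounded_clinear (\<lambda>h. E (W h))" by (rule bounded_clinear_comp[OF bE bW])
    show "norm (E (W h)) = norm h" for h by (simp add: normE norm_W)
    show "norm (F (E (W h)) - h) \<le> (1 + m + \<epsilon>) * norm h" for h
      using norm_triangle_ineq4[of "F (E (W h))" h] normFE[of "W h"] by (simp add: norm_W algebra_simps)
  qed
qed

lemma one_minus_sqrt_a_le: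
  assumes V: "\<And>h. norm (V h) = norm h" and r: "\<And>h. norm (F (V h) - h) \<le> r * norm h"
  shows "1 - sqrt a \<le> r"
proof (rule ccontr)
  assume "\<not> ?thesis"
  then have s: "sqrt a < 1 - r" by simp
  have "0 < sqrt a" using a_pos by simp
  have "(sqrt a)\<^sup>2 < (1 - r)\<^sup>2" using s \<open>0 < sqrt a\<close> by (intro power_strict_mono) auto
  \<comment> \<open>Half of the gap serves as slack, so that an almost minimiser still satisfies
    \<open>norm (Th h) < (1 - r) * norm h\<close>.\<close>
  then have "0 < ((1 - r)\<^sup>2 - a) / 2" using a_pos by simp
  then obtain h where h: "h \<noteq> 0" "(norm (Th h))\<^sup>2 \<le> (a + ((1 - r)\<^sup>2 - a) / 2) * (norm h)\<^sup>2"
    using frame_lower_sharp by blast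
  have "a + ((1 - r)\<^sup>2 - a) / 2 < (1 - r)\<^sup>2" using \<open>0 < ((1 - r)\<^sup>2 - a) / 2\<close> by (simp add: field_simps)
  then have "(a + ((1 - r)\<^sup>2 - a) / 2) * (norm h)\<^sup>2 < (1 - r)\<^sup>2 * (norm h)\<^sup>2"
    by (rule mult_strict_right_mono) (use h in simp)
  then have "(norm (Th h))\<^sup>2 < ((1 - r) * norm h)\<^sup>2" using h(2) by (simp only: power_mult_distrib)
  then have "norm (Th h) < (1 - r) * norm h"
    by (rule power_less_imp_less_base) (rule mult_nonneg_nonneg, use s \<open>0 < sqrt a\<close> in linarith, simp)
  then have "norm h * norm (Th h) < norm h * ((1 - r) * norm h)" using h(1) by simp
  moreover have "(norm h)\<^sup>2 = Re (cinner (h - F (V h)) h) + Re (cinner (F (V h)) h)"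
    by (simp add: cinner_diff_left norm_sq_cinner)
  moreover have "Re (cinner (h - F (V h)) h) \<le> r * norm h * norm h"
  proof -
    have "Re (cinner (h - F (V h)) h) \<le> norm (h - F (V h)) * norm h" using Re_cinner_le abs_le_iff by blast
    also have "\<dots> \<le> r * norm h * norm h"
      using r[of h] by (intro mult_right_mono) (auto simp: norm_minus_commute)
    finally show ?thesis .
  qed
  moreover have "Re (cinner (F (V h)) h) \<le> norm h * norm (Th h)"
    using Re_cinner_le[of "V h" "Th h"] by (simp add: cinner_cadjoint[OF F] V)
  ultimately show False by (simp add: power2_eq_square algebra_simps)
qed

text \<open>Adding a multiple of the projection onto a finite-dimensional space \<open>L\<close> makes
  \<open>F\<^sup>* (F + \<kappa> X)\<close> coercive as soon as \<open>\<kappa>\<close> is below the lower bound of \<open>F\<close> on the complement of \<open>L\<close>.\<close>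

lemma coercive_finite_rank_perturbation:
  assumes X: "bounded_clinear X" "\<And>y. norm (X y) \<le> norm y"
    and e: "orthonormal e k" and low: "\<And>v. v \<in> cortho (cspan (e ` {..<k})) \<Longrightarrow> \<mu> * norm v \<le> norm (F v)"
    and \<kappa>: "0 \<le> \<kappa>" "\<kappa> < \<mu>"
  shows "\<exists>c \<delta>. 0 < \<delta> \<and> (\<forall>y. \<delta> * (norm y)\<^sup>2 \<le>
    Re (cinner (Th (F y + \<kappa> *\<^sub>R X y) + c *\<^sub>R oproj e k y) y))"
proof -
  \<comment> \<open>Strictly between: the gap to \<open>\<mu>\<close> pays for the mixed terms with
    the projection, and the gap to \<open>\<kappa>\<close> remains as the coercivity constant
    \<open>\<nu> * (\<nu> - \<kappa>)\<close>.\<close>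
  define \<nu> where "\<nu> = (\<kappa> + \<mu>) / 2"
  have \<nu>: "\<kappa> < \<nu>" "\<nu> < \<mu>" "0 < \<nu>" using \<kappa> by (auto simp: \<nu>_def)
  \<comment> \<open>The weight in
    \<open>(p + q)^2 \<le> (1 + \<eta>) p^2 + (1 + 1 / \<eta>) q^2\<close>, chosen so that division
    by \<open>1 + \<eta>\<close> turns \<open>\<mu>^2\<close> into \<open>\<nu>^2\<close>.\<close>
  define \<eta> where "\<eta> = \<mu>\<^sup>2 / \<nu>\<^sup>2 - 1"
  have "\<nu>\<^sup>2 < \<mu>\<^sup>2" using \<nu> by (intro power_strict_mono) auto
  then have \<eta>: "0 < \<eta>" "(1 + \<eta>) * \<nu>\<^sup>2 = \<mu>\<^sup>2" using \<nu> by (auto simp: \<eta>_def)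
  define K where "K = onorm F"
  have K: "norm (F y) \<le> K * norm y" for y unfolding K_def by (rule bcl_onorm[OF F])
  \<comment> \<open>The first summand absorbs the image of the projected part \<open>u\<close>; the
    second adds \<open>\<nu>^2 * (norm u)^2\<close>, so that the bound reaches all of
    \<open>y\<close>.\<close>
  define c where "c = K\<^sup>2 / \<eta> + \<nu>\<^sup>2"
  have "\<nu> * (\<nu> - \<kappa>) * (norm y)\<^sup>2 \<le> Re (cinner (Th (F y + \<kappa> *\<^sub>R X y) + c *\<^sub>R oproj e k y) y)" for y
  proof -
    define u where "u = oproj e k y"
    define v where "v = y - u"
    have vL: "v \<in> cortho (cspan (e ` {..<k}))" unfolding v_def u_def by (rule diff_oproj_cortho[OF e])
    have uv: "cinner v u = 0" using corthoD[OF vL, of u] oproj_in_cspan[of e k y] by (simp add: u_def)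
    have y: "y = v + u" by (simp add: v_def)
    have ny: "(norm y)\<^sup>2 = (norm v)\<^sup>2 + (norm u)\<^sup>2" unfolding y norm_add_sq uv by simp
    have uy: "Re (cinner u y) = (norm u)\<^sup>2"
      using uv cinner_zero_commute[of v u] by (simp add: y cinner_add_right norm_sq_cinner)
    have "\<mu> * norm v \<le> norm (F y) + K * norm u"
    proof -
      have "norm (F v) \<le> norm (F y) + norm (F u)" unfolding v_def bcl_diff[OF F] by (rule norm_triangle_ineq4)
      then show ?thesis using low[OF vL] K[of u] by linarith
    qed
    then have "(\<mu> * norm v)\<^sup>2 \<le> (norm (F y) + K * norm u)\<^sup>2"
      using \<kappa> by (intro power_mono) auto
    also have "\<dots> \<le> (1 + \<eta>) * (norm (F y))\<^sup>2 + (1 + 1 / \<eta>) * (K * norm u)\<^sup>2"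
    proof -
      have "0 \<le> (\<eta> * norm (F y) - K * norm u)\<^sup>2 / \<eta>" using \<eta>(1) by simp
      also have "\<dots> = \<eta> * (norm (F y))\<^sup>2 - 2 * norm (F y) * (K * norm u) + (K * norm u)\<^sup>2 / \<eta>"
        using \<eta>(1) by (simp add: power2_eq_square field_simps)
      finally show ?thesis by (simp add: power2_sum algebra_simps)
    qed
    finally have le: "(\<mu> * norm v)\<^sup>2 \<le> (1 + \<eta>) * (norm (F y))\<^sup>2 + (1 + 1 / \<eta>) * (K * norm u)\<^sup>2" .
    have "(1 + \<eta>) * (\<nu>\<^sup>2 * (norm v)\<^sup>2) \<le> (1 + \<eta>) * ((norm (F y))\<^sup>2 + K\<^sup>2 / \<eta> * (norm u)\<^sup>2)"
    proof -
      have "(1 + 1 / \<eta>) * (K * norm u)\<^sup>2 = (1 + \<eta>) * (K\<^sup>2 / \<eta> * (norm u)\<^sup>2)"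
        using \<eta>(1) by (simp add: power_mult_distrib field_simps)
      moreover have "(\<mu> * norm v)\<^sup>2 = (1 + \<eta>) * (\<nu>\<^sup>2 * (norm v)\<^sup>2)"
        unfolding power_mult_distrib \<eta>(2)[symmetric] by simp
      ultimately show ?thesis
        using le by (simp only: distrib_left)
    qed
    then have 1: "\<nu>\<^sup>2 * (norm v)\<^sup>2 \<le> (norm (F y))\<^sup>2 + K\<^sup>2 / \<eta> * (norm u)\<^sup>2"
      using \<eta>(1) by simp
    \<comment> \<open>The form to be bounded is at least \<open>g * (g - \<kappa> * norm y)\<close>,
      because \<open>norm (F y) \<le> g\<close>; and \<open>g\<close> is at least
      \<open>\<nu> * norm y\<close>.\<close>
    define g where "g = sqrt ((norm (F y))\<^sup>2 + c * (norm u)\<^sup>2)"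
    have "0 \<le> c" using \<eta>(1) by (simp add: c_def)
    have g2: "g\<^sup>2 = (norm (F y))\<^sup>2 + c * (norm u)\<^sup>2" using \<open>0 \<le> c\<close> by (simp add: g_def)
    have "0 \<le> g" by (simp add: g_def \<open>0 \<le> c\<close>)
    have "norm (F y) \<le> g"
      by (rule power2_le_imp_le) (simp_all add: g2 \<open>0 \<le> c\<close> \<open>0 \<le> g\<close>)
    have "(\<nu> * norm y)\<^sup>2 \<le> g\<^sup>2"
      using 1 by (simp add: g2 power_mult_distrib ny c_def algebra_simps)
    then have \<nu>g: "\<nu> * norm y \<le> g" by (rule power2_le_imp_le) (rule \<open>0 \<le> g\<close>)
    have "\<bar>Re (cinner (X y) (F y))\<bar> \<le> norm y * g"
      by (rule order_trans[OF Re_cinner_le mult_mono]) (use X(2) \<open>norm (F y) \<le> g\<close> in auto)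
    then have "- (norm y * g) \<le> Re (cinner (X y) (F y))" by linarith
    then have "\<kappa> * - (norm y * g) \<le> \<kappa> * Re (cinner (X y) (F y))" using \<kappa>(1) by (rule mult_left_mono)
    moreover have "Re (cinner (Th (F y + \<kappa> *\<^sub>R X y) + c *\<^sub>R u) y)
        = g\<^sup>2 + \<kappa> * Re (cinner (X y) (F y))"
      by (simp add: cinner_add_left cinner_cadjoint'[OF F] cinner_scaleR_left uy g2 flip: norm_sq_cinner)
    moreover have "\<nu> * (\<nu> - \<kappa>) * (norm y)\<^sup>2 \<le> g * (g - \<kappa> * norm y)"
    proof -
      have "\<nu> * norm y - \<kappa> * norm y \<le> g - \<kappa> * norm y" using \<nu>g by simp
      moreover have "0 \<le> \<nu> * norm y - \<kappa> * norm y" using \<nu> by (simp add: mult_right_mono)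
      ultimately have "(\<nu> * norm y) * (\<nu> * norm y - \<kappa> * norm y) \<le> g * (g - \<kappa> * norm y)"
        using \<nu>g \<open>0 \<le> g\<close> by (intro mult_mono)
      then show ?thesis by (simp add: power2_eq_square algebra_simps)
    qed
    ultimately show ?thesis unfolding u_def[symmetric] by (simp add: power2_eq_square algebra_simps)
  qed
  then show ?thesis using \<nu> by (intro exI[of _ c] exI[of _ "\<nu> * (\<nu> - \<kappa>)"]) auto
qed

end

lemma has_cdim_finite_basis:
  assumes "has_cdim M k"
  obtains B where "finite B" "\<not> cdependent B" "card B = k" "cspan B = M"
  using assms unfolding has_cdim_def by blast

context frame_op
begin

text \<open>For \<open>V = cadjoint X\<close> the map \<open>F V + \<kappa> = (F + \<kappa> X) V\<close> is onto when \<open>norm (F V - 1) < 1 + \<kappa>\<close>.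
  For \<open>\<kappa> < m\<close> the kernel of \<open>F + \<kappa> X\<close> then has dimension at most \<open>n\<close>: otherwise \<open>F\<^sup>* (F + \<kappa> X)\<close>,
  a finite-rank perturbation of a coercive operator, could be changed by a finite-rank operator into
  a map that is onto but not injective.\<close>

lemma kernel_cdim_le:
  assumes X: "bounded_clinear X" "\<And>y. norm (X y) \<le> norm y"
    and \<kappa>: "0 \<le> \<kappa>" "\<kappa> < m" and onto: "\<And>w. \<exists>x. F x + \<kappa> *\<^sub>R X x = w"
  shows "\<exists>k\<le>n. has_cdim {y. F y + \<kappa> *\<^sub>R X y = 0} k"
proof (rule ccontr)
  define \<Phi> where "\<Phi> y = F y + \<kappa> *\<^sub>R X y" for y
  have b\<Phi>: "bounded_clinear \<Phi>" unfolding \<Phi>_def by (intro bounded_clinear_add bounded_clinear_scaleR F X)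
  assume "\<not> ?thesis"
  then obtain M where M: "M \<subseteq> {y. \<Phi> y = 0}" "has_cdim M (Suc n)"
    using has_cdim_dichotomy[OF csubspace_kernel[OF b\<Phi>], of n] unfolding \<Phi>_def by blast
  obtain b where b: "orthonormal b (Suc n)" "cspan (b ` {..<Suc n}) = M"
    using has_cdim_orthonormal_basis[OF M(2)] by blast
  have \<Phi>b: "\<Phi> (b i) = 0" if "i < Suc n" for i
    using M(1) complex_vector.span_base[of "b i" "b ` {..<Suc n}"] that unfolding b(2) by blast
  obtain q where q: "orthonormal q n" "cspan (q ` {..<n}) = {x. F x = 0}"
    using has_cdim_orthonormal_basis[OF cdim_kernel] by blast
  obtain \<mu> where \<mu>: "\<kappa> < \<mu>" "\<mu> < m" using \<kappa>(2) dense by blast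
  obtain L where L: "finite L" "\<forall>x\<in>cortho L. \<mu> * norm x \<le> norm (F x)" using F_lower_below_m[OF \<mu>(2)] by blast
  obtain k where "has_cdim (cspan L) k" using has_cdim_cspan_finite[OF L(1)] by blast
  then obtain e where e: "orthonormal e k" "cspan (e ` {..<k}) = cspan L"
    using has_cdim_orthonormal_basis by blast
  have low: "\<mu> * norm v \<le> norm (F v)" if "v \<in> cortho (cspan (e ` {..<k}))" for v
    using that L(2) unfolding e(2) cortho_cspan[of L] by blast
  obtain c \<delta> where c: "0 < \<delta>" "\<forall>y. \<delta> * (norm y)\<^sup>2 \<le> Re (cinner (Th (\<Phi> y) + c *\<^sub>R oproj e k y) y)"
    using coercive_finite_rank_perturbation[OF X e(1) low \<kappa>(1) \<mu>(1)] unfolding \<Phi>_def by blast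
  define A where "A y = Th (\<Phi> y) + c *\<^sub>R oproj e k y" for y
  have bA: "bounded_clinear A"
    unfolding A_def
    by (intro bounded_clinear_add bounded_clinear_scaleR bounded_clinear_oproj bounded_clinear_comp[OF bTh b\<Phi>])
  obtain R where R: "bounded_clinear R" "\<forall>x. R (A x) = x" "\<forall>x. A (R x) = x"
    using Lax_Milgram[OF bA c(1)] c(2) unfolding A_def by blast
  \<comment> \<open>\<open>J\<close> fills the kernel of \<open>F\<close>, which the range of
    \<open>Th\<close> misses, from the first \<open>n\<close> kernel vectors of
    \<open>\<Phi>\<close>; the surplus vector \<open>b n\<close> goes to 0.\<close>
  define J where "J y = (\<Sum>i<n. cinner y (b i) *\<^sub>C q i)" for y
  have bJ: "bounded_clinear J" unfolding J_def by (intro bounded_clinear_sum bounded_clinear_cinner)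
  \<comment> \<open>A finite-rank change that exchanges the coercivity correction in
    \<open>A\<close> for \<open>J\<close>.\<close>
  define E where "E y = J y - c *\<^sub>R oproj e k y" for y
  have bE: "bounded_clinear E"
    unfolding E_def by (intro bounded_clinear_diff bounded_clinear_scaleR bounded_clinear_oproj bJ)
  have AE: "A y + E y = Th (\<Phi> y) + J y" for y by (simp add: A_def E_def)
  have "b n = 0"
  proof (rule Fredholm_alternative[of R A E "q ` {..<n} \<union> e ` {..<k}"])
    show "bounded_clinear R" "R (A x) = x" "A (R y) = y" "bounded_clinear E" for x y using R bE by auto
    show "finite (q ` {..<n} \<union> e ` {..<k})" by simp
    show "E y \<in> cspan (q ` {..<n} \<union> e ` {..<k})" for y
      unfolding E_def
    proof (rule complex_vector.span_diff)
      show "J y \<in> cspan (q ` {..<n} \<union> e ` {..<k})"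
        unfolding J_def by (intro complex_vector.span_sum complex_vector.span_scale complex_vector.span_base) auto
      have "cspan (e ` {..<k}) \<subseteq> cspan (q ` {..<n} \<union> e ` {..<k})" by (rule complex_vector.span_mono) simp
      then show "c *\<^sub>R oproj e k y \<in> cspan (q ` {..<n} \<union> e ` {..<k})"
        unfolding scaleR_scaleC using oproj_in_cspan by (intro complex_vector.span_scale) blast
    qed
    show "\<exists>x. A x + E x = y" for y
    proof -
      \<comment> \<open>\<open>Th w\<close> is the component of \<open>y\<close> in the range of
        \<open>Th\<close> and \<open>p\<close> the one in the kernel of \<open>F\<close>;
        \<open>\<Phi>\<close> reaches the first and \<open>J\<close> the second.\<close>
      define w where "w = Si (F y)"
      define p where "p = y - Th w"
      have "F p = 0" by (simp add: p_def w_def bcl_diff[OF F] F_Th_Si)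
      then have p: "oproj q n p = p" by (intro oproj_cspan[OF q(1)]) (simp add: q(2))
      obtain x0 where "\<Phi> x0 = w" using onto unfolding \<Phi>_def by blast
      \<comment> \<open>Moving along the \<open>b i\<close> leaves \<open>\<Phi>\<close> unchanged,
        so the first \<open>n\<close> coefficients are free to produce
        \<open>J x = p\<close>.\<close>
      define x where "x = x0 + (\<Sum>i<n. (cinner p (q i) - cinner x0 (b i)) *\<^sub>C b i)"
      have "\<Phi> x = w"
        by (simp add: x_def bcl_add[OF b\<Phi>] bcl_sum[OF b\<Phi>] bcl_scaleC[OF b\<Phi>] \<Phi>b \<open>\<Phi> x0 = w\<close>)
      moreover have "J x = p"
      proof -
        have "orthonormal b n" using b(1) by (simp add: orthonormal_def)
        then have "cinner x (b i) = cinner p (q i)" if "i < n" for i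
          using that by (simp add: x_def cinner_add_left
              cinner_lincomb_orthonormal[where c = "\<lambda>i. cinner p (q i) - cinner x0 (b i)"])
        then have "J x = oproj q n p" by (simp add: J_def oproj_def)
        then show ?thesis by (simp add: p)
      qed
      ultimately have "A x + E x = y" unfolding AE by (simp add: p_def)
      then show ?thesis by blast
    qed
    have "J (b n) = 0" using b(1) by (simp add: J_def orthonormal_def)
    then show "A (b n) + E (b n) = 0" unfolding AE by (simp add: \<Phi>b bcl_zero[OF bTh])
  qed
  moreover have "cinner (b n) (b n) = 1" using b(1) by (simp add: orthonormal_def)
  ultimately show False by simp
qed

lemma qmin_le_if_close:
  assumes X: "bounded_clinear X" and iso: "\<And>h. X (cadjoint X h) = h"
    and r: "\<And>h. norm (F (cadjoint X h) - h) \<le> r * norm h" "r < 1 + m"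
    and M: "has_cdim M (Suc n)"
  shows "qmin M \<le> r + 1"
proof -
  define V where "V = cadjoint X"
  have bV: "bounded_clinear V" unfolding V_def by (rule bounded_clinear_cadjoint[OF X])
  have XV: "X (V h) = h" for h by (simp add: V_def iso)
  have VX: "cinner (V h) y = cinner h (X y)" for h y by (simp add: V_def cinner_cadjoint'[OF X])
  have nV: "norm (V h) = norm h" for h
  proof -
    have "(norm (V h))\<^sup>2 = (norm h)\<^sup>2" by (simp only: norm_sq_cinner VX XV)
    then show ?thesis by (simp add: power2_eq_iff_nonneg)
  qed
  have nX: "norm (X y) \<le> norm y" for y
  proof -
    have "norm (X y) * norm (X y) = Re (cinner (V (X y)) y)"
      using norm_sq_cinner[of "X y"] by (simp add: VX power2_eq_square)
    also have "\<dots> \<le> norm (V (X y)) * norm y" using Re_cinner_le abs_le_iff by blast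
    finally show ?thesis by (cases "X y = 0") (simp_all add: nV)
  qed
  \<comment> \<open>The midpoint of \<open>r - 1\<close> and \<open>m\<close>, raised to 0 if
    negative: above \<open>r - 1\<close> for coercivity of \<open>F V + \<kappa>\<close>, below
    \<open>m\<close> for the kernel bound.\<close>
  define \<kappa> where "\<kappa> = max 0 ((r - 1 + m) / 2)"
  have "(r - 1 + m) / 2 \<le> \<kappa>" by (simp add: \<kappa>_def)
  moreover have "r - 1 < (r - 1 + m) / 2" using r(2) by (simp add: field_simps)
  ultimately have "r - 1 < \<kappa>" by (rule less_le_trans[rotated])
  then have "r < 1 + \<kappa>" by simp
  moreover have "0 \<le> \<kappa>" "\<kappa> < m" using r(2) m_pos by (auto simp: \<kappa>_def)
  ultimately have \<kappa>: "0 \<le> \<kappa>" "\<kappa> < m" "r < 1 + \<kappa>" by auto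
  define \<Phi> where "\<Phi> y = F y + \<kappa> *\<^sub>R X y" for y
  have b\<Phi>: "bounded_clinear \<Phi>" unfolding \<Phi>_def by (intro bounded_clinear_add bounded_clinear_scaleR F X)
  have b\<Phi>V: "bounded_clinear (\<lambda>h. \<Phi> (V h))" by (rule bounded_clinear_comp[OF b\<Phi> bV])
  have coer: "(1 + \<kappa> - r) * (norm h)\<^sup>2 \<le> Re (cinner (\<Phi> (V h)) h)" for h
  proof -
    have "Re (cinner (\<Phi> (V h)) h) = Re (cinner (F (V h) - h) h) + (1 + \<kappa>) * (norm h)\<^sup>2"
      by (simp add: \<Phi>_def XV cinner_simps distrib_right flip: norm_sq_cinner)
    moreover have "\<bar>Re (cinner (F (V h) - h) h)\<bar> \<le> r * norm h * norm h"
      by (rule order_trans[OF Re_cinner_le mult_right_mono]) (simp_all add: V_def r(1))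
    then have "- (r * (norm h)\<^sup>2) \<le> Re (cinner (F (V h) - h) h)"
      by (simp only: power2_eq_square mult.assoc)
    ultimately show ?thesis by (simp add: left_diff_distrib)
  qed
  have "0 < 1 + \<kappa> - r" using \<kappa> by simp
  from Lax_Milgram[OF b\<Phi>V this coer] obtain R where R: "bounded_clinear R"
    "\<forall>h. R (\<Phi> (V h)) = h" "\<forall>h. \<Phi> (V (R h)) = h" by blast
  have "\<exists>x. F x + \<kappa> *\<^sub>R X x = w" for w using R(3) unfolding \<Phi>_def by blast
  from kernel_cdim_le[OF X nX \<kappa>(1,2) this] obtain k where k: "k \<le> n" "has_cdim {y. \<Phi> y = 0} k"
    unfolding \<Phi>_def by blast
  obtain L where L: "finite L" "card L = k" "cspan L = {y. \<Phi> y = 0}"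
    using has_cdim_finite_basis[OF k(2)] by metis
  obtain B where B: "finite B" "\<not> cdependent B" "card B = Suc n" "cspan B = M"
    using has_cdim_finite_basis[OF M] by metis
  \<comment> \<open>\<open>V R \<Phi>\<close> projects onto the range of \<open>V\<close> along the
    kernel of \<open>\<Phi>\<close>. The complementary projection \<open>\<psi>\<close> has rank at
    most \<open>n\<close>, so it kills a nonzero vector of \<open>M\<close>, which then lies in the
    range of \<open>V\<close>.\<close>
  define \<psi> where "\<psi> y = y - V (R (\<Phi> y))" for y
  have b\<psi>: "bounded_clinear \<psi>"
    unfolding \<psi>_def
    by (intro bounded_clinear_diff bounded_clinear_id bounded_clinear_comp[OF bV bounded_clinear_comp[OF R(1) b\<Phi>]])
  have "\<exists>y\<in>cspan B. y \<noteq> 0 \<and> \<psi> y = 0"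
  proof (rule clinear_kernel_nontrivial[OF bcl_add[OF b\<psi>] bcl_scaleC[OF b\<psi>] B(1,2) L(1)])
    show "\<psi> y \<in> cspan L" for y unfolding L(3) using R(3) by (simp add: \<psi>_def bcl_diff[OF b\<Phi>])
    show "card L < card B" using L(2) B(3) k(1) by simp
  qed
  then obtain y where y: "y \<in> M" "y \<noteq> 0" "y = V (R (\<Phi> y))" unfolding B(4) by (auto simp: \<psi>_def)
  define z where "z = R (\<Phi> y)"
  have yz: "y = V z" using y(3) by (simp add: z_def)
  have "qmin M * (norm y)\<^sup>2 \<le> Re (cinner (G y) y)"
    by (rule real_min_compression_le[OF bG hG M zero_less_Suc y(1)])
  also have "\<dots> \<le> norm (F y) * norm y" using Re_cinner_le[of "G y" y] by (simp add: norm_G)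
  finally have "qmin M * norm y \<le> norm (F y)" using y(2) by (simp add: power2_eq_square)
  also have "\<dots> \<le> norm (F (V z) - z) + norm z" unfolding yz using norm_triangle_ineq2 by (simp add: diff_le_eq)
  also have "\<dots> \<le> (r + 1) * norm y" using r(1)[of z] by (simp add: yz nV V_def[symmetric] distrib_right)
  finally show ?thesis using y(2) by simp
qed

section \<open>Truncating \<open>T\<close> at a level above \<open>u_number\<close>\<close>

lemma has_cdim_W_image:
  assumes "has_cdim M k"
  shows "\<exists>M'. has_cdim M' k \<and> M' \<subseteq> W ` M"
proof -
  obtain e where e: "orthonormal e k" "cspan (e ` {..<k}) = M" using has_cdim_orthonormal_basis[OF assms] by blast
  have "orthonormal (\<lambda>i. W (e i)) k" using e(1) by (simp add: orthonormal_def cinner_W UW)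
  then have "has_cdim (cspan ((\<lambda>i. W (e i)) ` {..<k})) k" by (rule has_cdim_cspan_orthonormal)
  moreover have "cspan ((\<lambda>i. W (e i)) ` {..<k}) \<subseteq> W ` M"
  proof (rule complex_vector.span_minimal)
    have "e ` {..<k} \<subseteq> M" unfolding e(2)[symmetric] by (rule complex_vector.span_superset)
    then show "(\<lambda>i. W (e i)) ` {..<k} \<subseteq> W ` M" by auto
    show "csubspace (W ` M)" by (rule csubspace_image[OF bW has_cdim_csubspace[OF assms]])
  qed
  ultimately show ?thesis by blast
qed

text \<open>\<open>W\<close> is isometric and turns the form of \<open>T\<close> into that of
  \<open>G\<close>, so subspaces of the codomain supply competitors for
  \<open>u_number\<close>.\<close>

lemma le_u_number_if_T_ge:
  assumes M: "has_cdim M (Suc n)" and T: "\<And>u. u \<in> M \<Longrightarrow> c * (norm u)\<^sup>2 \<le> Re (cinner (T u) u)"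
  shows "c \<le> u_number (Suc n) F"
proof -
  obtain M' where M': "has_cdim M' (Suc n)" "M' \<subseteq> W ` M" using has_cdim_W_image[OF M] by blast
  have "c \<le> qmin M'"
  proof (rule le_real_min_compression[OF bG hG M'(1) zero_less_Suc])
    fix x assume "x \<in> M'"
    then obtain u where "u \<in> M" "x = W u" using M'(2) by blast
    then show "c * (norm x)\<^sup>2 \<le> Re (cinner (G x) x)" using T by (simp add: form_G_W norm_W)
  qed
  also have "\<dots> \<le> u_number (Suc n) F" by (rule qmin_le_u_number[OF M'(1) zero_less_Suc])
  finally show ?thesis .
qed


text \<open>Were the codomain spanned by a finite \<open>B\<close>, some nonzero \<open>x\<close> in
  \<open>ell2\<close> would be orthogonal to the kernel of \<open>F\<close> and to all
  \<open>Th b\<close>; the latter gives \<open>F x = 0\<close>.\<close>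

lemma has_cdim_in_codomain: "\<exists>M :: 'h set. has_cdim M k"
proof (rule ccontr)
  assume no: "\<not> ?thesis"
  have "\<not> has_cdim M (Suc k)" for M :: "'h set"
  proof
    assume "has_cdim M (Suc k)"
    then obtain M' :: "'h set" where "has_cdim M' k" by (rule has_cdim_mono[where j = k]) auto
    then show False using no by blast
  qed
  then have "\<exists>j. has_cdim (UNIV :: 'h set) j"
    using has_cdim_dichotomy[OF complex_vector.subspace_UNIV, of k] by blast
  then obtain j and B :: "'h set" where B: "finite B" "cspan B = UNIV" unfolding has_cdim_def by blast
  obtain K where K: "finite K" "cspan K = {x. F x = 0}" using cdim_kernel unfolding has_cdim_def by blast
  have "finite (Th ` B \<union> K)" using B(1) K(1) by simp
  then obtain x where x: "x \<noteq> 0" "x \<in> cortho (Th ` B \<union> K)"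
    by (rule infinite_cdim_orthogonal[OF infinite_cdim_ell2])
  have "cinner (F x) b = 0" if "b \<in> B" for b
    using x(2) that by (auto simp: cortho_def cinner_cadjoint[OF F])
  then have "F x \<in> cortho (cspan B)" unfolding cortho_cspan by (simp add: cortho_def)
  then have "cinner (F x) (F x) = 0" using B(2) corthoD by blast
  then have "x \<in> cspan K" unfolding K(2) by simp
  moreover have "x \<in> cortho (cspan K)" unfolding cortho_cspan using x(2) by (simp add: cortho_def)
  ultimately have "cinner x x = 0" using corthoD by blast
  then show False using x(1) by simp
qed

text \<open>Ensures that a cut-off \<open>c\<close> above \<open>u_number\<close> also lies above
  \<open>sqrt a\<close>, so truncation keeps the lower bound of \<open>T\<close>.\<close>

lemma sqrt_a_le_u_number: "sqrt a \<le> u_number (Suc n) F"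
proof -
  obtain M :: "'h set" where "has_cdim M (Suc n)" using has_cdim_in_codomain by blast
  then show ?thesis by (rule le_u_number_if_T_ge) (rule T_ge)
qed

text \<open>With \<open>R\<close> the positive part of \<open>T - c\<close>, the operator \<open>T - R\<close> is \<open>min T c\<close>. The range of \<open>R\<close> has
  dimension at most \<open>n\<close>, so \<open>1 - K\<^sup>2\<close>, where \<open>T K = T - R\<close>, has rank at most \<open>n\<close>; a square root of
  it followed by an isometry into the kernel of \<open>F\<close> completes \<open>W K\<close> to an isometry.\<close>

lemma upper_bound_u_number:
  assumes c: "u_number (Suc n) F < c"
  shows "\<exists>V. bounded_clinear V \<and> (\<forall>h. norm (V h) = norm h) \<and>
    (\<forall>h. norm (F (V h) - h) \<le> max (c - 1) (1 - sqrt a) * norm h)"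
proof -
  have ac: "sqrt a \<le> c" using sqrt_a_le_u_number c by linarith
  have "0 < sqrt a" using a_pos by simp
  with ac have "0 < c" by linarith
  define D where "D x = T x - c *\<^sub>R x" for x
  have bD: "bounded_clinear D" unfolding D_def by (intro bounded_clinear_diff bounded_clinear_scaleR bounded_clinear_id bT)
  have hD: "cinner (D x) y = cinner x (D y)" for x y by (simp add: D_def cinner_simps hT)
  have bDD: "bounded_clinear (\<lambda>x. D (D x))" by (rule bounded_clinear_comp[OF bD bD])
  have pDD: "positive_op (\<lambda>x. D (D x))"
  proof (rule positive_opI[OF bDD])
    show "hermitian (\<lambda>x. D (D x))" by (simp add: hermitian_def hD)
    show "0 \<le> Re (cinner (D (D x)) x)" for x by (simp add: hD[of "D x"] flip: norm_sq_cinner)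
  qed
  \<comment> \<open>The absolute value of the hermitian operator \<open>D\<close>. As a root of
    \<open>D^2\<close> it commutes with \<open>T\<close>, and therefore with
    \<open>D\<close>.\<close>
  define Z where "Z = op_sqrt (\<lambda>x. D (D x))"
  have pZ: "positive_op Z" unfolding Z_def by (rule positive_op_sqrt[OF pDD])
  have ZZ: "Z (Z x) = D (D x)" for x unfolding Z_def by (rule op_sqrt_square[OF pDD])
  note bZ = positive_op_bcl[OF pZ] and hZ = hermitianD[OF positive_op_hermitian[OF pZ]]
  have TZ: "T (Z x) = Z (T x)" for x
    unfolding Z_def by (rule op_sqrt_commute[OF pDD bT]) (simp add: D_def bcl_simps[OF bT])
  have DZ: "D (Z x) = Z (D x)" for x by (simp add: D_def TZ bcl_simps[OF bZ])
  define R where "R x = (1/2) *\<^sub>R (Z x + D x)" for x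
  have bR: "bounded_clinear R" unfolding R_def by (intro bounded_clinear_scaleR bounded_clinear_add bZ bD)
  have hR: "cinner (R x) y = cinner x (R y)" for x y by (simp add: R_def cinner_simps hD hZ)
  have TR: "T (R x) = R (T x)" for x by (simp add: R_def TZ D_def bcl_simps[OF bT])
  define N where "N = range R"
  have sN: "csubspace N" unfolding N_def by (rule csubspace_range[OF bR])
  \<comment> \<open>\<open>(Z - D) (Z + D) = 0\<close>, since \<open>Z^2 = D^2\<close> and the two
    commute.\<close>
  have ZN: "Z u = D u" if "u \<in> N" for u
  proof -
    obtain y where "u = R y" using \<open>u \<in> N\<close> by (auto simp: N_def)
    then show ?thesis by (simp add: R_def bcl_simps[OF bZ] bcl_simps[OF bD] ZZ DZ add.commute)
  qed
  have RN: "R u = D u" if "u \<in> N" for u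
    unfolding R_def ZN[OF that] by (simp flip: scaleR_2)
  have TN: "c * (norm u)\<^sup>2 \<le> Re (cinner (T u) u)" if "u \<in> N" for u
    using positive_op_nonneg[OF pZ, of u] unfolding ZN[OF that] by (simp add: D_def cinner_simps norm_sq_cinner)
  have "\<exists>k\<le>n. has_cdim N k"
  proof (rule ccontr)
    assume "\<not> ?thesis"
    then obtain M where M: "M \<subseteq> N" "has_cdim M (Suc n)" using has_cdim_dichotomy[OF sN, of n] by blast
    have "c \<le> u_number (Suc n) F" by (rule le_u_number_if_T_ge[OF M(2)]) (use TN M(1) in blast)
    then show False using c by simp
  qed
  then obtain k where k: "k \<le> n" "has_cdim N k" by blast
  obtain e where e: "orthonormal e k" "cspan (e ` {..<k}) = N" using has_cdim_orthonormal_basis[OF k(2)] by blast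
  have clN: "closed N" unfolding e(2)[symmetric] by (rule closed_cspan_finite) simp
  define p where "p x = oproj e k x" for x
  have pN: "p x \<in> N" for x unfolding p_def e(2)[symmetric] by (rule oproj_in_cspan)
  have pN': "x - p x \<in> cortho N" for x
    using diff_oproj_cortho[OF e(1), of x] unfolding e(2) p_def .
  have Rv: "R v = 0" if "v \<in> cortho N" for v
  proof -
    have "cinner (R v) w = 0" for w using corthoD[OF that, of "R w"] by (simp add: hR N_def)
    then show ?thesis using cinner_eq_zero_iff by blast
  qed
  have Tv: "Re (cinner (T v) v) \<le> c * (norm v)\<^sup>2" if "v \<in> cortho N" for v
  proof -
    have "Z v + D v = 2 *\<^sub>R R v" by (simp add: R_def)
    then have "D v = - Z v" by (simp add: Rv[OF that] add_eq_0_iff)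
    then have "Re (cinner (D v) v) \<le> 0" using positive_op_nonneg[OF pZ, of v] by simp
    then show ?thesis by (simp add: D_def cinner_simps norm_sq_cinner)
  qed
  define Y where "Y x = T x - R x" for x
  have bY: "bounded_clinear Y" unfolding Y_def by (intro bounded_clinear_diff bT bR)
  have hY: "cinner (Y x) y = cinner x (Y y)" for x y by (simp add: Y_def cinner_simps hT hR)
  have Yu: "Y u = c *\<^sub>R u" if "u \<in> N" for u by (simp add: Y_def RN[OF that] D_def)
  have Yv: "Y v = T v" if "v \<in> cortho N" for v by (simp add: Y_def Rv[OF that])
  have ortho: "cinner u v = 0" "cinner v u = 0" if "u \<in> N" "v \<in> cortho N" for u v
    using corthoD[OF that(2,1)] cinner_zero_commute[of v u] by auto
  have split_norm: "(norm x)\<^sup>2 = (norm (p x))\<^sup>2 + (norm (x - p x))\<^sup>2" for x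
    using norm_add_sq[of "p x" "x - p x"] ortho(1)[OF pN pN', of x x] by simp
  have Y_form: "Re (cinner (Y x) x) = c * (norm (p x))\<^sup>2 + Re (cinner (T (x - p x)) (x - p x))" for x
  proof -
    define u where "u = p x"
    define v where "v = x - p x"
    have uN: "u \<in> N" and vN: "v \<in> cortho N" by (simp_all add: u_def v_def pN pN')
    have x: "x = u + v" by (simp add: u_def v_def)
    have "cinner (Y v) u = 0" by (simp add: hY Yu[OF uN] cinner_simps ortho[OF uN vN])
    then have "cinner (Y x) x = c * cinner u u + cinner (T v) v"
      by (simp add: x bcl_add[OF bY] cinner_add_left cinner_add_right Yu[OF uN] cinner_scaleR_left
          ortho[OF uN vN] Yv[OF vN, symmetric])
    then have "Re (cinner (Y x) x) = c * (norm u)\<^sup>2 + Re (cinner (T v) v)" by (simp add: norm_sq_cinner)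
    then show ?thesis by (simp only: u_def v_def)
  qed
  have Y_le: "Re (cinner (Y x) x) \<le> c * (norm x)\<^sup>2" for x
    using Tv[OF pN', of x] by (simp add: Y_form split_norm[of x] distrib_left)
  have Y_ge: "sqrt a * (norm x)\<^sup>2 \<le> Re (cinner (Y x) x)" for x
    using T_ge[of "x - p x"] mult_right_mono[OF ac, of "(norm (p x))\<^sup>2"]
    by (simp add: Y_form split_norm[of x] distrib_left)
  \<comment> \<open>\<open>T K = Y\<close>, so \<open>K\<close> is what must precede
    \<open>W\<close> to make \<open>F W K\<close> the truncation. It is the identity on
    \<open>cortho N\<close>, and a contraction on \<open>N\<close>, where the form of
    \<open>T\<close> is at least \<open>c\<close>.\<close>
  define K where "K x = x - Ti (R x)" for x
  have bK: "bounded_clinear K"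
    unfolding K_def by (intro bounded_clinear_diff bounded_clinear_id bounded_clinear_comp[OF bTi bR])
  have TiR: "Ti (R x) = R (Ti x)" for x
    using TiT[of "R (Ti x)"] by (simp add: TR TTi)
  have hK: "cinner (K x) y = cinner x (K y)" for x y
    by (simp add: K_def cinner_diff_left cinner_diff_right hTi hR) (simp add: TiR)
  have TK: "T (K x) = Y x" for x by (simp add: K_def bcl_diff[OF bT] TTi Y_def)
  have Kv: "K v = v" if "v \<in> cortho N" for v by (simp add: K_def Rv[OF that] bcl_zero[OF bTi])
  have KN: "K u \<in> N" "norm (K u) \<le> norm u" if "u \<in> N" for u
  proof -
    define w where "w = Ti u"
    obtain y where "u = R y" using \<open>u \<in> N\<close> by (auto simp: N_def)
    then have wN: "w \<in> N" by (simp add: w_def TiR N_def)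
    have "K u = Ti (T (K u))" by (simp add: TiT)
    also have "\<dots> = c *\<^sub>R w" by (simp add: TK Yu[OF \<open>u \<in> N\<close>] bcl_scaleR[OF bTi] w_def)
    finally have Ku: "K u = c *\<^sub>R w" .
    show "K u \<in> N" unfolding Ku by (rule csubspace_scaleR[OF sN wN])
    have "c * norm w \<le> norm (T w)"
    proof (cases "w = 0")
      case False
      have "c * (norm w)\<^sup>2 \<le> norm (T w) * norm w"
        using TN[OF wN] Re_cinner_le[of "T w" w] by linarith
      then show ?thesis using False by (simp add: power2_eq_square)
    qed (simp add: bcl_zero[OF bT])
    then show "norm (K u) \<le> norm u" using \<open>0 < c\<close> by (simp add: Ku w_def TTi)
  qed
  have normK: "norm (K x) \<le> norm x" for x
  proof (rule power2_le_imp_le)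
    have "K x = K (p x) + (x - p x)"
      using bcl_add[OF bK, of "p x" "x - p x"] by (simp add: Kv[OF pN'])
    then have "(norm (K x))\<^sup>2 = (norm (K (p x)))\<^sup>2 + (norm (x - p x))\<^sup>2"
      using ortho(1)[OF KN(1)[OF pN] pN', of x x] by (simp add: norm_add_sq)
    also have "\<dots> \<le> (norm (p x))\<^sup>2 + (norm (x - p x))\<^sup>2"
      by (intro add_right_mono power_mono KN(2) pN) simp
    finally show "(norm (K x))\<^sup>2 \<le> (norm x)\<^sup>2" by (simp only: split_norm[of x])
  qed simp
  define C where "C x = x - K (K x)" for x
  have C_form: "Re (cinner (C x) x) = (norm x)\<^sup>2 - (norm (K x))\<^sup>2" for x
    by (simp add: C_def cinner_diff_left hK[of "K x"] norm_sq_cinner)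
  have pC: "positive_op C"
  proof (rule positive_opI)
    show "bounded_clinear C"
      unfolding C_def by (intro bounded_clinear_diff bounded_clinear_id bounded_clinear_comp[OF bK bK])
    show "hermitian C" by (simp add: hermitian_def C_def cinner_diff_left cinner_diff_right hK)
    show "0 \<le> Re (cinner (C x) x)" for x unfolding C_form using power_mono[OF normK, of x 2] by simp
  qed
  define Q where "Q = op_sqrt C"
  have pQ: "positive_op Q" unfolding Q_def by (rule positive_op_sqrt[OF pC])
  have QQ: "Q (Q x) = C x" for x unfolding Q_def by (rule op_sqrt_square[OF pC])
  note bQ = positive_op_bcl[OF pQ] and hQ = hermitianD[OF positive_op_hermitian[OF pQ]]
  have normQ: "(norm (Q x))\<^sup>2 = (norm x)\<^sup>2 - (norm (K x))\<^sup>2" for x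
    using C_form[of x] unfolding norm_sq_cinner[of "Q x"] hQ[of "Q x" x, unfolded QQ, symmetric] .
  have Qv: "Q v = 0" if "v \<in> cortho N" for v using normQ[of v] by (simp add: Kv[OF that])
  \<comment> \<open>\<open>Q\<close> is hermitian and vanishes on \<open>cortho N\<close>, so its
    range is orthogonal to \<open>cortho N\<close>; \<open>N\<close> is closed because its dimension
    is finite.\<close>
  have QN: "Q x \<in> N" for x
    by (rule cortho_cortho_subset[OF sN clN]) (simp add: hQ Qv)
  obtain q where q: "orthonormal q n" "cspan (q ` {..<n}) = {x. F x = 0}"
    using has_cdim_orthonormal_basis[OF cdim_kernel] by blast
  define J where "J x = (\<Sum>i<k. cinner x (e i) *\<^sub>C q i)" for x
  have bJ: "bounded_clinear J" unfolding J_def by (intro bounded_clinear_sum bounded_clinear_cinner)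
  have FJ: "F (J x) = 0" for x
  proof -
    have "q i \<in> {x. F x = 0}" if "i < k" for i
      unfolding q(2)[symmetric] using that k(1) by (intro complex_vector.span_base) auto
    then show ?thesis by (simp add: J_def bcl_sum[OF F] bcl_scaleC[OF F])
  qed
  have normJ: "norm (J x) = norm x" if "x \<in> N" for x
  proof -
    have "orthonormal q k" using q(1) k(1) by (auto simp: orthonormal_def)
    then have "(norm (J x))\<^sup>2 = (norm (oproj e k x))\<^sup>2"
      unfolding J_def norm_oproj_sq[OF e(1)] by (rule norm_lincomb_orthonormal)
    also have "oproj e k x = x" by (rule oproj_cspan[OF e(1)]) (simp add: e(2) that)
    finally show ?thesis by (simp add: power2_eq_iff_nonneg)
  qed
  define V where "V x = W (K x) + J (Q x)" for x
  have normV: "norm (V x) = norm x" for x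
  proof -
    \<comment> \<open>The range of \<open>W\<close> is orthogonal to the kernel of \<open>F\<close>,
      into which \<open>J\<close> maps; so the norms add by Pythagoras.\<close>
    have "cinner (W (K x)) (J (Q x)) = 0" by (simp add: cinner_W U_def FJ bcl_zero[OF bTi])
    then have "(norm (V x))\<^sup>2 = (norm x)\<^sup>2"
      by (simp add: V_def norm_add_sq norm_W normJ[OF QN] normQ)
    then show ?thesis by (simp add: power2_eq_iff_nonneg)
  qed
  have FV: "F (V x) = Y x" for x by (simp add: V_def bcl_add[OF F] FW TK FJ)
  define \<rho> where "\<rho> = max (c - 1) (1 - sqrt a)"
  \<comment> \<open>The form of \<open>Y\<close> lies between \<open>sqrt a\<close> and
    \<open>c\<close>, and for a hermitian operator this alone gives the distance to the
    identity.\<close>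
  have "norm (Y x - x) \<le> \<rho> * norm x" for x
  proof (rule hermitian_norm_le)
    show "bounded_clinear (\<lambda>x. Y x - x)" by (intro bounded_clinear_diff bounded_clinear_id bY)
    show "hermitian (\<lambda>x. Y x - x)" by (simp add: hermitian_def cinner_simps hY)
    \<comment> \<open>If \<open>c < 1\<close>, then \<open>sqrt a \<le> c\<close> makes the second
      entry positive.\<close>
    show "0 \<le> \<rho>" using ac by (auto simp: \<rho>_def)
    fix z
    have "Re (cinner (Y z - z) z) = Re (cinner (Y z) z) - (norm z)\<^sup>2"
      by (simp add: cinner_diff_left norm_sq_cinner)
    moreover have "(c - 1) * (norm z)\<^sup>2 \<le> \<rho> * (norm z)\<^sup>2" "(1 - sqrt a) * (norm z)\<^sup>2 \<le> \<rho> * (norm z)\<^sup>2"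
      by (intro mult_right_mono; simp add: \<rho>_def)+
    ultimately show "\<bar>Re (cinner (Y z - z) z)\<bar> \<le> \<rho> * (norm z)\<^sup>2"
      using Y_le[of z] Y_ge[of z] by (simp add: left_diff_distrib abs_le_iff)
  qed
  moreover have "bounded_clinear V"
    unfolding V_def by (intro bounded_clinear_add bounded_clinear_comp[OF bW bK] bounded_clinear_comp[OF bJ bQ])
  ultimately show ?thesis using normV unfolding FV[symmetric] \<rho>_def by blast
qed

section \<open>Combination of the bounds and transfer to frames\<close>

lemma close_isometry_exists:
  assumes "0 < \<epsilon>"
  shows "\<exists>V. bounded_clinear V \<and> (\<forall>h. norm (V h) = norm h) \<and> (\<forall>h. norm (F (V h) - h) \<le>
    (min (max (u_number (Suc n) F - 1) (1 - sqrt a)) (1 + m) + \<epsilon>) * norm h)"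
proof (cases "max (u_number (Suc n) F - 1) (1 - sqrt a) \<le> 1 + m")
  case True
  have "u_number (Suc n) F < u_number (Suc n) F + \<epsilon>" using assms by simp
  from upper_bound_u_number[OF this] obtain V where V: "bounded_clinear V" "\<forall>h. norm (V h) = norm h"
    "\<forall>h. norm (F (V h) - h) \<le> max (u_number (Suc n) F + \<epsilon> - 1) (1 - sqrt a) * norm h" by blast
  have "max (u_number (Suc n) F + \<epsilon> - 1) (1 - sqrt a) \<le> max (u_number (Suc n) F - 1) (1 - sqrt a) + \<epsilon>"
    using assms by (auto simp: max_def)
  then have "max (u_number (Suc n) F + \<epsilon> - 1) (1 - sqrt a) \<le>
      min (max (u_number (Suc n) F - 1) (1 - sqrt a)) (1 + m) + \<epsilon>"
    unfolding min_absorb1[OF True] .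
  then show ?thesis using V by (meson mult_right_mono norm_ge_zero order_trans)
next
  case False
  then have "min (max (u_number (Suc n) F - 1) (1 - sqrt a)) (1 + m) = 1 + m" by (intro min_absorb2) linarith
  then show ?thesis using upper_bound_m[OF assms] by simp
qed

lemma distance_coisometry_ge:
  assumes X: "bounded_clinear X" and iso: "\<And>h. X (cadjoint X h) = h"
    and r: "\<And>h. norm (F (cadjoint X h) - h) \<le> r * norm h"
  shows "min (max (u_number (Suc n) F - 1) (1 - sqrt a)) (1 + m) \<le> r"
proof (cases "r < 1 + m")
  case True
  have "norm (cadjoint X h) = norm h" for h
  proof -
    have "(norm (cadjoint X h))\<^sup>2 = (norm h)\<^sup>2" by (simp only: norm_sq_cinner cinner_cadjoint'[OF X] iso)
    then show ?thesis by (simp add: power2_eq_iff_nonneg)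
  qed
  then have "1 - sqrt a \<le> r" using r by (rule one_minus_sqrt_a_le)
  moreover have "u_number (Suc n) F \<le> r + 1"
    unfolding u_number_F
  proof (rule cSup_least)
    have "\<exists>M :: ell2 set. has_cdim M (Suc n)"
      using has_cdim_cspan_orthonormal[OF orthonormal_unit_ell2] by blast
    then show "{qmin M | M. has_cdim M (Suc n)} \<noteq> {}" by blast
    show "q \<le> r + 1" if "q \<in> {qmin M | M. has_cdim M (Suc n)}" for q
      using that qmin_le_if_close[OF X iso r True] by blast
  qed
  ultimately show ?thesis by simp
qed simp

end

text \<open>The infimum of the form of \<open>synthesis f\<close> after \<open>analysis_op f\<close>
  is itself an admissible constant, so the \<open>GREATEST\<close> is attained, and its almost
  minimisers give sharpness.\<close>

lemma optimal_lower_bound_properties: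
  fixes f :: "nat \<Rightarrow> 'h::chilbert_space"
  assumes f: "Bessel f B" and A: "0 < A" "\<And>x. A * (norm x)\<^sup>2 \<le> (norm (analysis_op f x))\<^sup>2"
    and "\<exists>x :: 'h. x \<noteq> 0"
  defines "a \<equiv> optimal_lower_bound f"
  shows "0 < a" "a * (norm x)\<^sup>2 \<le> (norm (analysis_op f x))\<^sup>2"
    "0 < \<epsilon> \<Longrightarrow> \<exists>x. x \<noteq> 0 \<and> (norm (analysis_op f x))\<^sup>2 \<le> (a + \<epsilon>) * (norm x)\<^sup>2"
proof -
  note b = bounded_clinear_analysis_op[OF f] and b' = bounded_clinear_synthesis[OF f]
  have bS: "bounded_clinear (\<lambda>x. synthesis f (analysis_op f x))" by (rule bounded_clinear_comp[OF b' b])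
  have form: "Re (cinner (synthesis f (analysis_op f x)) x) = (norm (analysis_op f x))\<^sup>2" for x
    by (simp add: synthesis_eq_cadjoint[OF f] cinner_cadjoint'[OF b] norm_sq_cinner)
  obtain x0 :: 'h where "x0 \<noteq> 0" using assms(4) by blast
  from form_infimum_exists[OF bS complex_vector.subspace_UNIV UNIV_I this]
  obtain t where t1: "\<forall>x. t * (norm x)\<^sup>2 \<le> (norm (analysis_op f x))\<^sup>2"
    and t2: "\<forall>\<epsilon>>0. \<exists>x. x \<noteq> 0 \<and> (norm (analysis_op f x))\<^sup>2 \<le> (t + \<epsilon>) * (norm x)\<^sup>2"
    unfolding form by auto
  have max: "c \<le> t" if c: "\<And>x. c * (norm x)\<^sup>2 \<le> (norm (analysis_op f x))\<^sup>2" for c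
  proof (rule field_le_epsilon)
    fix \<epsilon> :: real assume "0 < \<epsilon>"
    then obtain x where x: "x \<noteq> 0" "(norm (analysis_op f x))\<^sup>2 \<le> (t + \<epsilon>) * (norm x)\<^sup>2" using t2 by blast
    then have "c * (norm x)\<^sup>2 \<le> (t + \<epsilon>) * (norm x)\<^sup>2" using c[of x] by linarith
    then show "c \<le> t + \<epsilon>" using x(1) by simp
  qed
  have "0 < t" using max[OF A(2)] A(1) by linarith
  have "a = t"
    unfolding a_def optimal_lower_bound_def norm_analysis_op_sq[OF f, symmetric]
  proof (rule Greatest_equality)
    show "0 < t \<and> (\<forall>x. summable (\<lambda>i. (cmod (cinner x (f i)))\<^sup>2) \<and> t * (norm x)\<^sup>2 \<le> (norm (analysis_op f x))\<^sup>2)"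
      using \<open>0 < t\<close> t1 f by (simp add: Bessel_def)
  qed (use max in blast)
  then show "0 < a" "a * (norm x)\<^sup>2 \<le> (norm (analysis_op f x))\<^sup>2"
    "0 < \<epsilon> \<Longrightarrow> \<exists>x. x \<noteq> 0 \<and> (norm (analysis_op f x))\<^sup>2 \<le> (a + \<epsilon>) * (norm x)\<^sup>2"
    using \<open>0 < t\<close> t1 t2 by auto
qed

theorem theorem15:
  fixes f :: "nat \<Rightarrow> 'h::chilbert_space" and n :: nat
  assumes "separable_space (euclidean :: 'h topology)"
    and "\<not> finite_cdim (UNIV :: 'h set)"
    and "is_frame f"
    and "has_cdim {a. synthesis f a = 0} n"
  shows "frame_alpha f =
    min (max (u_number (n + 1) (synthesis f) - 1) (1 - sqrt (optimal_lower_bound f)))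
        (1 + ess_min_modulus (synthesis f))"
proof -
  obtain A B where AB: "0 < A" "0 < B" "\<forall>x. summable (\<lambda>i. (cmod (cinner x (f i)))\<^sup>2) \<and>
     A * (norm x)\<^sup>2 \<le> (\<Sum>i. (cmod (cinner x (f i)))\<^sup>2) \<and>
     (\<Sum>i. (cmod (cinner x (f i)))\<^sup>2) \<le> B * (norm x)\<^sup>2"
    using assms(3) unfolding is_frame_def by blast
  then have f: "Bessel f B" by (simp add: Bessel_def)
  have low: "A * (norm x)\<^sup>2 \<le> (norm (analysis_op f x))\<^sup>2" for x
    unfolding norm_analysis_op_sq[OF f] using AB(3) by blast
  have "\<exists>x :: 'h. x \<noteq> 0" using infinite_cdim_orthogonal[OF assms(2) finite.emptyI] by metis
  note a = optimal_lower_bound_properties[OF f AB(1) low this]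
  interpret frame_op "synthesis f" "optimal_lower_bound f" n
    by unfold_locales (use a assms(4) in \<open>simp_all add: bounded_clinear_synthesis[OF f] cadjoint_synthesis[OF f]\<close>)
  let ?F = "synthesis f"
  define \<rho> where "\<rho> = min (max (u_number (Suc n) ?F - 1) (1 - sqrt (optimal_lower_bound f))) (1 + m)"
  define S where "S = {onorm (\<lambda>h. ?F (cadjoint X h) - h) | X :: ell2 \<Rightarrow> 'h.
    bounded_clinear X \<and> X \<circ> cadjoint X = id}"
  have S_ge: "\<rho> \<le> s" if "s \<in> S" for s
  proof -
    obtain X :: "ell2 \<Rightarrow> 'h" where X: "bounded_clinear X" "X \<circ> cadjoint X = id"
      "s = onorm (\<lambda>h. ?F (cadjoint X h) - h)" using \<open>s \<in> S\<close> unfolding S_def by blast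
    have "bounded_clinear (\<lambda>h. ?F (cadjoint X h) - h)"
      by (intro bounded_clinear_diff bounded_clinear_id bounded_clinear_comp[OF F bounded_clinear_cadjoint[OF X(1)]])
    then have "norm (?F (cadjoint X h) - h) \<le> s * norm h" for h unfolding X(3) by (rule bcl_onorm)
    moreover have "X (cadjoint X h) = h" for h using fun_cong[OF X(2), of h] by simp
    ultimately show ?thesis unfolding \<rho>_def by (intro distance_coisometry_ge[OF X(1)])
  qed
  have S_le: "\<exists>s\<in>S. s \<le> \<rho> + \<epsilon>" if "0 < \<epsilon>" for \<epsilon>
  proof -
    obtain V where V: "bounded_clinear V" "\<forall>h. norm (V h) = norm h"
      "\<forall>h. norm (?F (V h) - h) \<le> (\<rho> + \<epsilon>) * norm h"
      using close_isometry_exists[OF \<open>0 < \<epsilon>\<close>] unfolding \<rho>_def by blast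
    define X where "X = cadjoint V"
    have "X \<circ> cadjoint X = id"
      using isometry_cadjoint[OF V(1)] V(2) by (simp add: X_def cadjoint_cadjoint[OF V(1)] fun_eq_iff)
    then have "onorm (\<lambda>h. ?F (V h) - h) \<in> S"
      unfolding S_def X_def using bounded_clinear_cadjoint[OF V(1)] cadjoint_cadjoint[OF V(1)] by force
    moreover have "onorm (\<lambda>h. ?F (V h) - h) \<le> \<rho> + \<epsilon>"
    proof (rule onorm_bound)
      obtain x :: 'h where "x \<noteq> 0" using \<open>\<exists>x. x \<noteq> 0\<close> by blast
      \<comment> \<open>Nonnegativity of the constant follows because it bounds a norm at a nonzero
        vector.\<close>
      have "0 \<le> (\<rho> + \<epsilon>) * norm x" by (rule order_trans[OF norm_ge_zero V(3)[rule_format]])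
      then show "0 \<le> \<rho> + \<epsilon>" using \<open>x \<noteq> 0\<close> by (simp add: zero_le_mult_iff)
    qed (use V(3) in blast)
    ultimately show ?thesis by blast
  qed
  have "Inf S = \<rho>"
  proof (rule antisym)
    show "\<rho> \<le> Inf S" using S_le[of 1] S_ge by (intro cInf_greatest) auto
    show "Inf S \<le> \<rho>"
    proof (rule field_le_epsilon)
      fix \<epsilon> :: real assume "0 < \<epsilon>"
      then obtain s where "s \<in> S" "s \<le> \<rho> + \<epsilon>" using S_le by blast
      moreover have "bdd_below S" using S_ge by (rule bdd_belowI)
      ultimately show "Inf S \<le> \<rho> + \<epsilon>" using cInf_lower[of s S] by linarith
    qed
  qed
  then show ?thesis by (simp add: frame_alpha_def S_def \<rho>_def ess_min_modulus_F)
qed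

end
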